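(* Equip each of the classical Banach spaces $\ell_p$ ($1\le p<\infty$) and $c_0$ with its canonical unconditional Schauder basis $((e_m,e_m^* ))_{m\in\mathbb{N}^*}$, and let $\mathcal{F}$ and $\mathcal{G}$ denote the canonical bases of the first and second tensor factor respectively (except in item 5, where $\mathcal{G}$ is as stated). Then the Besselian crossnorm $\alpha_{\mathcal{F},\mathcal{G}}^{Bess}$ has the following properties: 1. On $c_0\otimes c_0$, $\alpha_{\mathcal{F},\mathcal{G}}^{Bess}=\varepsilon_{\mathcal{F},\mathcal{G}}=\varepsilon$. Consequently, $c_0\otimes_{\alpha_{\mathcal{F},\mathcal{G}}^{Bess}}c_0=c_0\otimes_\varepsilon c_0\simeq c_0$. 2. On $\ell_1\otimes\ell_1$, $\alpha_{\mathcal{F},\mathcal{G}}^{Bess}=\pi_{\mathcal{F},\mathcal{G}}=\pi$. Consequently, $\ell_1\otimes_{\alpha_{\mathcal{F},\mathcal{G}}^{Bess}}\ell_1=\ell_1\otimes_\pi\ell_1\simeq\ell_1$. 3. On $\ell_2\otimes\ell_2$, $\alpha_{\mathcal{F},\mathcal{G}}^{Bess}$ is not proportional to either $\varepsilon_{\mathcal{F},\mathcal{G}}$ or $\pi_{\mathcal{F},\mathcal{G}}$ (i.e. it is not a constant multiple of $\varepsilon_{\mathcal{F},\mathcal{G}}$, and not a constant multiple of $\pi_{\mathcal{F},\mathcal{G}}$). 4. For $1\le p<\infty$, $\ell_p\otimes_{\alpha_{\mathcal{F},\mathcal{G}}^{Bess}}\ell_1\simeq\ell_p(\ell_1)$. 5.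 If $F$ is a Banach space and $\mathcal{G}=((x_n,y_n^* ))_{n\in\mathbb{N}^*}$ is a USB for $F$ (and $\mathcal{F}$ is the canonical basis of $c_0$), then $c_0\otimes_{\alpha_{\mathcal{F},\mathcal{G}}^{Bess}}F\simeq c_0(F)$. Here $\simeq$ denotes isometric isomorphism in all items.
   Context: $\mathbb{K}=\mathbb{R}$ or $\mathbb{C}$ is the scalar field; $\mathbb{N}^*=\{1,2,3,\dots\}$; $E^*$ is the topological dual of $E$; $E\otimes F$ is the algebraic tensor product. $c_0$ and $\ell_p$ carry their usual norms; $e_m$ is the $m$-th unit vector and $e_m^*$ the $m$-th coordinate functional. For a Banach space $X$ with norm $\|\cdot\|_X$: $c_0(X)$ is the space of sequences $(x^i)$ in $X$ with $\|x^i\|_X\to0$, normed by $\sup_i\|x^i\|_X$; $\ell_p(X)$ is the space of sequences in $X$ with $\sum_i\|x^i\|_X^p<\infty$, normed by $(\sum_i\|x^i\|_X^p)^{1/p}$. A sequence of pairs $((a_m,b_m^* ))_m\subset E\times E^*$ is an unconditional Schauder basis (USB) for $E$ if every $x\in E$ has a unique expansion in scalar multiples of the $a_m$, this expansion is $x=\sum_m b_m^*(x)a_m$, and the series converges unconditionally for every $x$. Let $\mathcal{F}=((a_m,b_m^* ))_m$ and $\mathcal{G}=((x_n,y_n^* ))_n$ be USBs of Banach spaces $E$ and $F$. For a finite sum of elementary tensors put $$Bess\Big(\sum_{r=1}^R x^r\otimes y^r\Big):=\sup_{\|f^*\|_{E^*}\le 1,\ \|g^*\|_{F^*}\le 1}\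 \sum_{r=1}^R\sum_{m,n=1}^\infty\left|b_m^*(x^r)\,y_n^*(y^r)\,f^*(a_m)\,g^*(x_n)\right|.$$ The Besselian crossnorm of $u\in E\otimes F$ is $$\alpha_{\mathcal{F},\mathcal{G}}^{Bess}(u):=\inf\Big\{Bess\Big(\sum_{r=1}^R x^r\otimes y^r\Big): u=\sum_{r=1}^R x^r\otimes y^r\Big\},$$ the infimum over all finite representations of $u$; it is a norm on $E\otimes F$. The Besselian norm on $E$ is $\|x\|^{Bess}_{E,\mathcal{F}}:=\sup_{\|f^*\|_{E^*}\le1}\sum_m|b_m^*(x)f^*(a_m)|$, an equivalent norm on $E$; likewise $\|\cdot\|^{Bess}_{F,\mathcal{G}}$ on $F$. For Banach spaces $X,Y$ and $u=\sum_r x^r\otimes y^r\in X\otimes Y$, the injective norm is $\varepsilon(u)=\sup_{\|f^*\|_{X^*}\le1,\|g^*\|_{Y^*}\le1}|\sum_r f^*(x^r)g^*(y^r)|$ and the projective norm is $\pi(u)=\inf\{\sum_r\|x^r\|_X\|y^r\|_Y:u=\sum_r x^r\otimes y^r\}$. Here $\varepsilon,\pi$ are computed with the original norms of the factors, while $\varepsilon_{\mathcal{F},\mathcal{G}}$ and $\pi_{\mathcal{F},\mathcal{G}}$ are the injective and projective norms on the tensor product of $(E,\|\cdot\|^{Bess}_{E,\mathcal{F}})$ and $(F,\|\cdot\|^{Bess}_{F,\mathcal{G}})$. For a norm $\alpha$ on $E\otimes F$, $E\otimes_\alpha F$ denotes the completion of $(E\otimes F,\alpha)$.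
   Formalization: In item 5 the isometric isomorphism is proved onto c_0(F) with F carrying its Besselian norm; for the original norm of F, where the isometric claim can fail (e.g. F = c with basis 1, e_1, e_2, ...), only a topological linear isomorphism with c_0(F) is stated. *)

theory Defs
  imports "HOL-Analysis.Analysis"
begin

section \<open>The scalar field\<close>

text \<open>
  Up to isometric isomorphism of normed fields, the only instances of the following class are
  the real and the complex numbers.
\<close>

class real_or_complex = real_normed_field + banach +
  assumes real_or_complex:
    "\<exists>\<phi> :: 'a \<Rightarrow> complex.
       (\<forall>x y. \<phi> (x + y) = \<phi> x + \<phi> y) \<and> (\<forall>x y. \<phi> (x * y) = \<phi> x * \<phi> y) \<and>
       (\<forall>r. \<phi> (r *\<^sub>R 1) = of_real r) \<and> (\<forall>x. norm (\<phi> x) = norm x) \<and>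
       (range \<phi> = \<real> \<or> range \<phi> = UNIV)"

instance real :: real_or_complex
proof
  show "\<exists>\<phi> :: real \<Rightarrow> complex.
       (\<forall>x y. \<phi> (x + y) = \<phi> x + \<phi> y) \<and> (\<forall>x y. \<phi> (x * y) = \<phi> x * \<phi> y) \<and>
       (\<forall>r. \<phi> (r *\<^sub>R 1) = of_real r) \<and> (\<forall>x. norm (\<phi> x) = norm x) \<and>
       (range \<phi> = \<real> \<or> range \<phi> = UNIV)"
    by (intro exI[of _ complex_of_real]) (auto simp: Reals_def)
qed

instance complex :: real_or_complex
proof
  show "\<exists>\<phi> :: complex \<Rightarrow> complex.
       (\<forall>x y. \<phi> (x + y) = \<phi> x + \<phi> y) \<and> (\<forall>x y. \<phi> (x * y) = \<phi> x * \<phi> y) \<and>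
       (\<forall>r. \<phi> (r *\<^sub>R 1) = of_real r) \<and> (\<forall>x. norm (\<phi> x) = norm x) \<and>
       (range \<phi> = \<real> \<or> range \<phi> = UNIV)"
    by (intro exI[of _ "\<lambda>z. z"]) (auto simp: of_real_def)
qed


section \<open>Normed spaces\<close>

text \<open>
  Spaces are records with an explicit carrier: the sequence spaces depend on a real parameter,
  the distribution has no type class of complex normed spaces, and one and the same carrier is
  considered under several norms.
\<close>

record ('k, 'a) nspace =
  carrier :: "'a set"
  vadd :: "'a \<Rightarrow> 'a \<Rightarrow> 'a"
  vzero :: "'a"
  smul :: "'k \<Rightarrow> 'a \<Rightarrow> 'a"
  nrm :: "'a \<Rightarrow> real"

definition vdist :: "('k::real_or_complex, 'a) nspace \<Rightarrow> 'a \<Rightarrow> 'a \<Rightarrow> real" where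
  "vdist X x y = nrm X (vadd X x (smul X (- 1) y))"

locale normed_space =
  fixes X :: "('k::real_or_complex, 'a) nspace"
  assumes add_closed: "\<lbrakk>x \<in> carrier X; y \<in> carrier X\<rbrakk> \<Longrightarrow> vadd X x y \<in> carrier X"
    and zero_closed: "vzero X \<in> carrier X"
    and smul_closed: "x \<in> carrier X \<Longrightarrow> smul X c x \<in> carrier X"
    and add_assoc: "\<lbrakk>x \<in> carrier X; y \<in> carrier X; z \<in> carrier X\<rbrakk>
          \<Longrightarrow> vadd X (vadd X x y) z = vadd X x (vadd X y z)"
    and add_commute: "\<lbrakk>x \<in> carrier X; y \<in> carrier X\<rbrakk> \<Longrightarrow> vadd X x y = vadd X y x"
    and add_zero: "x \<in> carrier X \<Longrightarrow> vadd X x (vzero X) = x"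
    and add_inverse: "x \<in> carrier X \<Longrightarrow> vadd X x (smul X (- 1) x) = vzero X"
    and smul_add_right: "\<lbrakk>x \<in> carrier X; y \<in> carrier X\<rbrakk>
          \<Longrightarrow> smul X c (vadd X x y) = vadd X (smul X c x) (smul X c y)"
    and smul_add_left: "x \<in> carrier X \<Longrightarrow> smul X (c + d) x = vadd X (smul X c x) (smul X d x)"
    and smul_smul: "x \<in> carrier X \<Longrightarrow> smul X c (smul X d x) = smul X (c * d) x"
    and smul_one: "x \<in> carrier X \<Longrightarrow> smul X 1 x = x"
    and nrm_nonneg: "x \<in> carrier X \<Longrightarrow> 0 \<le> nrm X x"
    and nrm_eq_zero: "x \<in> carrier X \<Longrightarrow> nrm X x = 0 \<longleftrightarrow> x = vzero X"
    and nrm_triangle: "\<lbrakk>x \<in> carrier X; y \<in> carrier X\<rbrakk> \<Longrightarrow> nrm X (vadd X x y) \<le> nrm X x + nrm X y"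
    and nrm_smul: "x \<in> carrier X \<Longrightarrow> nrm X (smul X c x) = norm c * nrm X x"

definition converges_to :: "('k::real_or_complex, 'a) nspace \<Rightarrow> (nat \<Rightarrow> 'a) \<Rightarrow> 'a \<Rightarrow> bool" where
  "converges_to X s x \<longleftrightarrow> (\<lambda>n. vdist X (s n) x) \<longlonglongrightarrow> 0"

definition cauchy_in :: "('k::real_or_complex, 'a) nspace \<Rightarrow> (nat \<Rightarrow> 'a) \<Rightarrow> bool" where
  "cauchy_in X s \<longleftrightarrow> (\<forall>n. s n \<in> carrier X) \<and>
     (\<forall>e>0. \<exists>N. \<forall>m\<ge>N. \<forall>n\<ge>N. vdist X (s m) (s n) < e)"

locale banach_space = normed_space X for X :: "('k::real_or_complex, 'a) nspace" +
  assumes complete: "cauchy_in X s \<Longrightarrow> \<exists>x\<in>carrier X. converges_to X s x"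

definition linear_map ::
  "('k::real_or_complex, 'a) nspace \<Rightarrow> ('k, 'b) nspace \<Rightarrow> ('a \<Rightarrow> 'b) \<Rightarrow> bool" where
  "linear_map X Y T \<longleftrightarrow> (\<forall>x\<in>carrier X. T x \<in> carrier Y) \<and>
     (\<forall>x\<in>carrier X. \<forall>y\<in>carrier X. T (vadd X x y) = vadd Y (T x) (T y)) \<and>
     (\<forall>c. \<forall>x\<in>carrier X. T (smul X c x) = smul Y c (T x))"

definition isometrically_isomorphic ::
  "('k::real_or_complex, 'a) nspace \<Rightarrow> ('k, 'b) nspace \<Rightarrow> bool" where
  "isometrically_isomorphic X Y \<longleftrightarrow>
     (\<exists>T. linear_map X Y T \<and> bij_betw T (carrier X) (carrier Y) \<and>
          (\<forall>x\<in>carrier X. nrm Y (T x) = nrm X x))"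

definition linearly_homeomorphic ::
  "('k::real_or_complex, 'a) nspace \<Rightarrow> ('k, 'b) nspace \<Rightarrow> bool" where
  "linearly_homeomorphic X Y \<longleftrightarrow>
     (\<exists>T. linear_map X Y T \<and> bij_betw T (carrier X) (carrier Y) \<and>
          (\<exists>c>0. \<exists>C>0. \<forall>x\<in>carrier X. c * nrm X x \<le> nrm Y (T x) \<and> nrm Y (T x) \<le> C * nrm X x))"

definition scalars :: "('k::real_or_complex, 'k) nspace" where
  "scalars = \<lparr>carrier = UNIV, vadd = (+), vzero = 0, smul = (*), nrm = norm\<rparr>"

text \<open>Functionals are only constrained on the carrier; their values elsewhere are never used.\<close>

definition dual :: "('k::real_or_complex, 'a) nspace \<Rightarrow> ('a \<Rightarrow> 'k) set" where
  "dual X = {f. linear_map X scalars f \<and> (\<exists>C. \<forall>x\<in>carrier X. norm (f x) \<le> C * nrm X x)}"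

definition dual_norm :: "('k::real_or_complex, 'a) nspace \<Rightarrow> ('a \<Rightarrow> 'k) \<Rightarrow> real" where
  "dual_norm X f = (SUP x\<in>{x \<in> carrier X. nrm X x \<le> 1}. norm (f x))"

definition dual_ball :: "('k::real_or_complex, 'a) nspace \<Rightarrow> ('a \<Rightarrow> 'k) set" where
  "dual_ball X = {f \<in> dual X. dual_norm X f \<le> 1}"


section \<open>Sequence spaces\<close>

definition c0_space :: "('k::real_or_complex, 'a) nspace \<Rightarrow> ('k, nat \<Rightarrow> 'a) nspace" where
  "c0_space X = \<lparr>carrier = {x. (\<forall>i. x i \<in> carrier X) \<and> (\<lambda>i. nrm X (x i)) \<longlonglongrightarrow> 0},
     vadd = (\<lambda>x y i. vadd X (x i) (y i)), vzero = (\<lambda>i. vzero X),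
     smul = (\<lambda>c x i. smul X c (x i)), nrm = (\<lambda>x. SUP i. nrm X (x i))\<rparr>"

definition lp_space ::
  "real \<Rightarrow> ('k::real_or_complex, 'a) nspace \<Rightarrow> ('k, nat \<Rightarrow> 'a) nspace" where
  "lp_space p X =
     \<lparr>carrier = {x. (\<forall>i. x i \<in> carrier X) \<and> summable (\<lambda>i. nrm X (x i) powr p)},
      vadd = (\<lambda>x y i. vadd X (x i) (y i)), vzero = (\<lambda>i. vzero X),
      smul = (\<lambda>c x i. smul X c (x i)), nrm = (\<lambda>x. (\<Sum>i. nrm X (x i) powr p) powr (1 / p))\<rparr>"

abbreviation c0 :: "('k::real_or_complex, nat \<Rightarrow> 'k) nspace" where
  "c0 \<equiv> c0_space scalars"

abbreviation ell :: "real \<Rightarrow> ('k::real_or_complex, nat \<Rightarrow> 'k) nspace" where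
  "ell p \<equiv> lp_space p scalars"


section \<open>Unconditional Schauder bases\<close>

type_synonym ('k, 'a) basis = "nat \<Rightarrow> 'a \<times> ('a \<Rightarrow> 'k)"

primrec partial_sum :: "('k::real_or_complex, 'a) nspace \<Rightarrow> (nat \<Rightarrow> 'a) \<Rightarrow> nat \<Rightarrow> 'a" where
  "partial_sum X s 0 = vzero X"
| "partial_sum X s (Suc n) = vadd X (partial_sum X s n) (s n)"

definition series_sums ::
  "('k::real_or_complex, 'a) nspace \<Rightarrow> (nat \<Rightarrow> 'a) \<Rightarrow> 'a \<Rightarrow> bool" where
  "series_sums X s x \<longleftrightarrow> converges_to X (partial_sum X s) x"

definition USB :: "('k::real_or_complex, 'a) nspace \<Rightarrow> ('k, 'a) basis \<Rightarrow> bool" where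
  "USB X B \<longleftrightarrow>
     (\<forall>m. fst (B m) \<in> carrier X \<and> snd (B m) \<in> dual X) \<and>
     (\<forall>x\<in>carrier X.
        (\<forall>c. series_sums X (\<lambda>m. smul X (c m) (fst (B m))) x \<longleftrightarrow> (\<forall>m. c m = snd (B m) x)) \<and>
        (\<forall>\<sigma>. bij \<sigma> \<longrightarrow> series_sums X (\<lambda>m. smul X (snd (B (\<sigma> m)) x) (fst (B (\<sigma> m)))) x))"

definition unit_basis :: "('k::real_or_complex, nat \<Rightarrow> 'k) basis" where
  "unit_basis m = (\<lambda>i. if i = m then 1 else 0, \<lambda>x. x m)"

definition bess_norm ::
  "('k::real_or_complex, 'a) nspace \<Rightarrow> ('k, 'a) basis \<Rightarrow> 'a \<Rightarrow> ennreal" where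
  "bess_norm X B x =
     (SUP f\<in>dual_ball X. \<Sum>m. ennreal (norm (snd (B m) x * f (fst (B m)))))"

definition bess_space ::
  "('k::real_or_complex, 'a) nspace \<Rightarrow> ('k, 'a) basis \<Rightarrow> ('k, 'a) nspace" where
  "bess_space X B = X\<lparr>nrm := \<lambda>x. enn2real (bess_norm X B x)\<rparr>"


section \<open>Algebraic tensor products\<close>

text \<open>
  A list \<open>[(x\<^sub>1, y\<^sub>1), \<dots>, (x\<^sub>R, y\<^sub>R)]\<close> is the formal sum of the elementary tensors of its entries,
  with \<open>@\<close> as addition. The tensor product is the quotient of these formal sums by the
  congruence that makes addition commutative and the pairing of \<open>x\<close> and \<open>y\<close> bilinear, so an
  element of it is the set of all its finite representations.
\<close>

inductive tensor_eq ::
  "('k::real_or_complex, 'a) nspace \<Rightarrow> ('k, 'b) nspace \<Rightarrow> ('a \<times> 'b) list \<Rightarrow> ('a \<times> 'b) list \<Rightarrow> bool"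
  for X :: "('k::real_or_complex, 'a) nspace" and Y :: "('k, 'b) nspace"
where
  refl: "set s \<subseteq> carrier X \<times> carrier Y \<Longrightarrow> tensor_eq X Y s s"
| sym: "tensor_eq X Y s t \<Longrightarrow> tensor_eq X Y t s"
| trans: "\<lbrakk>tensor_eq X Y s t; tensor_eq X Y t u\<rbrakk> \<Longrightarrow> tensor_eq X Y s u"
| append: "\<lbrakk>tensor_eq X Y s s'; tensor_eq X Y t t'\<rbrakk> \<Longrightarrow> tensor_eq X Y (s @ t) (s' @ t')"
| commute: "\<lbrakk>set s \<subseteq> carrier X \<times> carrier Y; set t \<subseteq> carrier X \<times> carrier Y\<rbrakk>
    \<Longrightarrow> tensor_eq X Y (s @ t) (t @ s)"
| add_left: "\<lbrakk>x \<in> carrier X; x' \<in> carrier X; y \<in> carrier Y\<rbrakk>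
    \<Longrightarrow> tensor_eq X Y [(vadd X x x', y)] [(x, y), (x', y)]"
| add_right: "\<lbrakk>x \<in> carrier X; y \<in> carrier Y; y' \<in> carrier Y\<rbrakk>
    \<Longrightarrow> tensor_eq X Y [(x, vadd Y y y')] [(x, y), (x, y')]"
| scale: "\<lbrakk>x \<in> carrier X; y \<in> carrier Y\<rbrakk>
    \<Longrightarrow> tensor_eq X Y [(smul X c x, y)] [(x, smul Y c y)]"
| zero: "y \<in> carrier Y \<Longrightarrow> tensor_eq X Y [(vzero X, y)] []"

definition tensor_class ::
  "('k::real_or_complex, 'a) nspace \<Rightarrow> ('k, 'b) nspace \<Rightarrow> ('a \<times> 'b) list \<Rightarrow> ('a \<times> 'b) list set"
where
  "tensor_class X Y s = {t. tensor_eq X Y s t}"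

definition tensor ::
  "('k::real_or_complex, 'a) nspace \<Rightarrow> ('k, 'b) nspace \<Rightarrow> ('a \<times> 'b) list set set" where
  "tensor X Y = tensor_class X Y ` lists (carrier X \<times> carrier Y)"

definition rep :: "'a set \<Rightarrow> 'a" where
  "rep u = (SOME s. s \<in> u)"

text \<open>Norms on the tensor product take extended values, so that no supremum or sum is a junk value.\<close>

definition tensor_space ::
  "('k::real_or_complex, 'a) nspace \<Rightarrow> ('k, 'b) nspace \<Rightarrow> (('a \<times> 'b) list set \<Rightarrow> ennreal)
     \<Rightarrow> ('k, ('a \<times> 'b) list set) nspace" where
  "tensor_space X Y \<alpha> =
     \<lparr>carrier = tensor X Y,
      vadd = (\<lambda>u v. tensor_class X Y (rep u @ rep v)),
      vzero = tensor_class X Y [],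
      smul = (\<lambda>c u. tensor_class X Y (map (\<lambda>(x, y). (smul X c x, y)) (rep u))),
      nrm = restrict (\<lambda>u. enn2real (\<alpha> u)) (tensor X Y)\<rparr>"

definition injective_norm ::
  "('k::real_or_complex, 'a) nspace \<Rightarrow> ('k, 'b) nspace \<Rightarrow> ('a \<times> 'b) list set \<Rightarrow> ennreal" where
  "injective_norm X Y u =
     (SUP (f, g)\<in>dual_ball X \<times> dual_ball Y. ennreal (norm (\<Sum>(x, y)\<leftarrow>rep u. f x * g y)))"

definition projective_norm ::
  "('k::real_or_complex, 'a) nspace \<Rightarrow> ('k, 'b) nspace \<Rightarrow> ('a \<times> 'b) list set \<Rightarrow> ennreal" where
  "projective_norm X Y u = (INF s\<in>u. \<Sum>(x, y)\<leftarrow>s. ennreal (nrm X x * nrm Y y))"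

definition bess ::
  "('k::real_or_complex, 'a) nspace \<Rightarrow> ('k, 'a) basis \<Rightarrow> ('k, 'b) nspace \<Rightarrow> ('k, 'b) basis
     \<Rightarrow> ('a \<times> 'b) list \<Rightarrow> ennreal" where
  "bess X A Y B s =
     (SUP (f, g)\<in>dual_ball X \<times> dual_ball Y.
        \<Sum>(x, y)\<leftarrow>s. \<Sum>m. \<Sum>n.
          ennreal (norm (snd (A m) x * snd (B n) y * f (fst (A m)) * g (fst (B n)))))"

definition bess_crossnorm ::
  "('k::real_or_complex, 'a) nspace \<Rightarrow> ('k, 'a) basis \<Rightarrow> ('k, 'b) nspace \<Rightarrow> ('k, 'b) basis
     \<Rightarrow> ('a \<times> 'b) list set \<Rightarrow> ennreal" where
  "bess_crossnorm X A Y B u = (INF s\<in>u. bess X A Y B s)"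


section \<open>Completion\<close>

definition completion_class ::
  "('k::real_or_complex, 'a) nspace \<Rightarrow> (nat \<Rightarrow> 'a) \<Rightarrow> (nat \<Rightarrow> 'a) set" where
  "completion_class X s = {t. cauchy_in X t \<and> (\<lambda>n. vdist X (s n) (t n)) \<longlonglongrightarrow> 0}"

definition completion ::
  "('k::real_or_complex, 'a) nspace \<Rightarrow> ('k, (nat \<Rightarrow> 'a) set) nspace" where
  "completion X =
     \<lparr>carrier = completion_class X ` {s. cauchy_in X s},
      vadd = (\<lambda>U V. completion_class X (\<lambda>n. vadd X (rep U n) (rep V n))),
      vzero = completion_class X (\<lambda>n. vzero X),
      smul = (\<lambda>c U. completion_class X (\<lambda>n. smul X c (rep U n))),
      nrm = (\<lambda>U. lim (\<lambda>n. nrm X (rep U n)))\<rparr>"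

end

theory Submission
  imports Defs
begin

text \<open>
  Let \<open>S\<close> be \<open>c\<^sub>0\<close> or \<open>\<ell>\<^sub>p\<close> with its unit vectors \<open>e\<^sub>i\<close>, and \<open>F\<close> a space with a basis \<open>G\<close>. A tensor
  \<open>u = \<Sum>\<^sub>r x\<^sup>r \<otimes> y\<^sup>r\<close> in \<open>S \<otimes> F\<close> has coefficients \<open>u\<^sub>i = \<Sum>\<^sub>r x\<^sup>r(i) y\<^sup>r\<close> in \<open>F\<close>, which do not depend on the
  representation. In all isometric statements the Besselian crossnorm of \<open>u\<close> is the norm of the
  sequence \<open>(u\<^sub>i)\<close> in \<open>S(F)\<close>, where \<open>F\<close> carries its Besselian norm \<open>\<parallel>\<cdot>\<parallel>\<close>. Finitely supported sequences
  are coefficients, so \<open>S \<otimes> F\<close> is then dense in \<open>S(F)\<close>, which is its completion.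

  Upper estimate: \<open>u\<close> is represented by \<open>\<Sum>\<^sub>i\<^sub><\<^sub>n e\<^sub>i \<otimes> u\<^sub>i\<close> plus the tails of the \<open>x\<^sup>r\<close> tensored with the \<open>y\<^sup>r\<close>
  (\<open>tensor_eq_expansion\<close>). The remainder is small in the projective norm, and the Besselian sum of
  the main part is at most \<open>\<Sum>\<^sub>i |f(e\<^sub>i)| \<parallel>u\<^sub>i\<parallel>\<close> for a functional \<open>f\<close> in the dual ball of \<open>S\<close>; turning the
  signs of the summands bounds this by the norm of \<open>(\<parallel>u\<^sub>i\<parallel>)\<close> in \<open>S\<close> (\<open>dual_ball_pairing\<close>,
  \<open>le_nrm_coeff\<close>). The same argument bounds the injective norm on \<open>c\<^sub>0 \<otimes> c\<^sub>0\<close> and the projective norm on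
  \<open>\<ell>\<^sub>1 \<otimes> \<ell>\<^sub>1\<close>.

  Lower estimate: for functionals \<open>f\<close>, \<open>g\<close> in the dual balls the Besselian sum of any representation
  dominates \<open>\<Sum>\<^sub>i |f(e\<^sub>i)| \<Sum>\<^sub>n |y\<^sub>n\<^sup>*(u\<^sub>i) g(x\<^sub>n)|\<close> (\<open>pairing_le_bess\<close>). For \<open>S = c\<^sub>0\<close> take coordinate functionals
  for \<open>f\<close>; for \<open>F = \<ell>\<^sub>1\<close> take for \<open>g\<close> the summation functional, which computes all norms \<open>\<parallel>u\<^sub>i\<parallel>\<close>
  simultaneously, and for \<open>f\<close> a functional that norms the sequence \<open>(\<parallel>u\<^sub>i\<parallel>)\<close>.

  For a general \<open>F\<close> the Besselian norm has to be equivalent to the original one. It dominates the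
  original norm by the Hahn-Banach theorem (\<open>norming_functional\<close>). It is bounded by a multiple of
  it because unconditional convergence bounds the sums \<open>\<Sum>\<^sub>m |b\<^sub>m\<^sup>*(x) f(a\<^sub>m)|\<close> for each \<open>x\<close>, uniformly in \<open>f\<close>
  (\<open>unconditional_bounded\<close>), and hence by uniform boundedness also uniformly in \<open>x\<close>.

  On \<open>\<ell>\<^sub>2 \<otimes> \<ell>\<^sub>2\<close> the Besselian crossnorm sees only the moduli of the matrix entries: it separates
  from the injective norm on the matrix with rows \<open>(1, 1)\<close> and \<open>(1, -1)\<close>, and from the projective
  norm on the identity matrix of size two.
\<close>


section \<open>Normed spaces on a carrier\<close>

lemma null_squeeze:
  fixes f g :: "nat \<Rightarrow> real"
  assumes "g \<longlonglongrightarrow> 0" "\<And>n. f n \<le> g n" "\<And>n. 0 \<le> f n"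
  shows "f \<longlonglongrightarrow> 0"
  by (rule tendsto_sandwich[OF _ _ tendsto_const assms(1)]) (use assms in auto)

context normed_space
begin

lemma smul_zero_left: "x \<in> carrier X \<Longrightarrow> smul X 0 x = vzero X"
  using smul_add_left[of x 1 "-1"] add_inverse[of x] smul_one[of x] by simp

lemma smul_zero_right: "smul X c (vzero X) = vzero X"
  by (metis mult_zero_right smul_smul smul_zero_left zero_closed)

lemma zero_add: "x \<in> carrier X \<Longrightarrow> vadd X (vzero X) x = x"
  using add_commute add_zero zero_closed by metis

lemma add_left_commute:
  "\<lbrakk>x \<in> carrier X; y \<in> carrier X; z \<in> carrier X\<rbrakk> \<Longrightarrow> vadd X x (vadd X y z) = vadd X y (vadd X x z)"
  using add_commute add_assoc by metis

lemmas closed = add_closed zero_closed smul_closed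
lemmas add_ac = add_assoc add_commute add_left_commute

lemma nrm_zero: "nrm X (vzero X) = 0"
  using nrm_eq_zero zero_closed by blast

lemma add_inverse_left: "x \<in> carrier X \<Longrightarrow> vadd X (smul X (- 1) x) x = vzero X"
  using add_inverse add_commute smul_closed by metis

lemma add_inverse_cancel:
  "\<lbrakk>x \<in> carrier X; y \<in> carrier X\<rbrakk> \<Longrightarrow> vadd X x (vadd X (smul X (- 1) x) y) = y"
  by (metis add_assoc add_inverse smul_closed zero_add)

lemma add_inverse_cancel':
  "\<lbrakk>x \<in> carrier X; y \<in> carrier X\<rbrakk> \<Longrightarrow> vadd X (smul X (- 1) x) (vadd X x y) = y"
  by (metis add_assoc add_inverse_left smul_closed zero_add)

lemma vdist_nonneg: "\<lbrakk>x \<in> carrier X; y \<in> carrier X\<rbrakk> \<Longrightarrow> 0 \<le> vdist X x y"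
  unfolding vdist_def by (intro nrm_nonneg closed)

lemma vdist_refl: "x \<in> carrier X \<Longrightarrow> vdist X x x = 0"
  unfolding vdist_def by (simp add: add_inverse nrm_zero)

lemma vdist_zero_right: "x \<in> carrier X \<Longrightarrow> vdist X x (vzero X) = nrm X x"
  unfolding vdist_def by (simp add: smul_zero_right add_zero)

lemma vdist_sym: assumes "x \<in> carrier X" "y \<in> carrier X" shows "vdist X x y = vdist X y x"
proof -
  have "vadd X x (smul X (- 1) y) = smul X (- 1) (vadd X y (smul X (- 1) x))"
    using assms by (simp add: smul_add_right closed smul_smul smul_one add_commute)
  then show ?thesis
    unfolding vdist_def using assms by (simp add: nrm_smul closed)
qed

lemma vdist_triangle:
  assumes "x \<in> carrier X" "y \<in> carrier X" "z \<in> carrier X"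
  shows "vdist X x z \<le> vdist X x y + vdist X y z"
proof -
  have "vadd X x (smul X (- 1) z)
      = vadd X (vadd X x (smul X (- 1) y)) (vadd X y (smul X (- 1) z))"
    using assms by (simp add: closed add_assoc add_inverse_cancel')
  then show ?thesis
    unfolding vdist_def using assms nrm_triangle by (simp add: closed)
qed

lemma vdist_eq_zero: assumes "x \<in> carrier X" "y \<in> carrier X" "vdist X x y = 0" shows "x = y"
proof -
  have "vadd X x (smul X (- 1) y) = vzero X"
    using assms nrm_eq_zero unfolding vdist_def by (simp add: closed)
  then have "vadd X (vadd X x (smul X (- 1) y)) y = y" using assms zero_add by simp
  then show ?thesis using assms by (simp add: closed add_assoc add_inverse_left add_zero)
qed

lemma nrm_le_vdist:
  assumes "x \<in> carrier X" "y \<in> carrier X" shows "nrm X x \<le> nrm X y + vdist X x y"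
proof -
  have "x = vadd X y (vadd X x (smul X (- 1) y))"
    using assms by (simp add: closed add_left_commute add_inverse add_zero)
  then show ?thesis
    unfolding vdist_def using assms nrm_triangle[of y "vadd X x (smul X (- 1) y)"]
    by (simp add: closed)
qed

lemma abs_nrm_diff_le:
  assumes "x \<in> carrier X" "y \<in> carrier X" shows "\<bar>nrm X x - nrm X y\<bar> \<le> vdist X x y"
  using nrm_le_vdist[OF assms] nrm_le_vdist[OF assms(2,1)] vdist_sym[OF assms] by linarith

lemma vdist_add:
  assumes "x \<in> carrier X" "y \<in> carrier X" "x' \<in> carrier X" "y' \<in> carrier X"
  shows "vdist X (vadd X x y) (vadd X x' y') \<le> vdist X x x' + vdist X y y'"
proof -
  have "vadd X (vadd X x y) (smul X (- 1) (vadd X x' y'))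
     = vadd X (vadd X x (smul X (- 1) x')) (vadd X y (smul X (- 1) y'))"
    using assms by (simp add: closed smul_add_right add_assoc add_left_commute)
  then show ?thesis unfolding vdist_def using assms nrm_triangle by (simp add: closed)
qed

lemma vdist_smul:
  assumes "x \<in> carrier X" "y \<in> carrier X"
  shows "vdist X (smul X c x) (smul X c y) = norm c * vdist X x y"
proof -
  have "vadd X (smul X c x) (smul X (- 1) (smul X c y)) = smul X c (vadd X x (smul X (- 1) y))"
    using assms by (simp add: closed smul_add_right smul_smul)
  then show ?thesis unfolding vdist_def using assms nrm_smul by (simp add: closed)
qed

lemma converges_unique:
  assumes "\<And>n. s n \<in> carrier X" "x \<in> carrier X" "y \<in> carrier X"
    and "(\<lambda>n. vdist X (s n) x) \<longlonglongrightarrow> 0" "(\<lambda>n. vdist X (s n) y) \<longlonglongrightarrow> 0"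
  shows "x = y"
proof -
  have "vdist X x y \<le> vdist X (s n) x + vdist X (s n) y" for n
    using vdist_triangle[of x "s n" y] vdist_sym assms by simp
  moreover have "(\<lambda>n. vdist X (s n) x + vdist X (s n) y) \<longlonglongrightarrow> 0 + 0"
    by (intro tendsto_add assms)
  ultimately have "vdist X x y \<le> 0"
    using LIMSEQ_le_const by fastforce
  then show ?thesis using assms vdist_eq_zero vdist_nonneg by (meson antisym)
qed

lemma partial_sum_closed: "(\<And>m. v m \<in> carrier X) \<Longrightarrow> partial_sum X v n \<in> carrier X"
  by (induction n) (auto simp: closed)

text \<open>
  The dual norm is a supremum over the unit ball, so the estimate elsewhere follows by scaling.
\<close>

lemma dual_ball_le:
  assumes "f \<in> dual_ball X" "x \<in> carrier X" shows "norm (f x) \<le> nrm X x"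
proof -
  obtain C where C: "\<And>x. x \<in> carrier X \<Longrightarrow> norm (f x) \<le> C * nrm X x"
    and lin: "linear_map X scalars f"
    using assms unfolding dual_ball_def dual_def by auto
  have bdd: "bdd_above ((\<lambda>x. norm (f x)) ` {x \<in> carrier X. nrm X x \<le> 1})"
  proof (rule bdd_aboveI2)
    fix x assume x: "x \<in> {x \<in> carrier X. nrm X x \<le> 1}"
    have "norm (f x) \<le> \<bar>C\<bar> * nrm X x"
      using C[of x] x nrm_nonneg[of x] by (smt (verit) mem_Collect_eq mult_right_mono)
    also have "\<dots> \<le> \<bar>C\<bar> * 1" by (rule mult_left_mono) (use x in auto)
    finally show "norm (f x) \<le> \<bar>C\<bar>" by simp
  qed
  show ?thesis
  proof (cases "nrm X x = 0")
    case True
    then show ?thesis using C[OF assms(2)] by simp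
  next
    case False
    then have pos: "nrm X x > 0" using nrm_nonneg assms(2) by force
    define c :: 'k where "c = of_real (inverse (nrm X x))"
    have "nrm X (smul X c x) = 1"
      using pos assms(2) by (simp add: nrm_smul c_def norm_inverse)
    then have "norm (f (smul X c x)) \<le> dual_norm X f"
      unfolding dual_norm_def using assms(2) by (intro cSUP_upper bdd) (auto simp: closed)
    also have "\<dots> \<le> 1" using assms(1) unfolding dual_ball_def by simp
    finally have "norm (c * f x) \<le> 1"
      using lin assms(2) unfolding linear_map_def scalars_def by simp
    then show ?thesis using pos by (simp add: c_def norm_mult norm_divide field_simps)
  qed
qed

lemma dual_ballI:
  assumes "linear_map X scalars f" "\<And>x. x \<in> carrier X \<Longrightarrow> norm (f x) \<le> nrm X x"
  shows "f \<in> dual_ball X"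
proof -
  have "f \<in> dual X" unfolding dual_def using assms by (auto intro!: exI[of _ 1])
  moreover have "dual_norm X f \<le> 1"
    unfolding dual_norm_def
    using zero_closed nrm_zero assms(2) by (intro cSUP_least) (auto intro: order_trans)
  ultimately show ?thesis unfolding dual_ball_def by simp
qed

end

lemma dual_ball_linear: "f \<in> dual_ball X \<Longrightarrow> linear_map X scalars f"
  unfolding dual_ball_def dual_def by simp

lemma linear_map_scalarsD:
  assumes "linear_map X scalars f"
  shows "\<lbrakk>x \<in> carrier X; y \<in> carrier X\<rbrakk> \<Longrightarrow> f (vadd X x y) = f x + f y"
    and "x \<in> carrier X \<Longrightarrow> f (smul X c x) = c * f x"
  using assms unfolding linear_map_def scalars_def by auto

lemma linear_map_zero:
  assumes "normed_space X" "normed_space Y" "linear_map X Y T" shows "T (vzero X) = vzero Y"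
proof -
  interpret X: normed_space X by fact
  interpret Y: normed_space Y by fact
  have "T (smul X 0 (vzero X)) = smul Y 0 (T (vzero X))" "T (vzero X) \<in> carrier Y"
    using assms(3) X.zero_closed unfolding linear_map_def by auto
  then show ?thesis by (simp add: X.smul_zero_left X.zero_closed Y.smul_zero_left)
qed

lemma linear_map_diff:
  assumes "normed_space X" "linear_map X Y T" "x \<in> carrier X" "y \<in> carrier X"
  shows "T (vadd X x (smul X (- 1) y)) = vadd Y (T x) (smul Y (- 1) (T y))"
proof -
  interpret X: normed_space X by fact
  show ?thesis using assms unfolding linear_map_def by (simp add: X.closed)
qed

lemma scalars_simps [simp]:
  "carrier scalars = UNIV" "vadd scalars = (+)" "vzero scalars = 0" "smul scalars = (*)"
  "nrm scalars = norm"
  unfolding scalars_def by simp_all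

lemma vdist_scalars: "vdist scalars x y = dist x y"
  unfolding vdist_def dist_norm by simp

lemma banach_scalars: "banach_space (scalars :: ('k::real_or_complex, 'k) nspace)"
proof
  fix s :: "nat \<Rightarrow> 'k"
  assume "cauchy_in scalars s"
  then have "Cauchy s" unfolding cauchy_in_def vdist_scalars Cauchy_def by simp
  then obtain l where "s \<longlonglongrightarrow> l" using Cauchy_convergent convergent_def by blast
  then show "\<exists>x\<in>carrier scalars. converges_to scalars s x"
    unfolding converges_to_def vdist_scalars using tendsto_dist_iff by auto
qed (auto simp: algebra_simps norm_mult norm_triangle_ineq)

lemma normed_scalars: "normed_space (scalars :: ('k::real_or_complex, 'k) nspace)"
  using banach_scalars banach_space.axioms(1) by blast


section \<open>Completions\<close>

lemma rep_mem: "x \<in> u \<Longrightarrow> rep u \<in> u"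
  unfolding rep_def by (rule someI)

text \<open>
  A normed space that embeds linearly and isometrically onto a dense subspace of a Banach space
  has that space as its completion: a class of Cauchy sequences is sent to the common limit of
  their images.
\<close>

lemma completion_isometric:
  fixes X :: "('k::real_or_complex, 'a) nspace" and Y :: "('k, 'b) nspace"
  assumes Y: "banach_space Y"
    and add: "\<And>x y. \<lbrakk>x \<in> carrier X; y \<in> carrier X\<rbrakk> \<Longrightarrow> vadd X x y \<in> carrier X"
    and smul: "\<And>c x. x \<in> carrier X \<Longrightarrow> smul X c x \<in> carrier X"
    and J: "linear_map X Y J"
    and iso: "\<And>x. x \<in> carrier X \<Longrightarrow> nrm Y (J x) = nrm X x"
    and dense: "\<And>y e. \<lbrakk>y \<in> carrier Y; e > 0\<rbrakk> \<Longrightarrow> \<exists>x\<in>carrier X. vdist Y (J x) y < e"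
  shows "isometrically_isomorphic (completion X) Y"
proof -
  interpret Y: banach_space Y by (rule Y)
  note J_closed = J[unfolded linear_map_def, THEN conjunct1, rule_format]
  have J_add: "J (vadd X x y) = vadd Y (J x) (J y)" if "x \<in> carrier X" "y \<in> carrier X" for x y
    using J that unfolding linear_map_def by auto
  have J_smul: "J (smul X c x) = smul Y c (J x)" if "x \<in> carrier X" for c x
    using J that unfolding linear_map_def by auto
  have vd: "vdist X x y = vdist Y (J x) (J y)" if "x \<in> carrier X" "y \<in> carrier X" for x y
    unfolding vdist_def using that by (simp add: iso[symmetric] add smul J_add J_smul)
  \<comment> \<open>the sequence \<open>s\<close> represents the element \<open>y\<close> of the completion\<close>
  define conv where "conv s y \<longleftrightarrow> (\<forall>n. s n \<in> carrier X) \<and> y \<in> carrier Y \<and>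
      (\<lambda>n. vdist Y (J (s n)) y) \<longlonglongrightarrow> 0" for s y
  have conv_unique: "y = z" if "conv s y" "conv s z" for s y z
    using that Y.converges_unique[of "\<lambda>n. J (s n)" y z] J_closed unfolding conv_def by auto
  have cauchy: "cauchy_in X s \<longleftrightarrow> (\<exists>y. conv s y)" for s
  proof
    assume s: "cauchy_in X s"
    then have c: "s n \<in> carrier X" for n unfolding cauchy_in_def by auto
    have "cauchy_in Y (\<lambda>n. J (s n))"
      using s c unfolding cauchy_in_def by (auto simp: vd J_closed)
    then show "\<exists>y. conv s y"
      using Y.complete c unfolding conv_def converges_to_def by blast
  next
    assume "\<exists>y. conv s y"
    then obtain y where y: "conv s y" by blast
    have c: "s n \<in> carrier X" for n using y unfolding conv_def by auto
    show "cauchy_in X s"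
      unfolding cauchy_in_def
    proof (intro conjI allI impI c)
      fix e :: real assume "e > 0"
      then obtain N where N: "\<And>n. n \<ge> N \<Longrightarrow> vdist Y (J (s n)) y < e / 2"
        using y LIMSEQ_D[of "\<lambda>n. vdist Y (J (s n)) y" 0 "e / 2"] unfolding conv_def by force
      have "vdist X (s m) (s n) < e" if "m \<ge> N" "n \<ge> N" for m n
      proof -
        have "vdist Y (J (s m)) (J (s n)) \<le> vdist Y (J (s m)) y + vdist Y (J (s n)) y"
          using Y.vdist_triangle[of "J (s m)" y "J (s n)"] Y.vdist_sym[of y "J (s n)"] y c J_closed
          unfolding conv_def by auto
        then show ?thesis using N[OF that(1)] N[OF that(2)] by (simp add: vd c)
      qed
      then show "\<exists>N. \<forall>m\<ge>N. \<forall>n\<ge>N. vdist X (s m) (s n) < e" by blast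
    qed
  qed
  have equiv: "(\<lambda>n. vdist X (s n) (t n)) \<longlonglongrightarrow> 0 \<longleftrightarrow> conv t y"
    if s: "conv s y" and t: "cauchy_in X t" for s t y
  proof -
    have cs: "s n \<in> carrier X" "t n \<in> carrier X" "J (s n) \<in> carrier Y" "J (t n) \<in> carrier Y"
      and cy: "y \<in> carrier Y" for n
      using s t J_closed unfolding conv_def cauchy_in_def by auto
    have lim: "(\<lambda>n. vdist Y (J (s n)) y) \<longlonglongrightarrow> 0" using s unfolding conv_def by auto
    show ?thesis
    proof
      assume "(\<lambda>n. vdist X (s n) (t n)) \<longlonglongrightarrow> 0"
      then have "(\<lambda>n. vdist X (s n) (t n) + vdist Y (J (s n)) y) \<longlonglongrightarrow> 0"
        using tendsto_add[OF _ lim] by fastforce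
      moreover have "vdist Y (J (t n)) y \<le> vdist X (s n) (t n) + vdist Y (J (s n)) y" for n
        using Y.vdist_triangle[of "J (t n)" "J (s n)" y] Y.vdist_sym cs cy by (simp add: vd)
      ultimately have "(\<lambda>n. vdist Y (J (t n)) y) \<longlonglongrightarrow> 0"
        by (rule null_squeeze) (auto simp: Y.vdist_nonneg cs cy)
      then show "conv t y" unfolding conv_def using cs cy by auto
    next
      assume "conv t y"
      then have "(\<lambda>n. vdist Y (J (s n)) y + vdist Y (J (t n)) y) \<longlonglongrightarrow> 0"
        using tendsto_add[OF lim] unfolding conv_def by fastforce
      moreover have "vdist X (s n) (t n) \<le> vdist Y (J (s n)) y + vdist Y (J (t n)) y" for n
        using Y.vdist_triangle[of "J (s n)" y "J (t n)"] Y.vdist_sym[of y "J (t n)"] cs cy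
        by (simp add: vd)
      ultimately show "(\<lambda>n. vdist X (s n) (t n)) \<longlonglongrightarrow> 0"
        by (rule null_squeeze) (auto simp: Y.vdist_nonneg cs cy vd)
    qed
  qed
  \<comment> \<open>the inverse of the isomorphism\<close>
  define S where "S y = {t. conv t y}" for y
  have class_S: "completion_class X s = S y" if "conv s y" for s y
    unfolding completion_class_def S_def using equiv[OF that] cauchy that by blast
  have ex: "\<exists>s. conv s y" if "y \<in> carrier Y" for y
  proof -
    have "\<forall>n. \<exists>x\<in>carrier X. vdist Y (J x) y < inverse (real (Suc n))"
      using dense[OF that] by simp
    then obtain s where s: "\<And>n. s n \<in> carrier X" "\<And>n. vdist Y (J (s n)) y < inverse (real (Suc n))"
      by metis
    have "(\<lambda>n. vdist Y (J (s n)) y) \<longlonglongrightarrow> 0"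
      by (rule null_squeeze[OF LIMSEQ_inverse_real_of_nat])
         (use s J_closed that in \<open>auto simp: Y.vdist_nonneg less_imp_le\<close>)
    then show ?thesis using s that unfolding conv_def by blast
  qed
  have repS: "conv (rep (S y)) y" if "y \<in> carrier Y" for y
    using ex[OF that] rep_mem[of _ "S y"] unfolding S_def by blast
  have carr: "carrier (completion X) = S ` carrier Y"
  proof -
    have "completion_class X ` {s. cauchy_in X s} = S ` carrier Y"
    proof (intro set_eqI iffI)
      fix U assume "U \<in> completion_class X ` {s. cauchy_in X s}"
      then obtain s y where "U = completion_class X s" "conv s y" using cauchy by blast
      then show "U \<in> S ` carrier Y" using class_S unfolding conv_def by blast
    next
      fix U assume "U \<in> S ` carrier Y"
      then obtain y where "U = S y" "y \<in> carrier Y" by blast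
      then show "U \<in> completion_class X ` {s. cauchy_in X s}"
        using class_S repS cauchy by blast
    qed
    then show ?thesis unfolding completion_def by simp
  qed
  have inj: "inj_on S (carrier Y)"
  proof (rule inj_onI)
    fix y z assume "y \<in> carrier Y" "z \<in> carrier Y" "S y = S z"
    then show "y = z" using repS[of y] repS[of z] conv_unique by metis
  qed
  define T where "T = inv_into (carrier Y) S"
  have TS: "T (S y) = y" if "y \<in> carrier Y" for y
    unfolding T_def by (rule inv_into_f_f[OF inj that])
  have bij: "bij_betw T (carrier (completion X)) (carrier Y)"
    unfolding carr T_def by (rule bij_betw_inv_into) (simp add: bij_betw_def inj)
  have Sadd: "vadd (completion X) (S y) (S z) = S (vadd Y y z)"
    if y: "y \<in> carrier Y" and z: "z \<in> carrier Y" for y z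
  proof -
    let ?s = "rep (S y)" and ?t = "rep (S z)"
    note s = repS[OF y, unfolded conv_def] and t = repS[OF z, unfolded conv_def]
    have "(\<lambda>n. vdist Y (J (?s n)) y + vdist Y (J (?t n)) z) \<longlonglongrightarrow> 0"
      using tendsto_add[of _ 0 _ _ 0] s t by fastforce
    then have "(\<lambda>n. vdist Y (J (vadd X (?s n) (?t n))) (vadd Y y z)) \<longlonglongrightarrow> 0"
      by (rule null_squeeze)
         (use s t y z in \<open>auto simp: J_add J_closed Y.vdist_add intro!: Y.vdist_nonneg Y.closed\<close>)
    then have "conv (\<lambda>n. vadd X (?s n) (?t n)) (vadd Y y z)"
      unfolding conv_def using s t by (simp add: add Y.closed)
    then show ?thesis unfolding completion_def by (simp add: class_S)
  qed
  have Ssmul: "smul (completion X) c (S y) = S (smul Y c y)" if y: "y \<in> carrier Y" for c y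
  proof -
    let ?s = "rep (S y)"
    note s = repS[OF y, unfolded conv_def]
    have "(\<lambda>n. norm c * vdist Y (J (?s n)) y) \<longlonglongrightarrow> 0"
      using tendsto_mult_right_zero s by blast
    then have "conv (\<lambda>n. smul X c (?s n)) (smul Y c y)"
      unfolding conv_def using s by (simp add: smul Y.closed J_smul Y.vdist_smul J_closed)
    then show ?thesis unfolding completion_def by (simp add: class_S)
  qed
  have Snrm: "nrm (completion X) (S y) = nrm Y y" if y: "y \<in> carrier Y" for y
  proof -
    let ?s = "rep (S y)"
    note s = repS[OF y, unfolded conv_def]
    have "(\<lambda>n. nrm X (?s n) - nrm Y y) \<longlonglongrightarrow> 0"
    proof (rule Lim_null_comparison)
      show "\<forall>\<^sub>F n in sequentially. norm (nrm X (?s n) - nrm Y y) \<le> vdist Y (J (?s n)) y"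
        using s y by (auto simp: iso[symmetric] J_closed intro!: always_eventually Y.abs_nrm_diff_le)
    qed (use s in auto)
    then have "(\<lambda>n. nrm X (?s n)) \<longlonglongrightarrow> nrm Y y" by (simp add: LIM_zero_iff)
    then show ?thesis unfolding completion_def by (simp add: limI)
  qed
  have "linear_map (completion X) Y T"
    unfolding linear_map_def carr by (auto simp: TS Sadd Ssmul Y.closed)
  moreover have "\<forall>U\<in>carrier (completion X). nrm Y (T U) = nrm (completion X) U"
    unfolding carr by (auto simp: TS Snrm)
  ultimately show ?thesis unfolding isometrically_isomorphic_def using bij by blast
qed


section \<open>Sequence spaces given by a norm on nonnegative sequences\<close>

text \<open>
  The part of \<open>a\<close> with indices in \<open>{n..<k}\<close>.
\<close>

definition block :: "nat \<Rightarrow> nat \<Rightarrow> (nat \<Rightarrow> real) \<Rightarrow> nat \<Rightarrow> real" where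
  "block n k a = (\<lambda>i. if n \<le> i \<and> i < k then a i else 0)"

text \<open>
  \<open>X\<close>-valued sequences whose sequence of norms belongs to \<open>C\<close>, normed by \<open>N\<close> of that sequence.
  Both \<open>c\<^sub>0(X)\<close> and \<open>\<ell>\<^sub>p(X)\<close> have this form.
\<close>

definition sequence_space ::
  "(nat \<Rightarrow> real) set \<Rightarrow> ((nat \<Rightarrow> real) \<Rightarrow> real) \<Rightarrow> ('k::real_or_complex, 'a) nspace
    \<Rightarrow> ('k, nat \<Rightarrow> 'a) nspace" where
  "sequence_space C N X = \<lparr>carrier = {x. (\<forall>i. x i \<in> carrier X) \<and> (\<lambda>i. nrm X (x i)) \<in> C},
     vadd = (\<lambda>x y i. vadd X (x i) (y i)), vzero = (\<lambda>i. vzero X),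
     smul = (\<lambda>c x i. smul X c (x i)), nrm = (\<lambda>x. N (\<lambda>i. nrm X (x i)))\<rparr>"

lemma sequence_space_simps [simp]:
  "carrier (sequence_space C N X) = {x. (\<forall>i. x i \<in> carrier X) \<and> (\<lambda>i. nrm X (x i)) \<in> C}"
  "vadd (sequence_space C N X) x y = (\<lambda>i. vadd X (x i) (y i))"
  "vzero (sequence_space C N X) = (\<lambda>i. vzero X)"
  "smul (sequence_space C N X) c x = (\<lambda>i. smul X c (x i))"
  "nrm (sequence_space C N X) x = N (\<lambda>i. nrm X (x i))"
  unfolding sequence_space_def by simp_all

lemma vdist_sequence_space: "vdist (sequence_space C N X) x y = N (\<lambda>i. vdist X (x i) (y i))"
  unfolding vdist_def by simp

text \<open>
  Only values at nonnegative sequences matter. The first assumption says that a sequence belongs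
  to \<open>C\<close> if and only if its truncations form a Cauchy sequence, the last one that the norm is
  determined by the truncations.
\<close>

locale sequence_norm =
  fixes C :: "(nat \<Rightarrow> real) set" and N :: "(nat \<Rightarrow> real) \<Rightarrow> real"
  assumes C_iff: "(\<And>i. 0 \<le> a i) \<Longrightarrow> a \<in> C \<longleftrightarrow> (\<forall>e>0. \<exists>n. \<forall>k. N (block n k a) \<le> e)"
    and N_mono: "\<lbrakk>a \<in> C; \<And>i. 0 \<le> b i; \<And>i. b i \<le> a i\<rbrakk> \<Longrightarrow> N b \<le> N a"
    and N_triangle: "\<lbrakk>a \<in> C; b \<in> C; \<And>i. 0 \<le> a i; \<And>i. 0 \<le> b i\<rbrakk> \<Longrightarrow> N (\<lambda>i. a i + b i) \<le> N a + N b"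
    and N_scale: "\<lbrakk>a \<in> C; \<And>i. 0 \<le> a i; 0 \<le> c\<rbrakk> \<Longrightarrow> N (\<lambda>i. c * a i) = c * N a"
    and N_zero: "N (\<lambda>i. 0) = 0"
    and N_unit: "N (\<lambda>i. if i = m then 1 else 0) = 1"
    and N_fatou: "\<lbrakk>a \<in> C; \<And>i. 0 \<le> a i; \<And>k. N (block 0 k a) \<le> M\<rbrakk> \<Longrightarrow> N a \<le> M"
begin

lemma finite_support_mem:
  assumes "\<And>i. 0 \<le> a i" "\<And>i. i \<ge> n \<Longrightarrow> a i = 0" shows "a \<in> C"
proof -
  have "block n k a = (\<lambda>i. 0)" for k unfolding block_def using assms(2) by auto
  then show ?thesis using assms(1) by (auto simp: C_iff N_zero intro!: exI[of _ n])
qed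

lemma block_mem: "(\<And>i. 0 \<le> a i) \<Longrightarrow> block n k a \<in> C"
  by (rule finite_support_mem[of _ k]) (auto simp: block_def)

lemma zero_mem: "(\<lambda>i. 0) \<in> C"
  by (rule finite_support_mem[of _ 0]) auto

lemma mem_mono:
  assumes a: "a \<in> C" and b: "\<And>i. 0 \<le> b i" "\<And>i. b i \<le> a i" shows "b \<in> C"
proof -
  have a0: "0 \<le> a i" for i using b order_trans by blast
  show ?thesis
    unfolding C_iff[OF b(1)]
  proof (intro allI impI)
    fix e :: real assume "e > 0"
    then obtain n where n: "\<And>k. N (block n k a) \<le> e" using a C_iff[of a] a0 by blast
    have "N (block n k b) \<le> N (block n k a)" for k
      by (rule N_mono[OF block_mem]) (auto simp: block_def a0 b)
    then show "\<exists>n. \<forall>k. N (block n k b) \<le> e" using n order_trans by blast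
  qed
qed

lemma N_nonneg: assumes "a \<in> C" "\<And>i. 0 \<le> a i" shows "0 \<le> N a"
  using N_mono[OF assms(1), of "\<lambda>i. 0"] assms(2) N_zero by simp

lemma N_single: assumes "0 \<le> c" shows "N (\<lambda>i. if i = m then c else 0) = c"
proof -
  have "N (\<lambda>i. c * (if i = m then 1 else 0)) = c * 1"
    by (subst N_scale) (auto simp: N_unit assms intro!: finite_support_mem[of _ "Suc m"])
  moreover have "(\<lambda>i. c * (if i = m then 1 else 0)) = (\<lambda>i. if i = m then c else 0)" by auto
  ultimately show ?thesis by simp
qed

lemma coord_le: assumes "a \<in> C" "\<And>i. 0 \<le> a i" shows "a i \<le> N a"
proof -
  have "N (\<lambda>j. if j = i then a i else 0) \<le> N a"
    by (rule N_mono) (use assms in auto)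
  then show ?thesis using N_single assms(2) by simp
qed

lemma add_mem: assumes "a \<in> C" "b \<in> C" "\<And>i. 0 \<le> a i" "\<And>i. 0 \<le> b i" shows "(\<lambda>i. a i + b i) \<in> C"
  unfolding C_iff[of "\<lambda>i. a i + b i", OF add_nonneg_nonneg[OF assms(3,4)]]
proof (intro allI impI)
  fix e :: real assume e: "e > 0"
  then have "e/2 > 0" by simp
  then obtain n1 where n1: "\<And>k. N (block n1 k a) \<le> e/2" using assms(1) C_iff[of a] assms(3) by blast
  obtain n2 where n2: "\<And>k. N (block n2 k b) \<le> e/2"
    using assms(2) C_iff[of b] assms(4) \<open>e/2 > 0\<close> by blast
  let ?n = "max n1 n2"
  have "N (block ?n k (\<lambda>i. a i + b i)) \<le> e" for k
  proof -
    have "block ?n k (\<lambda>i. a i + b i) = (\<lambda>i. block ?n k a i + block ?n k b i)"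
      by (auto simp: block_def)
    then have "N (block ?n k (\<lambda>i. a i + b i)) \<le> N (block ?n k a) + N (block ?n k b)"
      using N_triangle[OF block_mem block_mem, of a b ?n k ?n k] assms(3,4) by (simp add: block_def)
    also have "N (block ?n k a) \<le> N (block n1 k a)"
      by (rule N_mono[OF block_mem]) (auto simp: block_def assms)
    also have "N (block ?n k b) \<le> N (block n2 k b)"
      by (rule N_mono[OF block_mem]) (auto simp: block_def assms)
    finally show ?thesis using n1[of k] n2[of k] by linarith
  qed
  then show "\<exists>n. \<forall>k. N (block n k (\<lambda>i. a i + b i)) \<le> e" by blast
qed

lemma scale_mem: assumes "a \<in> C" "\<And>i. 0 \<le> a i" "0 \<le> c" shows "(\<lambda>i. c * a i) \<in> C"
proof -
  have sc: "N (block n k (\<lambda>i. c * a i)) = c * N (block n k a)" for n k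
  proof -
    have "block n k (\<lambda>i. c * a i) = (\<lambda>i. c * block n k a i)" by (auto simp: block_def)
    then show ?thesis
      using N_scale[OF block_mem[of a n k], of c] assms by (simp add: block_def)
  qed
  have nn: "0 \<le> c * a i" for i using assms by simp
  show ?thesis unfolding C_iff[of "\<lambda>i. c * a i", OF nn]
  proof (intro allI impI)
    fix e :: real assume e: "e > 0"
    then have "e / (c + 1) > 0" using assms by simp
    then obtain n where n: "\<And>k. N (block n k a) \<le> e / (c + 1)"
      using assms(1,2) C_iff[of a] by blast
    have "c * N (block n k a) \<le> e" for k
    proof -
      have "c * N (block n k a) \<le> c * (e / (c + 1))" by (rule mult_left_mono[OF n assms(3)])
      also have "\<dots> \<le> e" using assms(3) e by (simp add: field_simps)
      finally show ?thesis .
    qed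
    then show "\<exists>n. \<forall>k. N (block n k (\<lambda>i. c * a i)) \<le> e" unfolding sc by blast
  qed
qed

lemma N_eq_0: assumes "a \<in> C" "\<And>i. 0 \<le> a i" "N a = 0" shows "a i = 0"
  using coord_le[OF assms(1,2), of i] assms(2)[of i] assms(3) by simp

lemma tail_small:
  assumes "a \<in> C" "\<And>i. 0 \<le> a i" "e > 0"
  obtains n where "N (\<lambda>i. if i < n then 0 else a i) \<le> e"
proof -
  obtain n where n: "\<And>k. N (block n k a) \<le> e" using assms C_iff[of a] by blast
  have "N (\<lambda>i. if i < n then 0 else a i) \<le> e"
  proof (rule N_fatou)
    show "(\<lambda>i. if i < n then 0 else a i) \<in> C" by (rule mem_mono[OF assms(1)]) (use assms in auto)
    fix k
    have "block 0 k (\<lambda>i. if i < n then 0 else a i) = block n k a" by (auto simp: block_def)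
    then show "N (block 0 k (\<lambda>i. if i < n then 0 else a i)) \<le> e" using n by simp
  qed (use assms in auto)
  then show thesis by (rule that)
qed

lemma N_block_le_sum: assumes "\<And>i. 0 \<le> a i" shows "N (block 0 k a) \<le> (\<Sum>i<k. a i)"
proof (induction k)
  case 0
  have "block 0 0 a = (\<lambda>i. 0)" by (auto simp: block_def)
  then show ?case by (simp add: N_zero)
next
  case (Suc k)
  let ?s = "\<lambda>i. if i = k then a k else 0"
  have "block 0 (Suc k) a = (\<lambda>i. block 0 k a i + ?s i)" by (auto simp: block_def)
  moreover have "N (\<lambda>i. block 0 k a i + ?s i) \<le> N (block 0 k a) + N ?s"
    by (rule N_triangle)
       (use assms in \<open>auto simp: block_def intro: block_mem[unfolded block_def] finite_support_mem[of _ "Suc k"]\<close>)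
  ultimately show ?case using Suc N_single assms by simp
qed

lemma normed_sequence_space:
  fixes X :: "('k::real_or_complex, 'a) nspace"
  assumes "normed_space X" shows "normed_space (sequence_space C N X)"
proof -
  interpret X: normed_space X by fact
  note X.closed[simp] X.nrm_nonneg[simp]
  show ?thesis
  proof
    fix x y :: "nat \<Rightarrow> 'a" and c :: 'k
    assume x: "x \<in> carrier (sequence_space C N X)"
    have sc: "(\<lambda>i. nrm X (smul X c (x i))) = (\<lambda>i. norm c * nrm X (x i))"
      using x by (auto simp: X.nrm_smul)
    show "smul (sequence_space C N X) c x \<in> carrier (sequence_space C N X)"
      using x scale_mem[of "\<lambda>i. nrm X (x i)" "norm c"] by (simp add: sc)
    show "0 \<le> nrm (sequence_space C N X) x"
      using x N_nonneg by simp
    show "nrm (sequence_space C N X) (smul (sequence_space C N X) c x)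
        = norm c * nrm (sequence_space C N X) x"
      using x by (simp add: sc N_scale)
    show "nrm (sequence_space C N X) x = 0 \<longleftrightarrow> x = vzero (sequence_space C N X)"
      using x N_eq_0[of "\<lambda>i. nrm X (x i)"] X.nrm_eq_zero by (auto simp: fun_eq_iff N_zero X.nrm_zero)
    assume y: "y \<in> carrier (sequence_space C N X)"
    have sum: "(\<lambda>i. nrm X (x i) + nrm X (y i)) \<in> C"
      using x y by (auto intro: add_mem)
    show "vadd (sequence_space C N X) x y \<in> carrier (sequence_space C N X)"
      using x y mem_mono[OF sum, of "\<lambda>i. nrm X (vadd X (x i) (y i))"] X.nrm_triangle by simp
    have "N (\<lambda>i. nrm X (vadd X (x i) (y i))) \<le> N (\<lambda>i. nrm X (x i) + nrm X (y i))"
      using x y N_mono[OF sum] X.nrm_triangle by simp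
    also have "\<dots> \<le> N (\<lambda>i. nrm X (x i)) + N (\<lambda>i. nrm X (y i))"
      using x y N_triangle by simp
    finally show "nrm (sequence_space C N X) (vadd (sequence_space C N X) x y)
      \<le> nrm (sequence_space C N X) x + nrm (sequence_space C N X) y" by simp
  qed (auto simp: X.add_ac X.add_zero X.add_inverse X.smul_add_left
        X.smul_add_right X.smul_smul X.smul_one X.nrm_zero zero_mem)
qed

text \<open>
  A Cauchy sequence converges coordinatewise. Its distances from the coordinatewise limit are
  estimated on finite blocks of coordinates, on which convergence is uniform.
\<close>

lemma banach_sequence_space:
  assumes "banach_space X" shows "banach_space (sequence_space C N X)"
proof -
  interpret X: banach_space X by fact
  let ?S = "sequence_space C N X"
  interpret S: normed_space ?S by (rule normed_sequence_space) unfold_locales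
  note X.closed[simp] X.nrm_nonneg[simp]
  show ?thesis
  proof
    fix s assume s: "cauchy_in ?S s"
    then have sc: "s n \<in> carrier ?S" and sx: "s n i \<in> carrier X" for n i
      unfolding cauchy_in_def by auto
    have dC: "(\<lambda>i. vdist X (s m i) (s n i)) \<in> C" for m n
      using S.add_closed[OF sc S.smul_closed[OF sc], of m "-1" n] by (simp add: vdist_def)
    have dn: "0 \<le> vdist X (s m i) (s n i)" for m n i using X.vdist_nonneg sx by simp
    have "\<exists>z\<in>carrier X. converges_to X (\<lambda>n. s n i) z" for i
    proof (rule X.complete)
      have "vdist X (s m i) (s n i) \<le> vdist ?S (s m) (s n)" for m n
        unfolding vdist_sequence_space by (rule coord_le[OF dC dn])
      then show "cauchy_in X (\<lambda>n. s n i)"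
        using s sx unfolding cauchy_in_def by (meson le_less_trans)
    qed
    then obtain z where zX: "\<And>i. z i \<in> carrier X"
      and z: "\<And>i. (\<lambda>n. vdist X (s n i) (z i)) \<longlonglongrightarrow> 0"
      unfolding converges_to_def by metis
    have dz: "0 \<le> vdist X (s n i) (z i)" for n i using X.vdist_nonneg sx zX by simp
    have close: "\<exists>n0. \<forall>n\<ge>n0. \<forall>k. N (block 0 k (\<lambda>i. vdist X (s n i) (z i))) \<le> e" if e0: "e > 0" for e
    proof -
      obtain n0 where n0: "\<And>m n. \<lbrakk>m \<ge> n0; n \<ge> n0\<rbrakk> \<Longrightarrow> vdist ?S (s m) (s n) < e"
        using s e0 unfolding cauchy_in_def by blast
      have "N (block 0 k (\<lambda>i. vdist X (s n i) (z i))) \<le> e" if n: "n \<ge> n0" for n k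
      proof -
        have le: "N (block 0 k (\<lambda>i. vdist X (s n i) (z i))) \<le> e + (\<Sum>i<k. vdist X (s m i) (z i))"
          if m: "m \<ge> n0" for m
        proof -
          have "N (block 0 k (\<lambda>i. vdist X (s n i) (z i)))
             \<le> N (\<lambda>i. block 0 k (\<lambda>i. vdist X (s n i) (s m i)) i + block 0 k (\<lambda>i. vdist X (s m i) (z i)) i)"
            by (rule N_mono[OF add_mem[OF block_mem block_mem]])
               (use dn dz X.vdist_triangle sx zX in \<open>auto simp: block_def\<close>)
          also have "\<dots> \<le> N (block 0 k (\<lambda>i. vdist X (s n i) (s m i)))
               + N (block 0 k (\<lambda>i. vdist X (s m i) (z i)))"
            by (rule N_triangle[OF block_mem block_mem]) (use dn dz in \<open>auto simp: block_def\<close>)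
          also have "N (block 0 k (\<lambda>i. vdist X (s n i) (s m i))) \<le> vdist ?S (s n) (s m)"
            unfolding vdist_sequence_space by (rule N_mono[OF dC]) (use dn in \<open>auto simp: block_def\<close>)
          also have "\<dots> \<le> e" using n0[OF n m] by simp
          also have "N (block 0 k (\<lambda>i. vdist X (s m i) (z i))) \<le> (\<Sum>i<k. vdist X (s m i) (z i))"
            by (rule N_block_le_sum) (rule dz)
          finally show ?thesis by simp
        qed
        have "(\<lambda>m. e + (\<Sum>i<k. vdist X (s m i) (z i))) \<longlonglongrightarrow> e + (\<Sum>i<k. 0)"
          by (intro tendsto_intros z)
        from LIMSEQ_le_const[OF this, of "N (block 0 k (\<lambda>i. vdist X (s n i) (z i)))"] le
        show ?thesis by auto
      qed
      then show ?thesis by blast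
    qed
    have zS: "z \<in> carrier ?S"
    proof -
      have "(\<lambda>i. nrm X (z i)) \<in> C"
      proof (subst C_iff)
        show "\<forall>e>0. \<exists>n. \<forall>k. N (block n k (\<lambda>i. nrm X (z i))) \<le> e"
        proof (intro allI impI)
          fix e :: real assume "e > 0"
          then have e2: "e/2 > 0" by simp
          obtain m where m: "\<And>k. N (block 0 k (\<lambda>i. vdist X (s m i) (z i))) \<le> e/2"
            using close[OF e2] by blast
          obtain n where n: "\<And>k. N (block n k (\<lambda>i. nrm X (s m i))) \<le> e/2"
            using C_iff[of "\<lambda>i. nrm X (s m i)", THEN iffD1, rule_format, OF _ _ e2] sc[of m] sx by auto
          have "N (block n k (\<lambda>i. nrm X (z i))) \<le> e" for k
          proof -
            have "N (block n k (\<lambda>i. nrm X (z i)))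
             \<le> N (\<lambda>i. block n k (\<lambda>i. nrm X (s m i)) i + block 0 k (\<lambda>i. vdist X (s m i) (z i)) i)"
              by (rule N_mono[OF add_mem[OF block_mem block_mem]])
                 (use dz X.nrm_le_vdist sx zX X.vdist_sym in \<open>auto simp: block_def\<close>)
            also have "\<dots> \<le> N (block n k (\<lambda>i. nrm X (s m i)))
               + N (block 0 k (\<lambda>i. vdist X (s m i) (z i)))"
              by (rule N_triangle[OF block_mem block_mem]) (use dz sx in \<open>auto simp: block_def\<close>)
            finally show ?thesis using m[of k] n[of k] by linarith
          qed
          then show "\<exists>n. \<forall>k. N (block n k (\<lambda>i. nrm X (z i))) \<le> e" by blast
        qed
      qed (use zX in auto)
      then show ?thesis using zX by simp
    qed
    have dzC: "(\<lambda>i. vdist X (s n i) (z i)) \<in> C" for n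
      using S.add_closed[OF sc S.smul_closed[OF zS], of n "-1"] by (simp add: vdist_def)
    have "(\<lambda>n. vdist ?S (s n) z) \<longlonglongrightarrow> 0"
    proof (rule LIMSEQ_I)
      fix r :: real assume "r > 0"
      then have "r/2 > 0" by simp
      from close[OF this] obtain n0 where
        n0: "\<And>n k. n \<ge> n0 \<Longrightarrow> N (block 0 k (\<lambda>i. vdist X (s n i) (z i))) \<le> r/2" by blast
      have "vdist ?S (s n) z \<le> r/2" if "n \<ge> n0" for n
        unfolding vdist_sequence_space using N_fatou[OF dzC dz] n0[OF that] by blast
      moreover have "vdist ?S (s n) z \<ge> 0" for n by (rule S.vdist_nonneg[OF sc zS])
      ultimately show "\<exists>n0. \<forall>n\<ge>n0. norm (vdist ?S (s n) z - 0) < r"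
        using \<open>r > 0\<close> by (intro exI[of _ n0]) (force simp: abs_of_nonneg)
    qed
    then show "\<exists>z\<in>carrier ?S. converges_to ?S s z" using zS unfolding converges_to_def by blast
  qed
qed

end


section \<open>The norms of null sequences and of p-summable sequences\<close>

lemma c0_space_eq: "c0_space X = sequence_space {a. a \<longlonglongrightarrow> 0} (\<lambda>a. SUP i. a i) X"
  unfolding c0_space_def sequence_space_def by simp

lemma lp_space_eq:
  "lp_space p X = sequence_space {a. summable (\<lambda>i. a i powr p)} (\<lambda>a. (\<Sum>i. a i powr p) powr (1 / p)) X"
  unfolding lp_space_def sequence_space_def by simp

lemma bdd_above_block: "bdd_above (range (block n k a))"
proof -
  have "range (block n k a) \<subseteq> insert 0 (a ` {..<k})" unfolding block_def by auto
  then show ?thesis by (meson bdd_above.unfold bdd_above_finite bdd_above_mono finite_imageI finite_insert finite_lessThan)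
qed

lemma bdd_above_null: "a \<longlonglongrightarrow> 0 \<Longrightarrow> bdd_above (range (a :: nat \<Rightarrow> real))"
  by (metis bounded_imp_bdd_above convergent_imp_bounded)

lemma sequence_norm_c0: "sequence_norm {a. a \<longlonglongrightarrow> 0} (\<lambda>a. SUP i. a i)"
proof
  fix a b :: "nat \<Rightarrow> real" and c M :: real
  show "(SUP i::nat. 0::real) = 0" by simp
  show "(SUP i. if i = m then 1 else 0 :: real) = 1" for m :: nat
    by (rule cSup_eq_maximum) auto
  {
    assume a0: "\<And>i. 0 \<le> a i"
    have le_iff: "(SUP i. block n k a i) \<le> e \<longleftrightarrow> (\<forall>i. n \<le> i \<longrightarrow> i < k \<longrightarrow> a i \<le> e)" if "e > 0" for n k e
      using cSUP_le_iff[OF UNIV_not_empty bdd_above_block, of n k a e] that by (auto simp: block_def)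
    have "a \<longlonglongrightarrow> 0 \<longleftrightarrow> (\<forall>e>0. \<exists>n. \<forall>i\<ge>n. a i \<le> e)"
    proof
      assume "a \<longlonglongrightarrow> 0"
      then show "\<forall>e>0. \<exists>n. \<forall>i\<ge>n. a i \<le> e"
        using LIMSEQ_D[of a 0] a0 by (metis abs_of_nonneg diff_zero less_imp_le real_norm_def)
    next
      assume r: "\<forall>e>0. \<exists>n. \<forall>i\<ge>n. a i \<le> e"
      show "a \<longlonglongrightarrow> 0"
      proof (rule LIMSEQ_I)
        fix e :: real assume "e > 0"
        then have "e/2 > 0" by simp
        then obtain n where "\<forall>i\<ge>n. a i \<le> e/2" using r by blast
        then show "\<exists>n. \<forall>i\<ge>n. norm (a i - 0) < e" using \<open>e > 0\<close> a0 by (intro exI[of _ n]) force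
      qed
    qed
    also have "\<dots> \<longleftrightarrow> (\<forall>e>0. \<exists>n. \<forall>k. (SUP i. block n k a i) \<le> e)"
      using le_iff by (metis (no_types) lessI)
    finally show "a \<in> {a. a \<longlonglongrightarrow> 0} \<longleftrightarrow> (\<forall>e>0. \<exists>n. \<forall>k. (SUP i. block n k a i) \<le> e)" by simp
  }
  assume a: "a \<in> {a. a \<longlonglongrightarrow> 0}"
  note bdd = bdd_above_null[OF a[simplified]]
  show "(SUP i. b i) \<le> (SUP i. a i)" if "\<And>i. b i \<le> a i"
    by (rule cSUP_mono) (use bdd that in auto)
  show "(SUP i. a i + b i) \<le> (SUP i. a i) + (SUP i. b i)" if "b \<in> {a. a \<longlonglongrightarrow> 0}"
    using bdd bdd_above_null[of b] that by (intro cSUP_least add_mono cSUP_upper) auto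
  assume a0: "\<And>i. 0 \<le> a i"
  show "(SUP i. c * a i) = c * (SUP i. a i)" if c: "0 \<le> c"
  proof (rule antisym)
    show "(SUP i. c * a i) \<le> c * (SUP i. a i)"
      using bdd c by (intro cSUP_least mult_left_mono cSUP_upper) auto
    show "c * (SUP i. a i) \<le> (SUP i. c * a i)"
    proof (cases "c = 0")
      case False
      have "bdd_above (range (\<lambda>i. c * a i))"
        using tendsto_mult_right_zero a by (intro bdd_above_null) auto
      then have "a i \<le> (SUP i. c * a i) / c" for i
        using cSUP_upper[of i UNIV "\<lambda>i. c * a i"] False c by (simp add: field_simps)
      then have "(SUP i. a i) \<le> (SUP i. c * a i) / c" by (intro cSUP_least) auto
      then show ?thesis using False c by (simp add: field_simps)
    qed simp
  qed
  assume M: "\<And>k. (SUP i. block 0 k a i) \<le> M"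
  show "(SUP i. a i) \<le> M"
  proof (rule cSUP_least)
    fix i
    have "a i \<le> (SUP j. block 0 (Suc i) a j)"
      using cSUP_upper[OF UNIV_I bdd_above_block, of 0 "Suc i" a i] by (simp add: block_def)
    then show "a i \<le> M" using M order_trans by blast
  qed simp
qed

text \<open>Convexity of \<open>x\<^sup>p\<close> on the half-line including the endpoint \<open>0\<close>.\<close>

lemma powr_convex_combination:
  assumes "1 \<le> p" "0 \<le> x" "0 \<le> y" "0 \<le> t" "t \<le> (1::real)"
  shows "(t * x + (1 - t) * y) powr p \<le> t * x powr p + (1 - t) * y powr p"
proof -
  have le: "s powr p \<le> s" if "0 \<le> s" "s \<le> 1" for s :: real
    using powr_mono'[of 1 p s] that assms(1) by (cases "s = 0") auto
  consider "x = 0" | "y = 0" | "x > 0" "y > 0" using assms by linarith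
  then show ?thesis
  proof cases
    case 1
    then show ?thesis
      using le[of "1 - t"] assms by (simp add: powr_mult mult_right_mono)
  next
    case 2
    then show ?thesis
      using le[of t] assms by (simp add: powr_mult mult_right_mono)
  next
    case 3
    then show ?thesis
      using convex_onD[OF powr_convex[OF assms(1)], of "1 - t" x y] assms by (simp add: algebra_simps)
  qed
qed

lemma sequence_norm_lp:
  assumes p: "1 \<le> p"
  shows "sequence_norm {a. summable (\<lambda>i. a i powr p)} (\<lambda>a. (\<Sum>i. a i powr p) powr (1 / p))"
    (is "sequence_norm ?C ?N")
proof
  fix a b :: "nat \<Rightarrow> real" and c M :: real
  have N_powr: "?N a powr p = (\<Sum>i. a i powr p)" if "summable (\<lambda>i. a i powr p)" for a :: "nat \<Rightarrow> real"
    using p suminf_nonneg[OF that] by (simp add: powr_powr)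
  have N0: "0 \<le> ?N a" for a :: "nat \<Rightarrow> real" by simp
  have N_le: "?N a \<le> M" if "(\<Sum>i. a i powr p) \<le> M powr p" "0 \<le> M" "summable (\<lambda>i. a i powr p)"
    for a :: "nat \<Rightarrow> real" and M
  proof -
    have "?N a \<le> (M powr p) powr (1 / p)"
      using that p suminf_nonneg[of "\<lambda>i. a i powr p"] by (intro powr_mono2) auto
    then show ?thesis using p that by (simp add: powr_powr)
  qed
  have N_block: "?N (block n k a) = (\<Sum>i\<in>{n..<k}. a i powr p) powr (1 / p)" for n k and a :: "nat \<Rightarrow> real"
  proof -
    have "(\<Sum>i. block n k a i powr p) = (\<Sum>i\<in>{n..<k}. block n k a i powr p)"
      by (rule suminf_finite) (auto simp: block_def)
    then show ?thesis by (simp add: block_def)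
  qed
  show "?N (\<lambda>i. 0) = 0" by simp
  show "?N (\<lambda>i. if i = m then 1 else 0) = 1" for m
  proof -
    have "(\<Sum>i. (if i = m then 1 else 0 :: real) powr p) = (\<Sum>i\<in>{m}. (if i = m then 1 else 0) powr p)"
      by (rule suminf_finite) auto
    then show ?thesis by simp
  qed
  {
    assume a0: "\<And>i. 0 \<le> a i"
    have "summable (\<lambda>i. a i powr p) \<longleftrightarrow> (\<forall>e>0. \<exists>n. \<forall>k. ?N (block n k a) \<le> e)"
    proof
      assume s: "summable (\<lambda>i. a i powr p)"
      show "\<forall>e>0. \<exists>n. \<forall>k. ?N (block n k a) \<le> e"
      proof (intro allI impI)
        fix e :: real assume "e > 0"
        then have "e powr p > 0" by simp
        then obtain n where n: "\<And>k. norm (\<Sum>i\<in>{n..<k}. a i powr p) < e powr p"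
          using s unfolding summable_Cauchy by blast
        have "?N (block n k a) \<le> (e powr p) powr (1 / p)" for k
          unfolding N_block using n[of k] p by (intro powr_mono2) (auto simp: sum_nonneg)
        then have "?N (block n k a) \<le> e" for k
          using p \<open>e > 0\<close> by (simp add: powr_powr)
        then show "\<exists>n. \<forall>k. ?N (block n k a) \<le> e" by blast
      qed
    next
      assume r: "\<forall>e>0. \<exists>n. \<forall>k. ?N (block n k a) \<le> e"
      show "summable (\<lambda>i. a i powr p)"
        unfolding summable_Cauchy
      proof (intro allI impI)
        fix e :: real assume e: "e > 0"
        then have "(e/2) powr (1/p) > 0" by simp
        then obtain n where n: "\<And>k. ?N (block n k a) \<le> (e/2) powr (1/p)" using r by blast
        have "norm (\<Sum>i\<in>{m..<k}. a i powr p) < e" if "m \<ge> n" for m k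
        proof -
          have "(\<Sum>i\<in>{m..<k}. a i powr p) \<le> (\<Sum>i\<in>{n..<k}. a i powr p)"
            by (rule sum_mono2) (use that in auto)
          also have "\<dots> = ((\<Sum>i\<in>{n..<k}. a i powr p) powr (1/p)) powr p"
            using p by (simp add: powr_powr sum_nonneg)
          also have "\<dots> \<le> ((e/2) powr (1/p)) powr p"
            using n[of k] p unfolding N_block by (intro powr_mono2[of p]) auto
          also have "\<dots> = e/2" using p e by (simp add: powr_powr)
          finally show ?thesis using e by (simp add: sum_nonneg)
        qed
        then show "\<exists>n. \<forall>m\<ge>n. \<forall>k. norm (\<Sum>i\<in>{m..<k}. a i powr p) < e" by blast
      qed
    qed
    then show "a \<in> ?C \<longleftrightarrow> (\<forall>e>0. \<exists>n. \<forall>k. ?N (block n k a) \<le> e)" by simp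
  }
  assume "a \<in> ?C"
  then have a: "summable (\<lambda>i. a i powr p)" by simp
  {
    assume b0: "\<And>i. 0 \<le> b i" and ba: "\<And>i. b i \<le> a i"
    then have le: "b i powr p \<le> a i powr p" for i using p by (intro powr_mono2) auto
    have "summable (\<lambda>i. b i powr p)" by (rule summable_comparison_test'[OF a]) (use le in auto)
    then show "?N b \<le> ?N a"
      using a p le by (intro powr_mono2[of "1 / p"] suminf_le suminf_nonneg) auto
  }
  assume a0: "\<And>i. 0 \<le> a i"
  {
    assume "b \<in> ?C" and b0: "\<And>i. 0 \<le> b i"
    then have b: "summable (\<lambda>i. b i powr p)" by simp
    have zero: "a i = 0" if "?N a = 0" "summable (\<lambda>i. a i powr p)" for a :: "nat \<Rightarrow> real" and i
    proof -
      have "(\<Sum>i. a i powr p) = 0" using that(1) by simp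
      then have "a i powr p = 0" using suminf_eq_zero_iff[OF that(2)] by simp
      then show ?thesis by simp
    qed
    show "?N (\<lambda>i. a i + b i) \<le> ?N a + ?N b"
    proof (cases "?N a = 0 \<or> ?N b = 0")
      case True
      then show ?thesis using zero[OF _ a] zero[OF _ b] N0 by auto
    next
      case False
      define A B where "A = ?N a" and "B = ?N b"
      have A: "A > 0" and B: "B > 0" using False N0[of a] N0[of b] unfolding A_def B_def by linarith+
      \<comment> \<open>Minkowski's inequality is convexity applied to \<open>a / A\<close> and \<open>b / B\<close> with weights \<open>A\<close> and \<open>B\<close>\<close>
      define t where "t = A / (A + B)"
      have t: "0 \<le> t" "t \<le> 1" "1 - t = B / (A + B)" using A B by (auto simp: t_def field_simps)
      let ?g = "\<lambda>i. (A + B) powr p * (t / A powr p * a i powr p + (1 - t) / B powr p * b i powr p)"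
      have le: "(a i + b i) powr p \<le> ?g i" for i
      proof -
        have "a i + b i = (A + B) * (t * (a i / A) + (1 - t) * (b i / B))"
        proof -
          have "(A + B) * t = A" "(A + B) * (1 - t) = B" unfolding t(3) using A B by (auto simp: t_def)
          then have "(A + B) * (t * (a i / A) + (1 - t) * (b i / B)) = A * (a i / A) + B * (b i / B)"
            by (simp only: distrib_left mult.assoc[symmetric])
          then show ?thesis using A B by simp
        qed
        moreover have "0 \<le> t * (a i / A) + (1 - t) * (b i / B)" using t a0 b0 A B by auto
        ultimately have "(a i + b i) powr p = (A + B) powr p * (t * (a i / A) + (1 - t) * (b i / B)) powr p"
          using A B by (simp add: powr_mult)
        also have "\<dots> \<le> (A + B) powr p * (t * (a i / A) powr p + (1 - t) * (b i / B) powr p)"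
          using powr_convex_combination[OF p, of "a i / A" "b i / B" t] t a0 b0 A B
          by (intro mult_left_mono) auto
        also have "\<dots> = ?g i" using a0 b0 A B by (simp add: powr_divide)
        finally show ?thesis .
      qed
      have g: "?g sums ((A + B) powr p * (t / A powr p * (\<Sum>i. a i powr p) + (1 - t) / B powr p * (\<Sum>i. b i powr p)))"
        by (intro sums_mult sums_add summable_sums a b)
      moreover have "(\<Sum>i. a i powr p) = A powr p" "(\<Sum>i. b i powr p) = B powr p"
        using N_powr[OF a] N_powr[OF b] unfolding A_def B_def by auto
      ultimately have g: "?g sums ((A + B) powr p)" using A B by simp
      have s: "summable (\<lambda>i. (a i + b i) powr p)"
        by (rule summable_comparison_test'[OF sums_summable[OF g]]) (use le in auto)
      have "(\<Sum>i. (a i + b i) powr p) \<le> (A + B) powr p"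
        using suminf_le[OF le s sums_summable[OF g]] sums_unique[OF g] by simp
      then have "?N (\<lambda>i. a i + b i) \<le> A + B" using N_le[of _ "A + B"] s A B by simp
      then show ?thesis unfolding A_def B_def .
    qed
  }
  show "?N (\<lambda>i. c * a i) = c * ?N a" if "0 \<le> c"
  proof -
    have "(\<Sum>i. (c * a i) powr p) = c powr p * (\<Sum>i. a i powr p)"
      using that a0 a by (simp add: powr_mult suminf_mult)
    then show ?thesis using that p suminf_nonneg[OF a] by (simp add: powr_mult powr_powr)
  qed
  assume M: "\<And>k. ?N (block 0 k a) \<le> M"
  have "(\<Sum>i. a i powr p) \<le> M powr p"
  proof (rule suminf_le_const[OF a])
    fix k
    have "(\<Sum>i<k. a i powr p) = ((\<Sum>i\<in>{0..<k}. a i powr p) powr (1/p)) powr p"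
      using p by (simp add: powr_powr sum_nonneg atLeast0LessThan)
    also have "\<dots> \<le> M powr p" using M[of k] p unfolding N_block by (intro powr_mono2[of p]) auto
    finally show "(\<Sum>i<k. a i powr p) \<le> M powr p" .
  qed
  moreover have "0 \<le> M" using M[of 0] N0[of "block 0 0 a"] by linarith
  ultimately show "?N a \<le> M" using N_le a by blast
qed


section \<open>Norming functionals\<close>

text \<open>
  A sublinear functional bounded by the norm. Its value off the carrier is fixed to be \<open>0\<close>, so that
  functionals that agree on the carrier are equal.
\<close>

definition sublinear :: "('k::real_or_complex, 'a) nspace \<Rightarrow> ('a \<Rightarrow> real) \<Rightarrow> bool" where
  "sublinear X p \<longleftrightarrow>
     (\<forall>x\<in>carrier X. \<forall>y\<in>carrier X. p (vadd X x y) \<le> p x + p y) \<and>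
     (\<forall>x\<in>carrier X. \<forall>t>0. p (smul X (of_real t) x) = t * p x) \<and>
     (\<forall>x\<in>carrier X. p x \<le> nrm X x) \<and> (\<forall>x. x \<notin> carrier X \<longrightarrow> p x = 0)"

context normed_space
begin

lemma sublinearD:
  assumes "sublinear X p"
  shows "\<lbrakk>x \<in> carrier X; y \<in> carrier X\<rbrakk> \<Longrightarrow> p (vadd X x y) \<le> p x + p y"
    and "\<lbrakk>x \<in> carrier X; t > 0\<rbrakk> \<Longrightarrow> p (smul X (of_real t) x) = t * p x"
    and "x \<in> carrier X \<Longrightarrow> p x \<le> nrm X x"
    and "x \<notin> carrier X \<Longrightarrow> p x = 0"
  using assms unfolding sublinear_def by auto

lemma sublinear_zero: assumes "sublinear X p" shows "p (vzero X) = 0"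
  using sublinearD(2)[OF assms zero_closed, of 2] by (simp add: smul_zero_right)

lemma sublinear_lower: assumes "sublinear X p" "x \<in> carrier X" shows "- nrm X x \<le> p x"
proof -
  have "0 \<le> p x + p (smul X (- 1) x)"
    using sublinearD(1)[OF assms(1) assms(2) smul_closed[OF assms(2)], of "-1"] assms
    by (simp add: add_inverse sublinear_zero)
  moreover have "p (smul X (- 1) x) \<le> nrm X x"
    using sublinearD(3)[OF assms(1) smul_closed[OF assms(2)], of "-1"] assms(2) by (simp add: nrm_smul)
  ultimately show ?thesis by linarith
qed

text \<open>
  A sublinear functional \<open>p\<close> can be lowered to \<open>q\<close> with \<open>q(- z) \<le> - p(z)\<close> at a prescribed point \<open>z\<close>:
  the infimum over \<open>t \<ge> 0\<close> of \<open>p(x + t z) - t p(z)\<close>.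
\<close>

lemma sublinear_decrease:
  assumes p: "sublinear X p" and z: "z \<in> carrier X"
  obtains q where "sublinear X q" "\<And>x. q x \<le> p x" "q (smul X (- 1) z) \<le> - p z"
proof -
  define g where "g x t = p (vadd X x (smul X (of_real t) z)) - t * p z" for x and t :: real
  define q where "q x = (if x \<in> carrier X then INF t\<in>{0..}. g x t else 0)" for x
  note cl = closed z
  have lower: "- nrm X x \<le> g x t" if "x \<in> carrier X" "0 \<le> t" for x t
  proof (cases "t = 0")
    case True
    then show ?thesis
      using sublinear_lower[OF p that(1)] that z by (simp add: g_def smul_zero_left add_zero)
  next
    case False
    then have t: "t > 0" using that by simp
    have "smul X (of_real t) z = vadd X (vadd X x (smul X (of_real t) z)) (smul X (- 1) x)"
      using that cl by (simp add: add_assoc add_commute[of "smul X (of_real t) z"] add_inverse_cancel)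
    then have "t * p z \<le> p (vadd X x (smul X (of_real t) z)) + p (smul X (- 1) x)"
      using sublinearD(1)[OF p, of "vadd X x (smul X (of_real t) z)" "smul X (- 1) x"]
        sublinearD(2)[OF p z t] that cl by simp
    moreover have "p (smul X (- 1) x) \<le> nrm X x"
      using sublinearD(3)[OF p smul_closed[OF that(1)], of "-1"] that by (simp add: nrm_smul)
    ultimately show ?thesis unfolding g_def by simp
  qed
  have bdd: "bdd_below (g x ` {0..})" if "x \<in> carrier X" for x
    using lower[OF that] by (intro bdd_belowI2[of _ "- nrm X x"]) auto
  have q_le: "q x \<le> g x t" if "x \<in> carrier X" "0 \<le> t" for x t
    unfolding q_def using that bdd by (auto intro!: cINF_lower)
  have q_ge: "m \<le> q x" if "x \<in> carrier X" "\<And>t. 0 \<le> t \<Longrightarrow> m \<le> g x t" for x m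
    unfolding q_def using that by (auto intro!: cINF_greatest)
  have qp: "q x \<le> p x" for x
  proof (cases "x \<in> carrier X")
    case True
    then show ?thesis using q_le[OF True, of 0] z by (simp add: g_def smul_zero_left add_zero)
  next
    case False
    then show ?thesis using sublinearD(4)[OF p] by (simp add: q_def)
  qed
  have add: "q (vadd X x y) \<le> q x + q y" if x: "x \<in> carrier X" and y: "y \<in> carrier X" for x y
  proof -
    have le: "q (vadd X x y) \<le> g x s + g y t" if s: "0 \<le> s" and t: "0 \<le> t" for s t
    proof -
      have "vadd X (vadd X x y) (smul X (of_real (s + t)) z)
         = vadd X (vadd X x (smul X (of_real s) z)) (vadd X y (smul X (of_real t) z))"
        using x y cl by (simp add: smul_add_left add_assoc add_left_commute)
      then have "g (vadd X x y) (s + t) \<le> g x s + g y t"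
        unfolding g_def using x y cl
          sublinearD(1)[OF p, of "vadd X x (smul X (of_real s) z)" "vadd X y (smul X (of_real t) z)"]
        by (simp add: algebra_simps)
      then show ?thesis using q_le[of "vadd X x y" "s + t"] x y cl s t by fastforce
    qed
    have "q (vadd X x y) - g y t \<le> q x" if "0 \<le> t" for t
      using le[OF _ that] by (intro q_ge x) (simp add: algebra_simps)
    then have "q (vadd X x y) - q x \<le> q y"
      by (intro q_ge y) (simp add: algebra_simps)
    then show ?thesis by simp
  qed
  have scale_le: "t * q x \<le> q (smul X (of_real t) x)" if x: "x \<in> carrier X" and t: "t > 0" for x t
  proof (rule q_ge)
    fix s :: real assume s: "0 \<le> s"
    have "vadd X (smul X (of_real t) x) (smul X (of_real s) z)
        = smul X (of_real t) (vadd X x (smul X (of_real (s / t)) z))"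
      using x cl t by (simp add: smul_add_right smul_smul)
    then have "g (smul X (of_real t) x) s = t * g x (s / t)"
      unfolding g_def using sublinearD(2)[OF p _ t, of "vadd X x (smul X (of_real (s / t)) z)"] x cl t
      by (simp add: algebra_simps)
    then show "t * q x \<le> g (smul X (of_real t) x) s"
      using q_le[OF x, of "s / t"] s t by simp
  qed (use x cl in auto)
  have scale: "q (smul X (of_real t) x) = t * q x" if x: "x \<in> carrier X" and t: "t > 0" for x t
  proof (rule antisym)
    have "inverse t * q (smul X (of_real t) x) \<le> q (smul X (of_real (inverse t)) (smul X (of_real t) x))"
      using x t by (intro scale_le) (auto simp: closed)
    also have "smul X (of_real (inverse t)) (smul X (of_real t) x) = x"
      using x t by (simp add: smul_smul smul_one flip: of_real_mult)
    finally show "q (smul X (of_real t) x) \<le> t * q x" using t by (simp add: field_simps)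
  qed (rule scale_le[OF x t])
  have "sublinear X q"
    unfolding sublinear_def
    using add scale order_trans[OF qp sublinearD(3)[OF p]] by (auto simp: q_def)
  moreover have "q (smul X (- 1) z) \<le> - p z"
    using q_le[of "smul X (- 1) z" 1] z sublinear_zero[OF p]
    by (simp add: g_def closed smul_one add_inverse_left)
  ultimately show thesis using qp that by blast
qed

text \<open>
  By Zorn's lemma there are minimal sublinear functionals. The infimum of a chain is subadditive
  because of any two members of the chain the smaller one estimates both summands.
\<close>

lemma minimal_sublinear:
  assumes p0: "sublinear X p0"
  obtains p where "sublinear X p" "\<And>q. \<lbrakk>sublinear X q; \<And>x. q x \<le> p x\<rbrakk> \<Longrightarrow> q = p"
    "\<And>x. p x \<le> p0 x"
proof -
  define A where "A = {p. sublinear X p \<and> (\<forall>x. p x \<le> p0 x)}"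
  have "\<exists>m\<in>A. \<forall>a\<in>A. m \<ge> a \<longrightarrow> a = m"
  proof (rule predicate_Zorn)
    show "partial_order_on A (relation_of (\<lambda>p q. p \<ge> q) A)"
      by (rule partial_order_on_relation_ofI) auto
    fix \<C> assume "\<C> \<in> Chains (relation_of (\<lambda>p q. p \<ge> q) A)"
    then have CA: "\<C> \<subseteq> A" and chain: "\<And>p q. \<lbrakk>p \<in> \<C>; q \<in> \<C>\<rbrakk> \<Longrightarrow> p \<le> q \<or> q \<le> p"
      unfolding Chains_def relation_of_def by auto
    show "\<exists>u\<in>A. \<forall>a\<in>\<C>. a \<ge> u"
    proof (cases "\<C> = {}")
      case True
      then show ?thesis using p0 unfolding A_def by auto
    next
      case False
      have sl: "sublinear X p" if "p \<in> \<C>" for p using CA that unfolding A_def by auto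
      define q where "q x = (if x \<in> carrier X then INF p\<in>\<C>. p x else 0)" for x
      have bdd: "bdd_below ((\<lambda>p. p x) ` \<C>)" if "x \<in> carrier X" for x
        using sublinear_lower[OF sl that] by (intro bdd_belowI2[of _ "- nrm X x"]) auto
      have qp: "q x \<le> p x" if "p \<in> \<C>" for p x
        unfolding q_def using that bdd sublinearD(4)[OF sl[OF that]] by (auto intro!: cINF_lower)
      have q_ge: "m \<le> q x" if "x \<in> carrier X" "\<And>p. p \<in> \<C> \<Longrightarrow> m \<le> p x" for x m
        unfolding q_def using that False by (auto intro!: cINF_greatest)
      have add: "q (vadd X x y) \<le> q x + q y" if x: "x \<in> carrier X" and y: "y \<in> carrier X" for x y
      proof -
        have le: "q (vadd X x y) \<le> p x + p' y" if p: "p \<in> \<C>" and p': "p' \<in> \<C>" for p p'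
          using chain[OF p p']
        proof
          assume "p \<le> p'"
          then have "p y \<le> p' y" by (simp add: le_fun_def)
          then show ?thesis using qp[OF p, of "vadd X x y"] sublinearD(1)[OF sl[OF p] x y] by linarith
        next
          assume "p' \<le> p"
          then have "p' x \<le> p x" by (simp add: le_fun_def)
          then show ?thesis using qp[OF p', of "vadd X x y"] sublinearD(1)[OF sl[OF p'] x y] by linarith
        qed
        have "q (vadd X x y) - p' y \<le> q x" if "p' \<in> \<C>" for p'
          using le[OF _ that] by (intro q_ge x) (simp add: algebra_simps)
        then have "q (vadd X x y) - q x \<le> q y"
          by (intro q_ge y) (simp add: algebra_simps)
        then show ?thesis by simp
      qed
      have scale: "q (smul X (of_real t) x) = t * q x" if x: "x \<in> carrier X" and t: "t > 0" for x t
      proof (rule antisym)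
        have "q (smul X (of_real t) x) / t \<le> q x"
          using qp[of _ "smul X (of_real t) x"] sublinearD(2)[OF sl x t] t
          by (intro q_ge x) (simp add: field_simps)
        then show "q (smul X (of_real t) x) \<le> t * q x" using t by (simp add: field_simps)
        show "t * q x \<le> q (smul X (of_real t) x)"
        proof (rule q_ge)
          fix p assume p: "p \<in> \<C>"
          show "t * q x \<le> p (smul X (of_real t) x)"
            using qp[OF p, of x] sublinearD(2)[OF sl[OF p] x t] t by simp
        qed (use x in \<open>simp add: closed\<close>)
      qed
      obtain p1 where p1: "p1 \<in> \<C>" using False by blast
      have "q x \<le> nrm X x" if "x \<in> carrier X" for x
        using qp[OF p1, of x] sublinearD(3)[OF sl[OF p1] that] by linarith
      then have "sublinear X q" unfolding sublinear_def using add scale by (auto simp: q_def)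
      moreover have "q x \<le> p0 x" for x
        using qp[OF p1, of x] CA p1 unfolding A_def by (blast intro: order_trans)
      ultimately show ?thesis using qp unfolding A_def by (auto intro!: bexI[of _ q] simp: le_fun_def)
    qed
  qed
  then obtain p where "p \<in> A" "\<And>q. \<lbrakk>q \<in> A; q \<le> p\<rbrakk> \<Longrightarrow> q = p" by blast
  then show thesis
    using that[of p] unfolding A_def le_fun_def by (smt (verit, ccfv_SIG) mem_Collect_eq order_trans)
qed

end

text \<open>
  The scalar field is the real line or is spanned by \<open>1\<close> and an imaginary unit.
\<close>

lemma scalar_field_cases:
  obtains (real) "\<And>c :: 'k::real_or_complex. \<exists>r. c = of_real r"
  | (complex) i :: "'k::real_or_complex" where "i * i = - 1" "\<And>c. \<exists>a b. c = of_real a + of_real b * i"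
      "\<And>a b. (norm (of_real a + of_real b * i))\<^sup>2 = a\<^sup>2 + b\<^sup>2"
proof -
  obtain \<phi> :: "'k \<Rightarrow> complex" where add: "\<And>x y. \<phi> (x + y) = \<phi> x + \<phi> y"
    and mult: "\<And>x y. \<phi> (x * y) = \<phi> x * \<phi> y" and real': "\<And>r. \<phi> (r *\<^sub>R 1) = of_real r"
    and norm: "\<And>x. norm (\<phi> x) = norm x" and range: "range \<phi> = \<real> \<or> range \<phi> = UNIV"
    using real_or_complex[where ?'a = 'k] by auto
  have real: "\<phi> (of_real r) = of_real r" for r using real'[of r] by (simp add: of_real_def)
  have diff: "\<phi> (x - y) = \<phi> x - \<phi> y" for x y using add[of "x - y" y] by simp
  have inj: "x = y" if "\<phi> x = \<phi> y" for x y using that diff[of x y] norm[of "x - y"] by simp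
  show thesis
    using range
  proof
    assume R: "range \<phi> = \<real>"
    have "\<exists>r. c = of_real r" for c :: 'k
    proof -
      have "\<phi> c \<in> \<real>" using R by blast
      then obtain r where "\<phi> c = of_real r" by (auto elim: Reals_cases)
      then show ?thesis using inj real by metis
    qed
    then show thesis by (rule that(1))
  next
    assume U: "range \<phi> = UNIV"
    then obtain i where i: "\<phi> i = \<i>" by (metis UNIV_I imageE)
    show thesis
    proof (rule that(2)[of i])
      show "i * i = - 1"
        by (rule inj) (use real[of "-1"] in \<open>simp add: mult i\<close>)
      show "\<exists>a b. c = of_real a + of_real b * i" for c :: 'k
        by (intro exI[of _ "Re (\<phi> c)"] exI[of _ "Im (\<phi> c)"] inj)
           (simp add: add mult real i complex_eq_iff)
      show "(norm (of_real a + of_real b * i))\<^sup>2 = a\<^sup>2 + b\<^sup>2" for a b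
        by (simp add: norm[symmetric] add mult real i cmod_power2)
    qed
  qed
qed

lemma unimodular_rotation:
  fixes z :: "'k::real_normed_field"
  obtains c where "norm c = 1" "c * z = of_real (norm z)"
proof (cases "z = 0")
  case True
  then show thesis using that[of 1] by simp
next
  case False
  then show thesis using that[of "of_real (norm z) / z"] by (simp add: norm_divide)
qed

context normed_space
begin

text \<open>
  The real form of the Hahn-Banach theorem: a minimal sublinear functional cannot be lowered, so
  it is odd, and an odd sublinear functional is additive.
\<close>

lemma real_norming_functional:
  assumes x0: "x0 \<in> carrier X"
  obtains p :: "'a \<Rightarrow> real" where
    "\<And>x y. \<lbrakk>x \<in> carrier X; y \<in> carrier X\<rbrakk> \<Longrightarrow> p (vadd X x y) = p x + p y"
    "\<And>x t. x \<in> carrier X \<Longrightarrow> p (smul X (of_real t) x) = t * p x"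
    "\<And>x. x \<in> carrier X \<Longrightarrow> p x \<le> nrm X x" "p x0 = nrm X x0"
proof -
  define p0 where "p0 x = (if x \<in> carrier X then nrm X x else 0)" for x
  have "sublinear X p0"
    unfolding sublinear_def p0_def by (auto simp: closed nrm_triangle nrm_smul)
  from sublinear_decrease[OF this x0] obtain q where q: "sublinear X q"
    and qx0: "q (smul X (- 1) x0) \<le> - nrm X x0"
    using x0 unfolding p0_def by (metis (full_types))
  obtain p where p: "sublinear X p" and minp: "\<And>q. \<lbrakk>sublinear X q; \<And>x. q x \<le> p x\<rbrakk> \<Longrightarrow> q = p"
    and pq: "\<And>x. p x \<le> q x"
    using minimal_sublinear[OF q] by blast
  have odd: "p (smul X (- 1) z) = - p z" if z: "z \<in> carrier X" for z
  proof (rule antisym)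
    show "p (smul X (- 1) z) \<le> - p z"
      using sublinear_decrease[OF p z] minp by metis
    show "- p z \<le> p (smul X (- 1) z)"
      using sublinearD(1)[OF p z smul_closed[OF z], of "-1"] z
      by (simp add: add_inverse sublinear_zero[OF p])
  qed
  have add: "p (vadd X x y) = p x + p y" if x: "x \<in> carrier X" and y: "y \<in> carrier X" for x y
  proof (rule antisym)
    show "p (vadd X x y) \<le> p x + p y" by (rule sublinearD(1)[OF p x y])
    have "vadd X (vadd X x y) (smul X (- 1) y) = x"
      using x y by (simp add: add_assoc closed add_inverse add_zero)
    then show "p x + p y \<le> p (vadd X x y)"
      using sublinearD(1)[OF p, of "vadd X x y" "smul X (- 1) y"] x y by (simp add: closed odd)
  qed
  have pos: "p (smul X (of_real t) x) = t * p x" if "x \<in> carrier X" "t > 0" for x t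
    by (rule sublinearD(2)[OF p that])
  have smul: "p (smul X (of_real t) x) = t * p x" if x: "x \<in> carrier X" for x t
  proof (cases t "0 :: real" rule: linorder_cases)
    case less
    have "smul X (of_real t) x = smul X (- 1) (smul X (of_real (- t)) x)"
      using x by (simp add: smul_smul)
    then show ?thesis using odd[OF smul_closed[OF x]] pos[OF x, of "- t"] less by simp
  next
    case equal
    then show ?thesis using x by (simp add: smul_zero_left sublinear_zero[OF p])
  next
    case greater
    then show ?thesis by (rule pos[OF x])
  qed
  have "nrm X x0 \<le> p x0" using pq[of "smul X (- 1) x0"] qx0 odd[OF x0] by simp
  then show thesis
    using add smul sublinearD(3)[OF p] x0 by (intro that[of p]) (auto intro: antisym)
qed

text \<open>
  Over the complex numbers the real functional \<open>p\<close> is the real part of \<open>f(x) = p(x) - i p(i x)\<close>, and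
  rotating \<open>f(x)\<close> to the positive half-line transfers the bound from \<open>p\<close> to \<open>f\<close>.
\<close>

theorem norming_functional:
  assumes x0: "x0 \<in> carrier X"
  obtains f where "f \<in> dual_ball X" "norm (f x0) = nrm X x0"
proof -
  obtain p where add: "\<And>x y. \<lbrakk>x \<in> carrier X; y \<in> carrier X\<rbrakk> \<Longrightarrow> p (vadd X x y) = p x + p y"
    and smul: "\<And>x t. x \<in> carrier X \<Longrightarrow> p (smul X (of_real t) x) = t * p x"
    and le: "\<And>x. x \<in> carrier X \<Longrightarrow> p x \<le> nrm X x" and px0: "p x0 = nrm X x0"
    using real_norming_functional[OF x0] by blast
  show thesis
  proof (cases rule: scalar_field_cases[where ?'k = 'k])
    case real
    define f :: "'a \<Rightarrow> 'k" where "f x = of_real (p x)" for x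
    have abs: "\<bar>p x\<bar> \<le> nrm X x" if "x \<in> carrier X" for x
      using le[OF that] le[OF smul_closed[OF that], of "-1"] smul[OF that, of "-1"] that
      by (simp add: nrm_smul abs_le_iff)
    have "f (smul X c x) = c * f x" if "x \<in> carrier X" for c x
      using real[of c] smul[OF that] by (auto simp: f_def)
    then have "f \<in> dual_ball X"
      by (intro dual_ballI) (auto simp: linear_map_def f_def add abs)
    then show thesis using that px0 x0 nrm_nonneg by (simp add: f_def)
  next
    case (complex i)
    define f where "f x = of_real (p x) + of_real (- p (smul X i x)) * i" for x
    have fadd: "f (vadd X x y) = f x + f y" if "x \<in> carrier X" "y \<in> carrier X" for x y
      using that by (simp add: f_def add smul_add_right closed algebra_simps)
    have freal: "f (smul X (of_real t) x) = of_real t * f x" if "x \<in> carrier X" for x t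
    proof -
      have "smul X i (smul X (of_real t) x) = smul X (of_real t) (smul X i x)"
        using that by (simp add: smul_smul mult.commute)
      then show ?thesis using that by (simp add: f_def smul closed algebra_simps)
    qed
    have fi: "f (smul X i x) = i * f x" if x: "x \<in> carrier X" for x
    proof -
      have "p (smul X i (smul X i x)) = - p x"
        using smul[OF x, of "-1"] x complex(1) by (simp add: smul_smul)
      moreover have "i * (of_real a * i) = - of_real a" for a
        using complex(1) by (metis mult.commute mult.left_commute mult_minus1_right)
      ultimately show ?thesis by (simp add: f_def algebra_simps)
    qed
    have fsmul: "f (smul X c x) = c * f x" if x: "x \<in> carrier X" for c x
    proof -
      obtain a b where c: "c = of_real a + of_real b * i" using complex(2) by blast
      have "smul X c x = vadd X (smul X (of_real a) x) (smul X (of_real b) (smul X i x))"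
        using x by (simp add: c smul_add_left smul_smul)
      then show ?thesis using x by (simp add: fadd freal fi closed c algebra_simps)
    qed
    have p_le: "p x \<le> norm (f x)" for x
    proof -
      have "(p x)\<^sup>2 \<le> (norm (f x))\<^sup>2" unfolding f_def complex(3) by simp
      then show ?thesis by (rule power2_le_imp_le) simp
    qed
    have f_le: "norm (f x) \<le> nrm X x" if x: "x \<in> carrier X" for x
    proof -
      obtain c :: 'k where c: "norm c = 1" "c * f x = of_real (norm (f x))"
        by (rule unimodular_rotation)
      let ?y = "smul X c x"
      have "of_real (p ?y) + of_real (- p (smul X i ?y)) * i = of_real (norm (f x))"
        using fsmul[OF x, of c] c unfolding f_def by simp
      then have "of_real (p ?y - norm (f x)) + of_real (- p (smul X i ?y)) * i = 0"
        by (simp add: algebra_simps)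
      then have "(p ?y - norm (f x))\<^sup>2 + (- p (smul X i ?y))\<^sup>2 = 0"
        using complex(3)[of "p ?y - norm (f x)" "- p (smul X i ?y)"] by simp
      then have "p ?y = norm (f x)" by (simp add: sum_power2_eq_zero_iff)
      then show ?thesis using le[OF smul_closed[OF x], of c] c(1) x by (simp add: nrm_smul)
    qed
    have "f \<in> dual_ball X"
      by (intro dual_ballI f_le) (auto simp: linear_map_def fadd fsmul)
    then show thesis
      using that[of f] p_le[of x0] px0 f_le[OF x0] by simp
  qed
qed

end


section \<open>Uniform boundedness\<close>

text \<open>
  The uniform boundedness principle for bounded seminorms. If it failed, there would be nested
  balls with radii tending to \<open>0\<close> such that on the \<open>n\<close>-th of them some seminorm is at least \<open>n\<close>; a
  common point of these balls contradicts pointwise boundedness.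
\<close>

lemma (in banach_space) uniform_boundedness:
  fixes P :: "'i \<Rightarrow> 'a \<Rightarrow> real"
  assumes triangle: "\<And>i x y. \<lbrakk>i \<in> I; x \<in> carrier X; y \<in> carrier X\<rbrakk> \<Longrightarrow> P i (vadd X x y) \<le> P i x + P i y"
    and scale: "\<And>i x c. \<lbrakk>i \<in> I; x \<in> carrier X\<rbrakk> \<Longrightarrow> P i (smul X c x) = norm c * P i x"
    and bounded: "\<And>i. i \<in> I \<Longrightarrow> \<exists>K. \<forall>x\<in>carrier X. P i x \<le> K * nrm X x"
    and pointwise: "\<And>x. x \<in> carrier X \<Longrightarrow> \<exists>K. \<forall>i\<in>I. P i x \<le> K"
  shows "\<exists>K>0. \<forall>i\<in>I. \<forall>x\<in>carrier X. P i x \<le> K * nrm X x"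
proof (rule ccontr)
  assume contra: "\<not> ?thesis"
  have large: "\<exists>i\<in>I. \<exists>x'\<in>carrier X. vdist X x' x \<le> r \<and> M < P i x'"
    if x: "x \<in> carrier X" and r: "r > 0" and M: "M > 0" for x r and M :: real
  proof -
    have "M / r > 0" using r M by simp
    then obtain i z where i: "i \<in> I" and z: "z \<in> carrier X" and Pz: "P i z > M / r * nrm X z"
      using contra by (meson not_le)
    have nz: "nrm X z > 0"
    proof (rule ccontr)
      assume "\<not> nrm X z > 0"
      then have "nrm X z = 0" using nrm_nonneg[OF z] by simp
      then show False using Pz bounded[OF i] z by fastforce
    qed
    define c :: 'k where "c = of_real (r / nrm X z)"
    define w where "w = smul X c z"
    have nc: "norm c = r / nrm X z" using r nz by (simp add: c_def norm_divide)
    have w: "w \<in> carrier X" "nrm X w = r" using z nz nc by (auto simp: w_def closed nrm_smul)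
    have "M = r / nrm X z * (M / r * nrm X z)" using r nz by simp
    also have "\<dots> < r / nrm X z * P i z"
      using Pz r nz by (intro mult_strict_left_mono) auto
    also have "\<dots> = P i w" using scale[OF i z, of c] by (simp add: w_def nc)
    finally have Pw: "M < P i w" .
    let ?w' = "smul X (- 1) w"
    have w': "?w' \<in> carrier X" "nrm X ?w' = r" using w by (auto simp: closed nrm_smul)
    \<comment> \<open>one of the points \<open>x + w\<close> and \<open>x - w\<close> has a value at least that of \<open>w\<close>\<close>
    have "smul X 2 w = vadd X (vadd X x w) (smul X (- 1) (vadd X x ?w'))"
      using x w smul_add_left[OF w(1), of 1 1]
      by (simp add: closed smul_add_right smul_smul smul_one add_assoc add_left_commute[of w]
          add_inverse_cancel)
    then have "P i (smul X 2 w) \<le> P i (vadd X x w) + P i (vadd X x ?w')"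
      using triangle[OF i, of "vadd X x w" "smul X (- 1) (vadd X x ?w')"]
        scale[OF i, of "vadd X x ?w'" "-1"] x w w' by (simp add: closed)
    then have "2 * P i w \<le> P i (vadd X x w) + P i (vadd X x ?w')" using scale[OF i w(1), of 2] by simp
    then have "M < P i (vadd X x w) \<or> M < P i (vadd X x ?w')" using Pw by linarith
    moreover have "vdist X (vadd X x v) x = nrm X v" if "v \<in> carrier X" for v
      using x that by (simp add: vdist_def add_commute[of x v] add_assoc closed add_inverse add_zero)
    ultimately show ?thesis using i x w w' closed by (metis order_refl)
  qed
  have step: "\<exists>x' \<rho>'. x' \<in> carrier X \<and> 0 < \<rho>' \<and> \<rho>' \<le> \<rho> / 2 \<and> vdist X x' x + \<rho>' \<le> \<rho> \<and>
      (\<exists>i\<in>I. \<forall>y\<in>carrier X. vdist X y x' \<le> \<rho>' \<longrightarrow> real n \<le> P i y)"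
    if x: "x \<in> carrier X" and \<rho>: "\<rho> > 0" for x \<rho> n
  proof -
    obtain i x' where i: "i \<in> I" and x': "x' \<in> carrier X" "vdist X x' x \<le> \<rho> / 2" "real n + 1 < P i x'"
      using large[OF x, of "\<rho> / 2" "real n + 1"] \<rho> by auto
    obtain K where K: "\<And>x. x \<in> carrier X \<Longrightarrow> P i x \<le> K * nrm X x" using bounded[OF i] by blast
    define \<rho>' where "\<rho>' = min (\<rho> / 2) (1 / (\<bar>K\<bar> + 1))"
    have "real n \<le> P i y" if y: "y \<in> carrier X" "vdist X y x' \<le> \<rho>'" for y
    proof -
      have "x' = vadd X y (vadd X x' (smul X (- 1) y))"
        using x' y by (simp add: closed add_left_commute add_inverse add_zero)
      then have "P i x' \<le> P i y + P i (vadd X x' (smul X (- 1) y))"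
        using triangle[OF i y(1), of "vadd X x' (smul X (- 1) y)"] x' y by (simp add: closed)
      also have "P i (vadd X x' (smul X (- 1) y)) \<le> K * vdist X y x'"
        using K[of "vadd X x' (smul X (- 1) y)"] x' y vdist_sym[OF y(1) x'(1)]
        by (simp add: closed vdist_def)
      also have "\<dots> \<le> (\<bar>K\<bar> + 1) * (1 / (\<bar>K\<bar> + 1))"
        using y vdist_nonneg[OF y(1) x'(1)] by (intro mult_mono) (auto simp: \<rho>'_def)
      also have "\<dots> = 1" using abs_ge_zero[of K] by (simp add: add_nonneg_eq_0_iff)
      finally show ?thesis using x'(3) by simp
    qed
    moreover have "0 < \<rho>'" "\<rho>' \<le> \<rho> / 2" using \<rho> by (auto simp: \<rho>'_def)
    ultimately show ?thesis using i x' by (intro exI[of _ x'] exI[of _ \<rho>']) force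
  qed
  have "\<exists>s. \<forall>n. (fst (s n) \<in> carrier X \<and> snd (s n) > 0) \<and>
     (snd (s (Suc n)) \<le> snd (s n) / 2 \<and> vdist X (fst (s (Suc n))) (fst (s n)) + snd (s (Suc n)) \<le> snd (s n) \<and>
      (\<exists>i\<in>I. \<forall>y\<in>carrier X. vdist X y (fst (s (Suc n))) \<le> snd (s (Suc n)) \<longrightarrow> real n \<le> P i y))"
  proof (rule dependent_nat_choice)
    show "\<exists>x. fst x \<in> carrier X \<and> (0 :: real) < snd x"
      using zero_closed by (intro exI[of _ "(vzero X, 1)"]) simp
  next
    fix x :: "'a \<times> real" and n
    assume "fst x \<in> carrier X \<and> 0 < snd x"
    then obtain x' \<rho>' where "x' \<in> carrier X \<and> 0 < \<rho>' \<and> \<rho>' \<le> snd x / 2 \<and>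
        vdist X x' (fst x) + \<rho>' \<le> snd x \<and>
        (\<exists>i\<in>I. \<forall>y\<in>carrier X. vdist X y x' \<le> \<rho>' \<longrightarrow> real n \<le> P i y)"
      using step[of "fst x" "snd x" n] by blast
    then show "\<exists>y. (fst y \<in> carrier X \<and> 0 < snd y) \<and> snd y \<le> snd x / 2 \<and>
        vdist X (fst y) (fst x) + snd y \<le> snd x \<and>
        (\<exists>i\<in>I. \<forall>z\<in>carrier X. vdist X z (fst y) \<le> snd y \<longrightarrow> real n \<le> P i z)"
      by (intro exI[of _ "(x', \<rho>')"]) simp
  qed
  then obtain s where s: "\<And>n. fst (s n) \<in> carrier X" "\<And>n. snd (s n) > 0"
    "\<And>n. snd (s (Suc n)) \<le> snd (s n) / 2"
    "\<And>n. vdist X (fst (s (Suc n))) (fst (s n)) + snd (s (Suc n)) \<le> snd (s n)"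
    "\<And>n. \<exists>i\<in>I. \<forall>y\<in>carrier X. vdist X y (fst (s (Suc n))) \<le> snd (s (Suc n)) \<longrightarrow> real n \<le> P i y"
    by blast
  let ?x = "\<lambda>n. fst (s n)" and ?\<rho> = "\<lambda>n. snd (s n)"
  have nested: "vdist X (?x (n + m)) (?x n) + ?\<rho> (n + m) \<le> ?\<rho> n" for n m
  proof (induction m)
    case 0
    then show ?case by (simp add: vdist_refl s)
  next
    case (Suc m)
    then show ?case
      using s(4)[of "n + m"] vdist_triangle[OF s(1)[of "Suc (n + m)"] s(1)[of "n + m"] s(1)[of n]] by simp
  qed
  have \<rho>_small: "?\<rho> n \<le> ?\<rho> 0 / 2 ^ n" for n
  proof (induction n)
    case (Suc n)
    then show ?case using s(3)[of n] by simp
  qed simp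
  have "(\<lambda>n. ?\<rho> 0 / 2 ^ n) \<longlonglongrightarrow> 0"
    using tendsto_mult_right_zero[OF LIMSEQ_inverse_realpow_zero[of 2], of "?\<rho> 0"]
    by (simp add: divide_inverse)
  then have \<rho>_lim: "?\<rho> \<longlonglongrightarrow> 0"
    by (rule null_squeeze) (use \<rho>_small s(2) less_imp_le in auto)
  have close: "vdist X (?x m) (?x n) \<le> ?\<rho> n" if "n \<le> m" for m n
    using nested[of n "m - n"] that s(2)[of m] by simp
  have "cauchy_in X ?x"
    unfolding cauchy_in_def
  proof (intro conjI allI impI s)
    fix e :: real assume "e > 0"
    then obtain n0 where n0: "\<And>n. n \<ge> n0 \<Longrightarrow> ?\<rho> n < e / 2"
      using LIMSEQ_D[OF \<rho>_lim, of "e / 2"] s(2) by force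
    have "vdist X (?x m) (?x n) < e" if "m \<ge> n0" "n \<ge> n0" for m n
      using vdist_triangle[OF s(1)[of m] s(1)[of n0] s(1)[of n]] close[OF that(1)] close[OF that(2)]
        n0[of n0] vdist_sym[OF s(1)[of n] s(1)[of n0]] by simp
    then show "\<exists>n0. \<forall>m\<ge>n0. \<forall>n\<ge>n0. vdist X (?x m) (?x n) < e" by blast
  qed
  then obtain l where l: "l \<in> carrier X" "(\<lambda>n. vdist X (?x n) l) \<longlonglongrightarrow> 0"
    using complete unfolding converges_to_def by blast
  have near: "vdist X l (?x n) \<le> ?\<rho> n" for n
  proof -
    have "vdist X l (?x n) \<le> vdist X (?x m) l + ?\<rho> n" if "n \<le> m" for m
      using vdist_triangle[OF l(1) s(1)[of m] s(1)[of n]] vdist_sym[OF l(1) s(1)[of m]] close[OF that]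
      by simp
    moreover have "(\<lambda>m. vdist X (?x m) l + ?\<rho> n) \<longlonglongrightarrow> 0 + ?\<rho> n"
      by (intro tendsto_intros l)
    ultimately show ?thesis using LIMSEQ_le_const by fastforce
  qed
  obtain K where K: "\<And>i. i \<in> I \<Longrightarrow> P i l \<le> K" using pointwise[OF l(1)] by blast
  obtain n where n: "K < real n" using reals_Archimedean2 by blast
  obtain i where "i \<in> I" "real n \<le> P i l" using s(5)[of n] near[of "Suc n"] l(1) by blast
  then show False using K n by force
qed


section \<open>Unconditional convergence\<close>

text \<open>
  The factor comes from sorting the summands by the signs of their real parts and of their
  imaginary parts: the moduli of the four resulting sums add up to at least the left side.
\<close>

lemma sum_norm_le_subset_sum:
  fixes z :: "'i \<Rightarrow> 'k::real_or_complex"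
  assumes A: "finite A"
  obtains B where "B \<subseteq> A" "(\<Sum>m\<in>A. norm (z m)) \<le> 4 * norm (\<Sum>m\<in>B. z m)"
proof -
  obtain \<phi> :: "'k \<Rightarrow> complex" where add: "\<And>x y. \<phi> (x + y) = \<phi> x + \<phi> y"
    and real': "\<And>r. \<phi> (r *\<^sub>R 1) = of_real r"
    and norm: "\<And>x. norm (\<phi> x) = norm x"
    using real_or_complex[where ?'a = 'k] by auto
  have "\<phi> 0 = 0" using real'[of 0] by simp
  then have sum: "\<phi> (\<Sum>m\<in>B. z m) = (\<Sum>m\<in>B. \<phi> (z m))" for B
    by (induction B rule: infinite_finite_induct) (auto simp: add)
  have part: "\<exists>B\<subseteq>A. (\<Sum>m\<in>A. \<bar>h m\<bar>) \<le> 2 * \<bar>\<Sum>m\<in>B. h m\<bar>" for h :: "'i \<Rightarrow> real"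
  proof -
    let ?P = "{m\<in>A. h m \<ge> 0}" and ?Q = "{m\<in>A. h m < 0}"
    have "(\<Sum>m\<in>A. \<bar>h m\<bar>) = (\<Sum>m\<in>?P \<union> ?Q. \<bar>h m\<bar>)" by (rule sum.cong) auto
    also have "\<dots> = (\<Sum>m\<in>?P. \<bar>h m\<bar>) + (\<Sum>m\<in>?Q. \<bar>h m\<bar>)"
      using A by (intro sum.union_disjoint) auto
    also have "\<dots> = (\<Sum>m\<in>?P. h m) - (\<Sum>m\<in>?Q. h m)" by (simp add: sum_negf[symmetric])
    also have "\<dots> \<le> \<bar>\<Sum>m\<in>?P. h m\<bar> + \<bar>\<Sum>m\<in>?Q. h m\<bar>" by simp
    finally have "(\<Sum>m\<in>A. \<bar>h m\<bar>) \<le> 2 * \<bar>\<Sum>m\<in>?P. h m\<bar> \<or> (\<Sum>m\<in>A. \<bar>h m\<bar>) \<le> 2 * \<bar>\<Sum>m\<in>?Q. h m\<bar>"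
      by linarith
    then show ?thesis
    proof
      assume "(\<Sum>m\<in>A. \<bar>h m\<bar>) \<le> 2 * \<bar>\<Sum>m\<in>?P. h m\<bar>"
      then show ?thesis by (intro exI[of _ ?P]) simp
    next
      assume "(\<Sum>m\<in>A. \<bar>h m\<bar>) \<le> 2 * \<bar>\<Sum>m\<in>?Q. h m\<bar>"
      then show ?thesis by (intro exI[of _ ?Q]) simp
    qed
  qed
  obtain B1 where B1: "B1 \<subseteq> A" "(\<Sum>m\<in>A. \<bar>Re (\<phi> (z m))\<bar>) \<le> 2 * \<bar>\<Sum>m\<in>B1. Re (\<phi> (z m))\<bar>"
    using part[of "\<lambda>m. Re (\<phi> (z m))"] by (elim exE conjE)
  obtain B2 where B2: "B2 \<subseteq> A" "(\<Sum>m\<in>A. \<bar>Im (\<phi> (z m))\<bar>) \<le> 2 * \<bar>\<Sum>m\<in>B2. Im (\<phi> (z m))\<bar>"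
    using part[of "\<lambda>m. Im (\<phi> (z m))"] by (elim exE conjE)
  have "(\<Sum>m\<in>A. norm (z m)) \<le> (\<Sum>m\<in>A. \<bar>Re (\<phi> (z m))\<bar> + \<bar>Im (\<phi> (z m))\<bar>)"
    using cmod_le by (intro sum_mono) (simp add: norm[symmetric])
  also have "\<dots> \<le> 2 * \<bar>\<Sum>m\<in>B1. Re (\<phi> (z m))\<bar> + 2 * \<bar>\<Sum>m\<in>B2. Im (\<phi> (z m))\<bar>"
    using B1 B2 by (simp add: sum.distrib)
  also have "\<dots> = 2 * \<bar>Re (\<phi> (\<Sum>m\<in>B1. z m))\<bar> + 2 * \<bar>Im (\<phi> (\<Sum>m\<in>B2. z m))\<bar>"
    by (simp add: sum)
  also have "\<dots> \<le> 2 * norm (\<Sum>m\<in>B1. z m) + 2 * norm (\<Sum>m\<in>B2. z m)"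
    using abs_Re_le_cmod[of "\<phi> (\<Sum>m\<in>B1. z m)"] abs_Im_le_cmod[of "\<phi> (\<Sum>m\<in>B2. z m)"]
    by (simp add: norm)
  finally have "(\<Sum>m\<in>A. norm (z m)) \<le> 4 * norm (\<Sum>m\<in>B1. z m) \<or>
      (\<Sum>m\<in>A. norm (z m)) \<le> 4 * norm (\<Sum>m\<in>B2. z m)" by linarith
  then show thesis using that[OF B1(1)] that[OF B2(1)] by (elim disjE)
qed

lemma permutation_onto_subset:
  assumes S: "finite S" and A: "A \<subseteq> S" and B: "B \<subseteq> S" and card: "card A = card B"
  shows "\<exists>\<tau>. bij_betw \<tau> S S \<and> \<tau> ` A = B"
proof -
  have fin: "finite A" "finite B" "finite (S - A)" "finite (S - B)" using S A B finite_subset by auto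
  obtain \<tau>1 where 1: "bij_betw \<tau>1 A B" using finite_same_card_bij[OF fin(1,2) card] by blast
  have "card (S - A) = card (S - B)" using A B card fin by (simp add: card_Diff_subset)
  then obtain \<tau>2 where 2: "bij_betw \<tau>2 (S - A) (S - B)" using finite_same_card_bij fin by blast
  let ?\<tau> = "\<lambda>x. if x \<in> A then \<tau>1 x else \<tau>2 x"
  have "bij_betw ?\<tau> A B" using 1 by (simp cong: bij_betw_cong)
  moreover have "bij_betw ?\<tau> (S - A) (S - B)" using 2 by (subst bij_betw_cong[of _ _ \<tau>2]) auto
  ultimately have "bij_betw ?\<tau> (A \<union> (S - A)) (B \<union> (S - B))"
    by (rule bij_betw_combine) auto
  moreover have "?\<tau> ` A = B" using 1 by (auto simp: bij_betw_def)
  ultimately show ?thesis using A B by (metis Un_Diff_cancel sup.absorb2)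
qed

text \<open>
  Permutations of the consecutive blocks \<open>{a k..<a (Suc k)}\<close> combine to one of the natural numbers.
\<close>

lemma blockwise_permutation:
  assumes a: "strict_mono a" "a 0 = (0::nat)" and \<tau>: "\<And>k. bij_betw (\<tau> k) {a k..<a (Suc k)} {a k..<a (Suc k)}"
  obtains \<sigma> where "bij \<sigma>" "\<And>k n. n \<in> {a k..<a (Suc k)} \<Longrightarrow> \<sigma> n = \<tau> k n"
proof -
  have ex: "\<exists>k. n \<in> {a k..<a (Suc k)}" for n
  proof (induction n)
    case 0
    then show ?case using a strict_monoD[OF a(1), of 0 "Suc 0"] by (intro exI[of _ 0]) auto
  next
    case (Suc n)
    then obtain k where "n \<in> {a k..<a (Suc k)}" by blast
    then show ?case
      using strict_monoD[OF a(1), of "Suc k" "Suc (Suc k)"]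
      by (cases "Suc n < a (Suc k)") (auto intro: exI[of _ k] exI[of _ "Suc k"])
  qed
  have unique: "j = k" if "n \<in> {a j..<a (Suc j)}" "n \<in> {a k..<a (Suc k)}" for n j k
  proof (rule ccontr)
    assume "j \<noteq> k"
    then have "Suc j \<le> k \<or> Suc k \<le> j" by linarith
    then have "a (Suc j) \<le> a k \<or> a (Suc k) \<le> a j" using a(1) strict_mono_less_eq by blast
    then show False using that by auto
  qed
  define \<kappa> where "\<kappa> n = (SOME k. n \<in> {a k..<a (Suc k)})" for n
  have \<kappa>: "n \<in> {a (\<kappa> n)..<a (Suc (\<kappa> n))}" for n unfolding \<kappa>_def by (rule someI_ex[OF ex])
  define \<sigma> where "\<sigma> n = \<tau> (\<kappa> n) n" for n
  have \<sigma>: "\<sigma> n = \<tau> k n" if "n \<in> {a k..<a (Suc k)}" for k n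
    unfolding \<sigma>_def using unique[OF \<kappa> that] by simp
  have \<sigma>_block: "\<sigma> n \<in> {a (\<kappa> n)..<a (Suc (\<kappa> n))}" for n
    unfolding \<sigma>_def using bij_betwE[OF \<tau>] \<kappa> by blast
  have "inj \<sigma>"
  proof (rule injI)
    fix m n assume eq: "\<sigma> m = \<sigma> n"
    then have "\<kappa> m = \<kappa> n" using unique \<sigma>_block by metis
    then show "m = n"
      using eq \<kappa>[of m] \<kappa>[of n] inj_onD[OF bij_betw_imp_inj_on[OF \<tau>[of "\<kappa> n"]], of m n]
      unfolding \<sigma>_def by simp
  qed
  moreover have "surj \<sigma>"
  proof -
    have "\<exists>n. \<sigma> n = m" for m
    proof -
      have "m \<in> \<tau> (\<kappa> m) ` {a (\<kappa> m)..<a (Suc (\<kappa> m))}"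
        using \<kappa>[of m] bij_betw_imp_surj_on[OF \<tau>] by blast
      then show ?thesis using \<sigma> by (metis imageE)
    qed
    then show ?thesis unfolding surj_def by metis
  qed
  ultimately show thesis using that[of \<sigma>] \<sigma> by (simp add: bij_def)
qed

lemma (in normed_space) functional_partial_sum:
  assumes f: "linear_map X scalars f" and v: "\<And>m. v m \<in> carrier X"
  shows "f (partial_sum X v n) = (\<Sum>m<n. f (v m))"
proof (induction n)
  case 0
  then show ?case using linear_map_zero[OF normed_space_axioms normed_scalars f] by simp
next
  case (Suc n)
  then show ?case
    using linear_map_scalarsD(1)[OF f partial_sum_closed[of v n, OF v] v[of n]] by simp
qed

text \<open>
  If all rearrangements of a series converge, then the sums \<open>\<Sum>m<M. |f(v m)|\<close> are bounded uniformly
  in \<open>M\<close> and in \<open>f\<close> from the dual ball. Otherwise there are, arbitrarily far out, finite sets over which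
  the values of some \<open>f\<close> have a sum of modulus at least \<open>1\<close>; a rearrangement in which each of these
  sets is traversed without interruption diverges.
\<close>

lemma (in normed_space) unconditional_bounded:
  fixes v :: "nat \<Rightarrow> 'a"
  assumes v: "\<And>m. v m \<in> carrier X"
    and conv: "\<And>\<sigma>. bij \<sigma> \<Longrightarrow> \<exists>x\<in>carrier X. series_sums X (\<lambda>m. v (\<sigma> m)) x"
  shows "\<exists>K. \<forall>f\<in>dual_ball X. \<forall>M. (\<Sum>m<M. norm (f (v m))) \<le> K"
proof (rule ccontr)
  assume contra: "\<not> ?thesis"
  have "\<exists>n' B f. n < n' \<and> B \<subseteq> {n..<n'} \<and> f \<in> dual_ball X \<and> 1 \<le> norm (\<Sum>m\<in>B. f (v m))" for n :: nat
  proof -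
    obtain f M where f: "f \<in> dual_ball X" and M: "(\<Sum>m<M. norm (f (v m))) > (\<Sum>m<n. nrm X (v m)) + 4"
      using contra by (meson not_le)
    have head: "(\<Sum>m<n. norm (f (v m))) \<le> (\<Sum>m<n. nrm X (v m))"
      by (intro sum_mono dual_ball_le f v)
    have nM: "n < M"
    proof (rule ccontr)
      assume "\<not> n < M"
      then have "(\<Sum>m<M. norm (f (v m))) \<le> (\<Sum>m<n. norm (f (v m)))" by (intro sum_mono2) auto
      then show False using head M by linarith
    qed
    have "(\<Sum>m<M. norm (f (v m))) = (\<Sum>m<n. norm (f (v m))) + (\<Sum>m\<in>{n..<M}. norm (f (v m)))"
      using sum.atLeastLessThan_concat[of 0 n M "\<lambda>m. norm (f (v m))"] nM by (simp add: atLeast0LessThan)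
    then have "4 \<le> (\<Sum>m\<in>{n..<M}. norm (f (v m)))" using head M by linarith
    moreover obtain B where "B \<subseteq> {n..<M}"
      "(\<Sum>m\<in>{n..<M}. norm (f (v m))) \<le> 4 * norm (\<Sum>m\<in>B. f (v m))"
      by (rule sum_norm_le_subset_sum[of "{n..<M}" "\<lambda>m. f (v m)"]) auto
    ultimately show ?thesis using nM f by (intro exI[of _ M] exI[of _ B] exI[of _ f]) auto
  qed
  then obtain g B f where g: "\<And>n. n < g n" and B: "\<And>n. B n \<subseteq> {n..<g n}"
    and f: "\<And>n. f n \<in> dual_ball X" and fB: "\<And>n. 1 \<le> norm (\<Sum>m\<in>B n. f n (v m))"
    by metis
  \<comment> \<open>the \<open>k\<close>-th block runs from \<open>a k\<close> to \<open>a (Suc k)\<close> and contains the set \<open>B (a k)\<close>\<close>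
  define a where "a k = (g ^^ k) 0" for k
  have a: "a 0 = 0" "a (Suc k) = g (a k)" for k by (simp_all add: a_def)
  have mono: "strict_mono a" by (rule strict_mono_Suc_iff[THEN iffD2]) (simp add: a g)
  let ?c = "\<lambda>k. a k + card (B (a k))"
  have c_le: "?c k \<le> a (Suc k)" for k
    using card_mono[OF _ B[of "a k"]] g[of "a k"] by (simp add: a)
  have "\<exists>\<tau>. bij_betw \<tau> {a k..<a (Suc k)} {a k..<a (Suc k)} \<and> \<tau> ` {a k..<?c k} = B (a k)" for k
    by (rule permutation_onto_subset) (use c_le[of k] B[of "a k"] in \<open>auto simp: a\<close>)
  then obtain \<tau> where \<tau>: "\<And>k. bij_betw (\<tau> k) {a k..<a (Suc k)} {a k..<a (Suc k)}"
    and \<tau>B: "\<And>k. \<tau> k ` {a k..<?c k} = B (a k)" by metis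
  obtain \<sigma> where \<sigma>: "bij \<sigma>" and \<sigma>\<tau>: "\<And>k n. n \<in> {a k..<a (Suc k)} \<Longrightarrow> \<sigma> n = \<tau> k n"
    using blockwise_permutation[OF mono a(1) \<tau>] by blast
  obtain x where x: "x \<in> carrier X" and lim: "(\<lambda>n. vdist X (partial_sum X (\<lambda>m. v (\<sigma> m)) n) x) \<longlonglongrightarrow> 0"
    using conv[OF \<sigma>] unfolding series_sums_def converges_to_def by blast
  let ?s = "partial_sum X (\<lambda>m. v (\<sigma> m))"
  have s: "?s n \<in> carrier X" for n by (rule partial_sum_closed) (rule v)
  obtain n0 where n0: "\<And>n. n \<ge> n0 \<Longrightarrow> vdist X (?s n) x < 1 / 2"
    using LIMSEQ_D[OF lim, of "1 / 2"] by force
  have "n0 \<le> a n0" using mono by (rule strict_mono_imp_increasing)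
  define k where "k = n0"
  have far: "n0 \<le> a k" "n0 \<le> ?c k" using \<open>n0 \<le> a n0\<close> by (auto simp: k_def)
  have img: "\<sigma> ` {a k..<?c k} = B (a k)"
  proof -
    have "\<sigma> n = \<tau> k n" if "n \<in> {a k..<?c k}" for n
      by (rule \<sigma>\<tau>) (use that c_le[of k] in auto)
    then show ?thesis using \<tau>B[of k] by (metis (no_types, lifting) image_cong)
  qed
  have "(\<Sum>m\<in>B (a k). f (a k) (v m)) = (\<Sum>m\<in>{a k..<?c k}. f (a k) (v (\<sigma> m)))"
    by (rule sum.reindex_cong[of \<sigma>]) (use \<sigma> img in \<open>auto simp: bij_def inj_on_def\<close>)
  also have "\<dots> = (\<Sum>m<?c k. f (a k) (v (\<sigma> m))) - (\<Sum>m<a k. f (a k) (v (\<sigma> m)))"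
    using sum.atLeastLessThan_concat[of 0 "a k" "?c k" "\<lambda>m. f (a k) (v (\<sigma> m))"]
    by (simp add: atLeast0LessThan algebra_simps)
  also have "\<dots> = f (a k) (vadd X (?s (?c k)) (smul X (- 1) (?s (a k))))"
    using linear_map_diff[OF normed_space_axioms dual_ball_linear[OF f[of "a k"]] s[of "?c k"] s[of "a k"]]
    by (simp add: functional_partial_sum[OF dual_ball_linear[OF f]] v)
  also have "norm \<dots> \<le> vdist X (?s (?c k)) (?s (a k))"
    unfolding vdist_def using s by (intro dual_ball_le f closed)
  also have "\<dots> \<le> vdist X (?s (?c k)) x + vdist X (?s (a k)) x"
    using vdist_triangle[OF s x s, of "?c k" "a k"] vdist_sym[OF s x, of "a k"] by simp
  also have "\<dots> < 1" using n0[OF far(1)] n0[OF far(2)] by linarith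
  finally show False using fB[of "a k"] by linarith
qed


section \<open>Besselian norms\<close>

lemma suminf_ennreal_le_const:
  assumes "\<And>m. 0 \<le> f m" "\<And>n. (\<Sum>m<n. f m) \<le> M"
  shows "(\<Sum>m. ennreal (f m)) \<le> ennreal M"
proof (rule suminf_le_const[OF summableI])
  fix n
  have "(\<Sum>m<n. ennreal (f m)) = ennreal (\<Sum>m<n. f m)" using assms(1) by (simp add: sum_ennreal)
  then show "(\<Sum>m<n. ennreal (f m)) \<le> ennreal M" using assms(2) by (simp add: ennreal_leI)
qed

lemma sum_le_suminf_ennreal:
  assumes "\<And>m. 0 \<le> f m"
  shows "ennreal (\<Sum>m<n. f m) \<le> (\<Sum>m. ennreal (f m))"
proof -
  have "ennreal (\<Sum>m<n. f m) = (\<Sum>m<n. ennreal (f m))" using assms by (simp add: sum_ennreal)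
  also have "\<dots> \<le> (\<Sum>m. ennreal (f m))" by (rule sum_le_suminf) auto
  finally show ?thesis .
qed

lemma bess_space_simps [simp]:
  "carrier (bess_space X B) = carrier X" "vadd (bess_space X B) = vadd X"
  "vzero (bess_space X B) = vzero X" "smul (bess_space X B) = smul X"
  "nrm (bess_space X B) x = enn2real (bess_norm X B x)"
  unfolding bess_space_def by simp_all

text \<open>
  The properties of an unconditional Schauder basis on which the arguments about tensor
  products rest: the Besselian norm is finite and dominates the given norm.
\<close>

locale bessel_system = normed_space X
  for X :: "('k::real_or_complex, 'a) nspace" +
  fixes B :: "('k, 'a) basis"
  assumes basis_closed: "fst (B m) \<in> carrier X"
    and coord_linear: "linear_map X scalars (snd (B m))"
    and bess_finite: "x \<in> carrier X \<Longrightarrow> bess_norm X B x < top"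
    and nrm_le_bess: "x \<in> carrier X \<Longrightarrow> ennreal (nrm X x) \<le> bess_norm X B x"
begin

lemma ennreal_bess_nrm:
  "x \<in> carrier X \<Longrightarrow> ennreal (enn2real (bess_norm X B x)) = bess_norm X B x"
  using bess_finite by (simp add: less_top)

lemma bess_norm_add:
  assumes x: "x \<in> carrier X" and y: "y \<in> carrier X"
  shows "bess_norm X B (vadd X x y) \<le> bess_norm X B x + bess_norm X B y"
  unfolding bess_norm_def[of X B "vadd X x y"]
proof (rule SUP_least)
  fix f assume f: "f \<in> dual_ball X"
  have "(\<Sum>m. ennreal (norm (snd (B m) (vadd X x y) * f (fst (B m)))))
     \<le> (\<Sum>m. ennreal (norm (snd (B m) x * f (fst (B m)))) + ennreal (norm (snd (B m) y * f (fst (B m)))))"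
    by (intro suminf_le summableI)
       (auto simp: linear_map_scalarsD(1)[OF coord_linear] x y distrib_right norm_triangle_ineq
         simp flip: ennreal_plus intro!: ennreal_leI)
  also have "\<dots> = (\<Sum>m. ennreal (norm (snd (B m) x * f (fst (B m)))))
      + (\<Sum>m. ennreal (norm (snd (B m) y * f (fst (B m)))))"
    by (rule suminf_add[symmetric]) (rule summableI)+
  also have "\<dots> \<le> bess_norm X B x + bess_norm X B y"
    unfolding bess_norm_def by (intro add_mono SUP_upper f)
  finally show "(\<Sum>m. ennreal (norm (snd (B m) (vadd X x y) * f (fst (B m)))))
     \<le> bess_norm X B x + bess_norm X B y" .
qed

lemma bess_norm_smul:
  assumes x: "x \<in> carrier X"
  shows "bess_norm X B (smul X c x) = ennreal (norm c) * bess_norm X B x"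
  unfolding bess_norm_def SUP_mult_left_ennreal ennreal_suminf_cmult[symmetric]
  by (simp add: linear_map_scalarsD(2)[OF coord_linear] x norm_mult mult.assoc ennreal_mult)

lemma normed_bess_space: "normed_space (bess_space X B)"
proof
  fix x y and c :: 'k
  assume x: "x \<in> carrier (bess_space X B)"
  then have x': "x \<in> carrier X" by simp
  show "nrm (bess_space X B) (smul (bess_space X B) c x) = norm c * nrm (bess_space X B) x"
    using x by (simp add: bess_norm_smul enn2real_mult)
  show "nrm (bess_space X B) x = 0 \<longleftrightarrow> x = vzero (bess_space X B)"
  proof
    assume "nrm (bess_space X B) x = 0"
    then have "bess_norm X B x = 0" using ennreal_bess_nrm[OF x'] by simp
    then have "nrm X x \<le> 0" using nrm_le_bess[OF x'] by (simp add: ennreal_eq_0_iff)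
    then show "x = vzero (bess_space X B)"
      using nrm_nonneg[OF x'] nrm_eq_zero[OF x'] by simp
  next
    assume "x = vzero (bess_space X B)"
    then have "smul X 0 x = x" using smul_zero_left[OF x'] by simp
    then show "nrm (bess_space X B) x = 0" using bess_norm_smul[OF x', of 0] by simp
  qed
  assume y: "y \<in> carrier (bess_space X B)"
  have "enn2real (bess_norm X B (vadd X x y)) \<le> enn2real (bess_norm X B x + bess_norm X B y)"
    using x y bess_finite by (intro enn2real_mono bess_norm_add) (auto simp: less_top)
  also have "\<dots> = enn2real (bess_norm X B x) + enn2real (bess_norm X B y)"
    using x y bess_finite by (intro enn2real_plus) auto
  finally show "nrm (bess_space X B) (vadd (bess_space X B) x y)
      \<le> nrm (bess_space X B) x + nrm (bess_space X B) y" by simp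
qed (auto simp: closed add_assoc add_ac add_zero add_inverse smul_add_right smul_add_left smul_smul smul_one)

lemma nrm_le_bess_nrm: "x \<in> carrier X \<Longrightarrow> nrm X x \<le> nrm (bess_space X B) x"
  using nrm_le_bess[of x] bess_finite[of x] enn2real_mono[of "ennreal (nrm X x)" "bess_norm X B x"]
  by (simp add: nrm_nonneg)

end

text \<open>
  Boundedness of the Besselian norm comes from uniform boundedness of the seminorms
  \<open>x \<mapsto> \<Sum>m<M. |b\<^sub>m\<^sup>*(x) f(a\<^sub>m)|\<close>, and the lower estimate from a norming functional.
\<close>

lemma USB_bess_norm_le:
  assumes X: "banach_space X" and B: "USB X B"
  obtains K where "K > 0" "\<And>x. x \<in> carrier X \<Longrightarrow> bess_norm X B x \<le> ennreal (K * nrm X x)"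
proof -
  interpret banach_space X by fact
  have a: "fst (B m) \<in> carrier X" and b: "snd (B m) \<in> dual X" for m using B unfolding USB_def by auto
  have lin: "linear_map X scalars (snd (B m))" for m using b unfolding dual_def by auto
  define P where "P i x = (\<Sum>m<snd i. norm (snd (B m) x * fst i (fst (B m))))" for i x
  have "\<exists>K>0. \<forall>i\<in>dual_ball X \<times> UNIV. \<forall>x\<in>carrier X. P i x \<le> K * nrm X x"
  proof (rule uniform_boundedness)
    fix i x y assume "x \<in> carrier X" "y \<in> carrier X"
    then show "P i (vadd X x y) \<le> P i x + P i y"
      unfolding P_def sum.distrib[symmetric]
      by (intro sum_mono) (simp add: linear_map_scalarsD(1)[OF lin] distrib_right norm_triangle_ineq)
  next
    fix i x c assume "x \<in> carrier X"
    then show "P i (smul X c x) = norm c * P i x"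
      unfolding P_def by (simp add: linear_map_scalarsD(2)[OF lin] norm_mult sum_distrib_left mult.assoc)
  next
    fix i assume "i \<in> dual_ball X \<times> (UNIV :: nat set)"
    have "\<forall>m. \<exists>C. \<forall>x\<in>carrier X. norm (snd (B m) x) \<le> C * nrm X x" using b unfolding dual_def by auto
    then obtain C where C: "\<And>m x. x \<in> carrier X \<Longrightarrow> norm (snd (B m) x) \<le> C m * nrm X x" by metis
    have "P i x \<le> (\<Sum>m<snd i. C m * norm (fst i (fst (B m)))) * nrm X x" if "x \<in> carrier X" for x
      unfolding P_def sum_distrib_right
    proof (rule sum_mono)
      fix m
      show "norm (snd (B m) x * fst i (fst (B m))) \<le> C m * norm (fst i (fst (B m))) * nrm X x"
        using mult_right_mono[OF C[OF that, of m], of "norm (fst i (fst (B m)))"]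
        by (simp add: norm_mult mult_ac)
    qed
    then show "\<exists>K. \<forall>x\<in>carrier X. P i x \<le> K * nrm X x" by blast
  next
    fix x assume x: "x \<in> carrier X"
    define v where "v m = smul X (snd (B m) x) (fst (B m))" for m
    have "\<exists>K. \<forall>f\<in>dual_ball X. \<forall>M. (\<Sum>m<M. norm (f (v m))) \<le> K"
    proof (rule unconditional_bounded)
      show "v m \<in> carrier X" for m unfolding v_def by (intro closed a)
      show "\<exists>x\<in>carrier X. series_sums X (\<lambda>m. v (\<sigma> m)) x" if "bij \<sigma>" for \<sigma>
        using B x that unfolding USB_def v_def by blast
    qed
    then obtain K where K: "\<And>f M. f \<in> dual_ball X \<Longrightarrow> (\<Sum>m<M. norm (f (v m))) \<le> K" by blast
    have "P i x \<le> K" if "i \<in> dual_ball X \<times> UNIV" for i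
      using K[of "fst i" "snd i"] that linear_map_scalarsD(2)[OF dual_ball_linear a, of "fst i"]
      unfolding P_def v_def by (auto simp: mem_Times_iff)
    then show "\<exists>K. \<forall>i\<in>dual_ball X \<times> UNIV. P i x \<le> K" by blast
  qed
  then obtain K where K: "K > 0" and
    le: "\<And>i x. \<lbrakk>i \<in> dual_ball X \<times> UNIV; x \<in> carrier X\<rbrakk> \<Longrightarrow> P i x \<le> K * nrm X x" by blast
  have "bess_norm X B x \<le> ennreal (K * nrm X x)" if "x \<in> carrier X" for x
    unfolding bess_norm_def
    using le[OF _ that, unfolded P_def] by (intro SUP_least suminf_ennreal_le_const) auto
  then show thesis using that K by blast
qed

lemma USB_bessel_system:
  assumes X: "banach_space X" and B: "USB X B" shows "bessel_system X B"
proof -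
  interpret banach_space X by fact
  have a: "fst (B m) \<in> carrier X" and b: "snd (B m) \<in> dual X" for m using B unfolding USB_def by auto
  show ?thesis
  proof
    fix x m
    show "fst (B m) \<in> carrier X" by (rule a)
    show "linear_map X scalars (snd (B m))" using b unfolding dual_def by auto
    assume x: "x \<in> carrier X"
    obtain K where "bess_norm X B x \<le> ennreal (K * nrm X x)"
      using USB_bess_norm_le[OF X B] x by metis
    then show "bess_norm X B x < top" using ennreal_less_top le_less_trans by blast
    obtain f where f: "f \<in> dual_ball X" and fx: "norm (f x) = nrm X x" using norming_functional[OF x] .
    define v where "v m = smul X (snd (B m) x) (fst (B m))" for m
    have v: "v m \<in> carrier X" for m unfolding v_def by (intro closed a)
    have "series_sums X (\<lambda>m. smul X (snd (B (id m)) x) (fst (B (id m)))) x"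
      using B x bij_id unfolding USB_def by blast
    then have lim: "(\<lambda>n. vdist X (partial_sum X v n) x) \<longlonglongrightarrow> 0"
      unfolding v_def series_sums_def converges_to_def by simp
    have fv: "f (v m) = snd (B m) x * f (fst (B m))" for m
      unfolding v_def by (rule linear_map_scalarsD(2)[OF dual_ball_linear[OF f] a])
    have "ennreal (nrm X x) \<le> (\<Sum>m. ennreal (norm (f (v m)))) + ennreal e" if e: "e > 0" for e
    proof -
      obtain n where n: "vdist X (partial_sum X v n) x < e"
        using order_tendstoD(2)[OF lim e] unfolding eventually_sequentially by blast
      let ?s = "partial_sum X v n"
      have s: "?s \<in> carrier X" by (rule partial_sum_closed[OF v])
      have "nrm X x = norm (f (vadd X x (smul X (- 1) ?s)) + f ?s)"
        using linear_map_diff[OF normed_space_axioms dual_ball_linear[OF f] x s] by (simp add: fx)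
      also have "\<dots> \<le> norm (f (vadd X x (smul X (- 1) ?s))) + norm (f ?s)" by (rule norm_triangle_ineq)
      also have "norm (f (vadd X x (smul X (- 1) ?s))) \<le> vdist X x ?s"
        unfolding vdist_def by (intro dual_ball_le f closed x s)
      also have "\<dots> \<le> e" using n vdist_sym[OF x s] by simp
      also have "norm (f ?s) \<le> (\<Sum>m<n. norm (f (v m)))"
        unfolding functional_partial_sum[OF dual_ball_linear[OF f] v] by (rule norm_sum)
      finally have "ennreal (nrm X x) \<le> ennreal (\<Sum>m<n. norm (f (v m))) + ennreal e"
        using e by (simp add: ennreal_leI sum_nonneg add.commute flip: ennreal_plus)
      also have "\<dots> \<le> (\<Sum>m. ennreal (norm (f (v m)))) + ennreal e"
        by (intro add_right_mono sum_le_suminf_ennreal) simp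
      finally show ?thesis .
    qed
    then have "ennreal (nrm X x) \<le> (\<Sum>m. ennreal (norm (f (v m))))"
      by (rule ennreal_le_epsilon)
    also have "\<dots> \<le> bess_norm X B x"
      unfolding bess_norm_def fv by (rule SUP_upper) (rule f)
    finally show "ennreal (nrm X x) \<le> bess_norm X B x" .
  qed
qed

text \<open>The Besselian norm is complete when it is equivalent to the given one.\<close>

lemma banach_bess_space:
  assumes X: "banach_space X" and B: "bessel_system X B"
    and K: "\<And>x. x \<in> carrier X \<Longrightarrow> bess_norm X B x \<le> ennreal (K * nrm X x)"
  shows "banach_space (bess_space X B)"
proof -
  interpret banach_space X by fact
  interpret bessel_system X B by fact
  interpret B: normed_space "bess_space X B" by (rule normed_bess_space)
  have le: "vdist X x y \<le> vdist (bess_space X B) x y"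
    "vdist (bess_space X B) x y \<le> \<bar>K\<bar> * vdist X x y" if "x \<in> carrier X" "y \<in> carrier X" for x y
  proof -
    have d: "vadd X x (smul X (- 1) y) \<in> carrier X" using that by (intro closed)
    show "vdist X x y \<le> vdist (bess_space X B) x y"
      using nrm_le_bess_nrm[OF d] by (simp add: vdist_def)
    have "K * vdist X x y \<le> \<bar>K\<bar> * vdist X x y"
      using vdist_nonneg that by (intro mult_right_mono) auto
    then have "bess_norm X B (vadd X x (smul X (- 1) y)) \<le> ennreal (\<bar>K\<bar> * vdist X x y)"
      unfolding vdist_def by (rule order_trans[OF K[OF d] ennreal_leI])
    then have "enn2real (bess_norm X B (vadd X x (smul X (- 1) y))) \<le> \<bar>K\<bar> * vdist X x y"
      using vdist_nonneg that by (intro enn2real_leI) auto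
    then show "vdist (bess_space X B) x y \<le> \<bar>K\<bar> * vdist X x y"
      by (simp add: vdist_def[of "bess_space X B"])
  qed
  show ?thesis
  proof
    fix s assume s: "cauchy_in (bess_space X B) s"
    then have sc: "s n \<in> carrier X" for n unfolding cauchy_in_def by simp
    then have "cauchy_in X s" using s le(1) unfolding cauchy_in_def by (meson le_less_trans)
    then obtain x where x: "x \<in> carrier X" "(\<lambda>n. vdist X (s n) x) \<longlonglongrightarrow> 0"
      using complete unfolding converges_to_def by blast
    have "(\<lambda>n. vdist (bess_space X B) (s n) x) \<longlonglongrightarrow> 0"
      by (rule null_squeeze[OF tendsto_mult_right_zero[OF x(2), of "\<bar>K\<bar>"]])
         (use le(2) sc x B.vdist_nonneg in auto)
    then show "\<exists>x\<in>carrier (bess_space X B). converges_to (bess_space X B) s x"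
      using x unfolding converges_to_def by auto
  qed
qed


section \<open>Scalar sequence spaces with the unit basis\<close>

lemma unit_basis_simps [simp]:
  "fst (unit_basis m) = (\<lambda>i. if i = m then 1 else 0)" "snd (unit_basis m) x = x m"
  unfolding unit_basis_def by simp_all

context sequence_norm
begin

lemma unit_closed:
  "(\<lambda>i. if i = m then 1 else 0) \<in> carrier (sequence_space C N (scalars :: ('k::real_or_complex, 'k) nspace))"
  by (auto intro: finite_support_mem[of _ "Suc m"])

lemma truncation_closed:
  "(\<lambda>i. if i < n then x i else 0) \<in> carrier (sequence_space C N (scalars :: ('k::real_or_complex, 'k) nspace))"
  by (auto intro: finite_support_mem[of _ n])

lemma functional_truncation:
  fixes x :: "nat \<Rightarrow> 'k::real_or_complex"
  assumes f: "linear_map (sequence_space C N scalars) scalars f"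
  shows "f (\<lambda>i. if i < n then x i else 0) = (\<Sum>m<n. x m * f (\<lambda>i. if i = m then 1 else 0))"
proof (induction n)
  case 0
  then show ?case
    using linear_map_zero[OF normed_sequence_space[OF normed_scalars] normed_scalars f] by simp
next
  case (Suc n)
  let ?S = "sequence_space C N (scalars :: ('k, 'k) nspace)"
  interpret S: normed_space ?S by (rule normed_sequence_space[OF normed_scalars])
  have "(\<lambda>i. if i < Suc n then x i else 0)
     = vadd ?S (\<lambda>i. if i < n then x i else 0) (smul ?S (x n) (\<lambda>i. if i = n then 1 else 0))"
    by (rule ext) (auto simp: less_Suc_eq)
  then have "f (\<lambda>i. if i < Suc n then x i else 0)
     = f (\<lambda>i. if i < n then x i else 0) + x n * f (\<lambda>i. if i = n then 1 else 0)"
    using linear_map_scalarsD(1)[OF f truncation_closed S.smul_closed[OF unit_closed], of n x "x n" n]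
      linear_map_scalarsD(2)[OF f unit_closed, of "x n" n] by simp
  then show ?case using Suc by simp
qed

text \<open>
  The coefficients of a functional in the dual ball pair with a sequence to at most its norm:
  the signs of the sequence can be chosen to make all summands nonnegative.
\<close>

lemma dual_ball_pairing:
  fixes f :: "(nat \<Rightarrow> 'k::real_or_complex) \<Rightarrow> 'k"
  assumes f: "f \<in> dual_ball (sequence_space C N scalars)" and a: "a \<in> C" "\<And>i. 0 \<le> a i"
  shows "(\<Sum>m. ennreal (a m * norm (f (\<lambda>i. if i = m then 1 else 0)))) \<le> ennreal (N a)"
proof (rule suminf_ennreal_le_const)
  let ?S = "sequence_space C N (scalars :: ('k, 'k) nspace)"
  interpret S: normed_space ?S by (rule normed_sequence_space[OF normed_scalars])
  let ?f = "\<lambda>m. f (\<lambda>i. if i = m then 1 else 0)"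
  fix n
  have "\<forall>m. \<exists>c :: 'k. norm c = 1 \<and> c * ?f m = of_real (norm (?f m))"
    using unimodular_rotation by metis
  then obtain c :: "nat \<Rightarrow> 'k" where c: "\<And>m. norm (c m) = 1" "\<And>m. c m * ?f m = of_real (norm (?f m))"
    by metis
  let ?x = "\<lambda>i. if i < n then of_real (a i) * c i else 0"
  have "f ?x = (\<Sum>m<n. of_real (a m) * c m * ?f m)"
    by (rule functional_truncation[OF dual_ball_linear[OF f]])
  also have "\<dots> = of_real (\<Sum>m<n. a m * norm (?f m))" by (simp add: mult.assoc c)
  finally have "norm (f ?x) = (\<Sum>m<n. a m * norm (?f m))"
    using a by (simp only: norm_of_real) (simp add: sum_nonneg)
  moreover have "norm (f ?x) \<le> nrm ?S ?x" by (rule S.dual_ball_le[OF f truncation_closed])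
  moreover have "nrm ?S ?x \<le> N a"
    unfolding sequence_space_simps by (rule N_mono) (use a c in \<open>auto simp: norm_mult\<close>)
  ultimately show "(\<Sum>m<n. a m * norm (?f m)) \<le> N a" by linarith
qed (use a in auto)

lemma coordinate_in_dual_ball:
  "(\<lambda>x. x m) \<in> dual_ball (sequence_space C N (scalars :: ('k::real_or_complex, 'k) nspace))"
proof -
  interpret S: normed_space "sequence_space C N (scalars :: ('k, 'k) nspace)"
    by (rule normed_sequence_space[OF normed_scalars])
  show ?thesis
  proof (rule S.dual_ballI)
    fix x :: "nat \<Rightarrow> 'k"
    assume "x \<in> carrier (sequence_space C N scalars)"
    then show "norm (x m) \<le> nrm (sequence_space C N scalars) x"
      using coord_le[of "\<lambda>i. norm (x i)" m] by simp
  qed (simp add: linear_map_def)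
qed

text \<open>By the Hahn-Banach theorem the estimate of \<open>dual_ball_pairing\<close> is attained.\<close>

lemma norming_coefficients:
  assumes a: "a \<in> C" "\<And>i. 0 \<le> a i"
  obtains f where "f \<in> dual_ball (sequence_space C N (scalars :: ('k::real_or_complex, 'k) nspace))"
    "ennreal (N a) \<le> (\<Sum>m. ennreal (a m * norm (f (\<lambda>i. if i = m then 1 else 0))))"
proof -
  let ?S = "sequence_space C N (scalars :: ('k, 'k) nspace)"
  interpret S: normed_space ?S by (rule normed_sequence_space[OF normed_scalars])
  let ?x = "\<lambda>i. of_real (a i) :: 'k"
  have abs_a: "\<bar>a i\<bar> = a i" for i using a by simp
  have x: "?x \<in> carrier ?S" using a by (simp add: abs_a)
  obtain f where f: "f \<in> dual_ball ?S" and fx: "norm (f ?x) = N a"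
    using S.norming_functional[OF x] by (auto simp: abs_a)
  let ?f = "\<lambda>m. f (\<lambda>i. if i = m then 1 else 0)"
  have "ennreal (N a) \<le> (\<Sum>m. ennreal (a m * norm (?f m))) + ennreal e" if e: "e > 0" for e
  proof -
    obtain n where n: "N (\<lambda>i. if i < n then 0 else a i) \<le> e" using tail_small[OF a e] .
    let ?y = "\<lambda>i. if i < n then ?x i else 0"
    have d: "vadd ?S ?x (smul ?S (- 1) ?y) = (\<lambda>i. if i < n then 0 else ?x i)" by auto
    have "N a = norm (f (vadd ?S ?x (smul ?S (- 1) ?y)) + f ?y)"
      using linear_map_diff[OF S.normed_space_axioms dual_ball_linear[OF f] x truncation_closed, of n ?x]
      by (simp only: scalars_simps fx[symmetric]) simp
    also have "\<dots> \<le> norm (f (vadd ?S ?x (smul ?S (- 1) ?y))) + norm (f ?y)" by (rule norm_triangle_ineq)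
    also have "norm (f (vadd ?S ?x (smul ?S (- 1) ?y))) \<le> nrm ?S (vadd ?S ?x (smul ?S (- 1) ?y))"
      by (intro S.dual_ball_le f S.closed x truncation_closed)
    also have "\<dots> = N (\<lambda>i. if i < n then 0 else a i)"
      unfolding d sequence_space_simps by (intro arg_cong[of _ _ N]) (auto simp: abs_a)
    also have "\<dots> \<le> e" by (rule n)
    also have "norm (f ?y) \<le> (\<Sum>m<n. a m * norm (?f m))"
      unfolding functional_truncation[OF dual_ball_linear[OF f]]
      by (rule order_trans[OF norm_sum]) (simp add: norm_mult abs_a)
    finally have "ennreal (N a) \<le> ennreal (\<Sum>m<n. a m * norm (?f m)) + ennreal e"
      using e a by (simp add: ennreal_leI sum_nonneg add.commute flip: ennreal_plus)
    also have "\<dots> \<le> (\<Sum>m. ennreal (a m * norm (?f m))) + ennreal e"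
      using a by (intro add_right_mono sum_le_suminf_ennreal) simp
    finally show ?thesis .
  qed
  then have "ennreal (N a) \<le> (\<Sum>m. ennreal (a m * norm (?f m)))" by (rule ennreal_le_epsilon)
  then show thesis using that f by blast
qed

text \<open>For the unit basis the Besselian norm is the given norm.\<close>

lemma bess_norm_unit_basis:
  fixes x :: "nat \<Rightarrow> 'k::real_or_complex"
  assumes x: "x \<in> carrier (sequence_space C N scalars)"
  shows "bess_norm (sequence_space C N scalars) unit_basis x = ennreal (nrm (sequence_space C N scalars) x)"
proof (rule antisym)
  let ?a = "\<lambda>i. norm (x i)"
  have a: "?a \<in> C" "\<And>i. 0 \<le> ?a i" using x by auto
  show "bess_norm (sequence_space C N scalars) unit_basis x \<le> ennreal (nrm (sequence_space C N scalars) x)"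
    unfolding bess_norm_def using dual_ball_pairing[OF _ a, where ?'k = 'k]
    by (intro SUP_least) (simp add: norm_mult)
  obtain f :: "(nat \<Rightarrow> 'k) \<Rightarrow> 'k" where f: "f \<in> dual_ball (sequence_space C N scalars)"
    "ennreal (N ?a) \<le> (\<Sum>m. ennreal (?a m * norm (f (\<lambda>i. if i = m then 1 else 0))))"
    using norming_coefficients[OF a] .
  have "ennreal (nrm (sequence_space C N scalars) x)
      \<le> (\<Sum>m. ennreal (norm (snd (unit_basis m) x * f (fst (unit_basis m)))))"
    using f(2) by (simp add: norm_mult)
  also have "\<dots> \<le> bess_norm (sequence_space C N scalars) unit_basis x"
    unfolding bess_norm_def by (rule SUP_upper[OF f(1)])
  finally show "ennreal (nrm (sequence_space C N scalars) x)
      \<le> bess_norm (sequence_space C N scalars) unit_basis x" .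
qed

lemma bess_nrm_unit_basis:
  fixes x :: "nat \<Rightarrow> 'k::real_or_complex"
  assumes "x \<in> carrier (sequence_space C N scalars)"
  shows "nrm (bess_space (sequence_space C N scalars) unit_basis) x = nrm (sequence_space C N scalars) x"
proof -
  interpret S: normed_space "sequence_space C N (scalars :: ('k, 'k) nspace)"
    by (rule normed_sequence_space[OF normed_scalars])
  show ?thesis
    using bess_norm_unit_basis[OF assms] S.nrm_nonneg[OF assms] by simp
qed

lemma bessel_system_unit_basis:
  "bessel_system (sequence_space C N (scalars :: ('k::real_or_complex, 'k) nspace)) unit_basis"
proof -
  let ?S = "sequence_space C N (scalars :: ('k, 'k) nspace)"
  interpret S: normed_space ?S by (rule normed_sequence_space[OF normed_scalars])
  show ?thesis
  proof
    fix m and x :: "nat \<Rightarrow> 'k"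
    show "fst (unit_basis m) \<in> carrier ?S" using unit_closed by simp
    show "linear_map ?S scalars (snd (unit_basis m))" by (simp add: linear_map_def)
    assume x: "x \<in> carrier ?S"
    show "bess_norm ?S unit_basis x < top" "ennreal (nrm ?S x) \<le> bess_norm ?S unit_basis x"
      unfolding bess_norm_unit_basis[OF x] by auto
  qed
qed

lemma banach_bess_unit_basis:
  "banach_space (bess_space (sequence_space C N (scalars :: ('k::real_or_complex, 'k) nspace)) unit_basis)"
proof (rule banach_bess_space[OF _ bessel_system_unit_basis])
  show "banach_space (sequence_space C N (scalars :: ('k, 'k) nspace))"
    by (rule banach_sequence_space[OF banach_scalars])
  fix x :: "nat \<Rightarrow> 'k"
  assume x: "x \<in> carrier (sequence_space C N scalars)"
  show "bess_norm (sequence_space C N scalars) unit_basis x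
      \<le> ennreal (1 * nrm (sequence_space C N scalars) x)"
    unfolding bess_norm_unit_basis[OF x] by simp
qed

end


section \<open>Tensor products\<close>

lemma tensor_eq_carrier:
  assumes "normed_space X" "normed_space Y" "tensor_eq X Y s t"
  shows "set s \<subseteq> carrier X \<times> carrier Y \<and> set t \<subseteq> carrier X \<times> carrier Y"
proof -
  interpret X: normed_space X by fact
  interpret Y: normed_space Y by fact
  show ?thesis using assms(3) by induction (auto simp: X.closed Y.closed)
qed

text \<open>A product of linear functionals takes the same value on all representations of a tensor.\<close>

lemma tensor_eq_functional:
  assumes "normed_space X" "linear_map X scalars f" "linear_map Y scalars g" "tensor_eq X Y s t"
  shows "(\<Sum>(x, y)\<leftarrow>s. f x * g y) = (\<Sum>(x, y)\<leftarrow>t. f x * g y)"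
  using assms(4)
proof induction
  case (zero y)
  then show ?case using linear_map_zero[OF assms(1) normed_scalars assms(2)] by simp
qed (simp_all add: linear_map_scalarsD[OF assms(2)] linear_map_scalarsD[OF assms(3)] algebra_simps)

lemma tensor_eq_zero_right:
  assumes "normed_space X" "normed_space Y" "x \<in> carrier X"
  shows "tensor_eq X Y [(x, vzero Y)] []"
proof -
  interpret X: normed_space X by fact
  interpret Y: normed_space Y by fact
  have "tensor_eq X Y [(x, smul Y 0 (vzero Y))] [(smul X 0 x, vzero Y)]"
    by (intro tensor_eq.sym[OF tensor_eq.scale] assms Y.closed)
  then have "tensor_eq X Y [(x, vzero Y)] [(vzero X, vzero Y)]"
    using assms by (simp add: Y.smul_zero_right X.smul_zero_left)
  then show ?thesis by (rule tensor_eq.trans) (intro tensor_eq.zero Y.closed)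
qed

lemma tensor_class_mem: "t \<in> tensor_class X Y s \<longleftrightarrow> tensor_eq X Y s t"
  unfolding tensor_class_def by simp

lemma tensor_class_in_tensor: "set s \<subseteq> carrier X \<times> carrier Y \<Longrightarrow> tensor_class X Y s \<in> tensor X Y"
  unfolding tensor_def by auto

lemma tensor_class_self: "set s \<subseteq> carrier X \<times> carrier Y \<Longrightarrow> s \<in> tensor_class X Y s"
  unfolding tensor_class_mem by (rule tensor_eq.refl)

lemma rep_in_tensor: "u \<in> tensor X Y \<Longrightarrow> rep u \<in> u"
  unfolding tensor_def by (auto simp: lists_eq_set intro: rep_mem tensor_class_self)

lemma tensor_memD: "\<lbrakk>u \<in> tensor X Y; s \<in> u; t \<in> u\<rbrakk> \<Longrightarrow> tensor_eq X Y s t"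
  unfolding tensor_def by (auto simp: tensor_class_mem intro: tensor_eq.trans[OF tensor_eq.sym])

lemma tensor_mem_trans: "\<lbrakk>u \<in> tensor X Y; s \<in> u; tensor_eq X Y s t\<rbrakk> \<Longrightarrow> t \<in> u"
  unfolding tensor_def by (auto simp: tensor_class_mem intro: tensor_eq.trans)

lemma tensor_mem_carrier:
  assumes "normed_space X" "normed_space Y" "u \<in> tensor X Y" "s \<in> u"
  shows "set s \<subseteq> carrier X \<times> carrier Y"
  using tensor_eq_carrier[OF assms(1,2) tensor_memD[OF assms(3,4,4)]] by simp

lemma rep_tensor_class:
  "set s \<subseteq> carrier X \<times> carrier Y \<Longrightarrow> tensor_eq X Y s (rep (tensor_class X Y s))"
  using rep_mem[OF tensor_class_self, of s X Y] by (simp add: tensor_class_mem)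

text \<open>
  To identify the completion of a normed tensor product it suffices to give an additive
  and homogeneous map on representations that computes the norm and has dense range.
\<close>

lemma tensor_completion_isometric:
  assumes X: "normed_space X" and Y: "normed_space Y" and Z: "banach_space Z"
    and closed: "\<And>s. set s \<subseteq> carrier X \<times> carrier Y \<Longrightarrow> J s \<in> carrier Z"
    and cong: "\<And>s t. tensor_eq X Y s t \<Longrightarrow> J s = J t"
    and append: "\<And>s t. \<lbrakk>set s \<subseteq> carrier X \<times> carrier Y; set t \<subseteq> carrier X \<times> carrier Y\<rbrakk>
        \<Longrightarrow> J (s @ t) = vadd Z (J s) (J t)"
    and scale: "\<And>c s. set s \<subseteq> carrier X \<times> carrier Y
        \<Longrightarrow> J (map (\<lambda>(x, y). (smul X c x, y)) s) = smul Z c (J s)"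
    and norm: "\<And>u. u \<in> tensor X Y \<Longrightarrow> \<alpha> u = ennreal (nrm Z (J (rep u)))"
    and dense: "\<And>z e. \<lbrakk>z \<in> carrier Z; e > 0\<rbrakk>
        \<Longrightarrow> \<exists>s. set s \<subseteq> carrier X \<times> carrier Y \<and> vdist Z (J s) z < e"
  shows "isometrically_isomorphic (completion (tensor_space X Y \<alpha>)) Z"
proof -
  interpret X: normed_space X by fact
  interpret Z: banach_space Z by fact
  have rc: "set (rep u) \<subseteq> carrier X \<times> carrier Y" if "u \<in> tensor X Y" for u
    by (rule tensor_mem_carrier[OF X Y that rep_in_tensor[OF that]])
  have sc: "set (map (\<lambda>(x, y). (smul X c x, y)) s) \<subseteq> carrier X \<times> carrier Y"
    if "set s \<subseteq> carrier X \<times> carrier Y" for c s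
    using that X.smul_closed by fastforce
  have ac: "set (rep u @ rep v) \<subseteq> carrier X \<times> carrier Y" if "u \<in> tensor X Y" "v \<in> tensor X Y" for u v
    using rc that by simp
  have J_class: "J (rep (tensor_class X Y s)) = J s" if "set s \<subseteq> carrier X \<times> carrier Y" for s
    using cong[OF rep_tensor_class[OF that]] by simp
  show ?thesis
  proof (rule completion_isometric[where J = "\<lambda>u. J (rep u)", OF Z])
    fix x y c
    assume x: "x \<in> carrier (tensor_space X Y \<alpha>)"
    then have x': "x \<in> tensor X Y" by (simp add: tensor_space_def)
    show "smul (tensor_space X Y \<alpha>) c x \<in> carrier (tensor_space X Y \<alpha>)"
      using tensor_class_in_tensor[OF sc[OF rc[OF x']]] by (simp add: tensor_space_def)
    show "nrm Z (J (rep x)) = nrm (tensor_space X Y \<alpha>) x"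
      using x' norm[OF x'] Z.nrm_nonneg[OF closed[OF rc[OF x']]] by (simp add: tensor_space_def)
    assume "y \<in> carrier (tensor_space X Y \<alpha>)"
    then have y': "y \<in> tensor X Y" by (simp add: tensor_space_def)
    show "vadd (tensor_space X Y \<alpha>) x y \<in> carrier (tensor_space X Y \<alpha>)"
      using tensor_class_in_tensor[OF ac[OF x' y']] by (simp add: tensor_space_def)
  next
    show "linear_map (tensor_space X Y \<alpha>) Z (\<lambda>u. J (rep u))"
      unfolding linear_map_def
    proof (intro conjI ballI allI)
      fix x y c
      assume "x \<in> carrier (tensor_space X Y \<alpha>)"
      then have x: "x \<in> tensor X Y" by (simp add: tensor_space_def)
      show "J (rep x) \<in> carrier Z" by (rule closed[OF rc[OF x]])
      show "J (rep (smul (tensor_space X Y \<alpha>) c x)) = smul Z c (J (rep x))"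
        using J_class[OF sc[OF rc[OF x]], of c] scale[OF rc[OF x], of c] by (simp add: tensor_space_def)
      assume "y \<in> carrier (tensor_space X Y \<alpha>)"
      then have y: "y \<in> tensor X Y" by (simp add: tensor_space_def)
      show "J (rep (vadd (tensor_space X Y \<alpha>) x y)) = vadd Z (J (rep x)) (J (rep y))"
        using J_class[OF ac[OF x y]] append[OF rc[OF x] rc[OF y]] by (simp add: tensor_space_def)
    qed
  next
    fix z and e :: real
    assume "z \<in> carrier Z" "e > 0"
    then obtain s where s: "set s \<subseteq> carrier X \<times> carrier Y" "vdist Z (J s) z < e" using dense by blast
    then show "\<exists>x\<in>carrier (tensor_space X Y \<alpha>). vdist Z (J (rep x)) z < e"
      using J_class[OF s(1)] tensor_class_in_tensor[OF s(1)]
      by (intro bexI[of _ "tensor_class X Y s"]) (auto simp: tensor_space_def)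
  qed
qed


lemma tensor_space_cong:
  assumes "\<And>u. u \<in> tensor X Y \<Longrightarrow> \<alpha> u = \<beta> u"
  shows "tensor_space X Y \<alpha> = tensor_space X Y \<beta>"
proof -
  have "restrict (\<lambda>u. enn2real (\<alpha> u)) (tensor X Y) = restrict (\<lambda>u. enn2real (\<beta> u)) (tensor X Y)"
    by (rule restrict_ext) (simp add: assms)
  then show ?thesis unfolding tensor_space_def by simp
qed


section \<open>The Besselian sum of a representation\<close>

lemma bess_append: "bess X A Y B (s @ t) \<le> bess X A Y B s + bess X A Y B t"
  unfolding bess_def[of X A Y B "s @ t"]
proof (rule SUP_least, clarify)
  fix f g assume fg: "f \<in> dual_ball X" "g \<in> dual_ball Y"
  let ?h = "\<lambda>(f, g). \<lambda>(x, y). \<Sum>m. \<Sum>n.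
      ennreal (norm (snd (A m) x * snd (B n) y * f (fst (A m)) * g (fst (B n))))"
  have "sum_list (map (?h (f, g)) r) \<le> bess X A Y B r" for r
    unfolding bess_def using fg
    by (intro SUP_upper2[of "(f, g)"]) auto
  from add_mono[OF this[of s] this[of t]]
  show "(\<Sum>(x, y)\<leftarrow>s @ t. \<Sum>m. \<Sum>n.
      ennreal (norm (snd (A m) x * snd (B n) y * f (fst (A m)) * g (fst (B n)))))
    \<le> bess X A Y B s + bess X A Y B t" by simp
qed

text \<open>The double series of an elementary tensor is a product of two series.\<close>

lemma bess_product:
  fixes a b f g :: "nat \<Rightarrow> 'k::real_normed_field"
  shows "(\<Sum>m. \<Sum>n. ennreal (norm (a m * b n * f m * g n)))
    = (\<Sum>m. ennreal (norm (a m * f m))) * (\<Sum>n. ennreal (norm (b n * g n)))"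
proof -
  have "ennreal (norm (a m * b n * f m * g n)) = ennreal (norm (a m * f m)) * ennreal (norm (b n * g n))" for m n
    by (simp add: norm_mult mult_ac flip: ennreal_mult)
  then show ?thesis by (simp only: ennreal_suminf_cmult ennreal_suminf_multc)
qed

lemma bess_le_bess_norms: "bess X A Y B s \<le> (\<Sum>(x, y)\<leftarrow>s. bess_norm X A x * bess_norm Y B y)"
  unfolding bess_def
proof (rule SUP_least, clarify)
  fix f g assume fg: "f \<in> dual_ball X" "g \<in> dual_ball Y"
  show "(\<Sum>(x, y)\<leftarrow>s. \<Sum>m. \<Sum>n.
      ennreal (norm (snd (A m) x * snd (B n) y * f (fst (A m)) * g (fst (B n)))))
    \<le> (\<Sum>(x, y)\<leftarrow>s. bess_norm X A x * bess_norm Y B y)"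
    unfolding bess_product bess_norm_def
    using fg by (intro sum_list_mono) (auto intro!: mult_mono SUP_upper)
qed


section \<open>Coefficients of a tensor with a sequence space\<close>

text \<open>
  The sequence \<open>i \<mapsto> \<Sum>\<^sub>r x\<^sup>r(i) y\<^sup>r\<close> in the second factor attached to \<open>\<Sum>\<^sub>r x\<^sup>r \<otimes> y\<^sup>r\<close>.
\<close>

primrec coeff :: "('k::real_or_complex, 'b) nspace \<Rightarrow> ((nat \<Rightarrow> 'k) \<times> 'b) list \<Rightarrow> nat \<Rightarrow> 'b" where
  "coeff F [] = (\<lambda>i. vzero F)"
| "coeff F (p # s) = (\<lambda>i. vadd F (smul F (fst p i) (snd p)) (coeff F s i))"

text \<open>
  The first factor is the scalar sequence space \<open>S\<close> with its unit basis; \<open>target\<close> contains the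
  coefficient sequences of the tensors, with the Besselian norm on the second factor.
\<close>

locale sequence_tensor = sequence_norm C N + F: bessel_system F G
  for C N and F :: "('k::real_or_complex, 'b) nspace" and G
begin

abbreviation S :: "('k, nat \<Rightarrow> 'k) nspace" where
  "S \<equiv> sequence_space C N scalars"

abbreviation target :: "('k, nat \<Rightarrow> 'b) nspace" where
  "target \<equiv> sequence_space C N (bess_space F G)"

abbreviation unit :: "nat \<Rightarrow> nat \<Rightarrow> 'k" where
  "unit m \<equiv> (\<lambda>i. if i = m then 1 else 0)"

abbreviation tail :: "nat \<Rightarrow> (nat \<Rightarrow> 'k) \<Rightarrow> nat \<Rightarrow> 'k" where
  "tail n x \<equiv> (\<lambda>i. if i < n then 0 else x i)"

sublocale S: normed_space S
  by (rule normed_sequence_space[OF normed_scalars])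

sublocale FB: normed_space "bess_space F G"
  by (rule F.normed_bess_space)

sublocale target: normed_space target
  by (rule normed_sequence_space[OF F.normed_bess_space])

lemma coeff_closed: "set s \<subseteq> carrier S \<times> carrier F \<Longrightarrow> coeff F s i \<in> carrier F"
  by (induction s) (auto simp: F.closed)

lemma coeff_append:
  "\<lbrakk>set s \<subseteq> carrier S \<times> carrier F; set t \<subseteq> carrier S \<times> carrier F\<rbrakk>
    \<Longrightarrow> coeff F (s @ t) i = vadd F (coeff F s i) (coeff F t i)"
  by (induction s) (auto simp: F.closed coeff_closed F.zero_add F.add_assoc simp del: sequence_space_simps)

lemma coeff_scale:
  "set s \<subseteq> carrier S \<times> carrier F
    \<Longrightarrow> coeff F (map (\<lambda>(x, y). (smul S c x, y)) s) i = smul F c (coeff F s i)"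
  by (induction s) (auto simp: F.closed coeff_closed F.smul_zero_right F.smul_add_right F.smul_smul
        simp del: sequence_space_simps(1))

lemma coeff_cong:
  assumes "tensor_eq S F s t" shows "coeff F s = coeff F t"
proof
  fix i
  show "coeff F s i = coeff F t i"
    using assms
  proof induction
    case (append s s' t t')
    then show ?case
      using tensor_eq_carrier[OF S.normed_space_axioms F.normed_space_axioms append(1)]
        tensor_eq_carrier[OF S.normed_space_axioms F.normed_space_axioms append(2)]
      by (simp add: coeff_append del: sequence_space_simps)
  next
    case (commute s t)
    then show ?case
      using coeff_closed[OF commute(1), of i] coeff_closed[OF commute(2), of i]
      by (simp add: coeff_append F.add_commute del: sequence_space_simps)
  qed (simp_all add: F.closed F.add_zero F.smul_add_left F.smul_add_right F.smul_smul F.smul_zero_left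
      mult.commute)
qed

lemma elementary_mem:
  assumes x: "x \<in> carrier S" and y: "y \<in> carrier F"
  shows "(\<lambda>i. smul F (x i) y) \<in> carrier target"
    and "nrm target (\<lambda>i. smul F (x i) y) = nrm S x * nrm (bess_space F G) y"
proof -
  have eq: "(\<lambda>i. nrm (bess_space F G) (smul F (x i) y)) = (\<lambda>i. nrm (bess_space F G) y * norm (x i))"
    using FB.nrm_smul[of y] y by (auto simp: mult.commute)
  show "(\<lambda>i. smul F (x i) y) \<in> carrier target"
    using scale_mem[of "\<lambda>i. norm (x i)" "nrm (bess_space F G) y"] x y F.closed FB.nrm_nonneg[of y]
    by (simp add: eq del: bess_space_simps(5))
  show "nrm target (\<lambda>i. smul F (x i) y) = nrm S x * nrm (bess_space F G) y"
    using N_scale[of "\<lambda>i. norm (x i)" "nrm (bess_space F G) y"] x y FB.nrm_nonneg[of y]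
    by (simp add: eq del: bess_space_simps(5))
qed

lemma coeff_mem:
  "set s \<subseteq> carrier S \<times> carrier F \<Longrightarrow> coeff F s \<in> carrier target"
proof (induction s)
  case Nil
  then show ?case using target.zero_closed by simp
next
  case (Cons p s)
  then have "vadd target (\<lambda>i. smul F (fst p i) (snd p)) (coeff F s) \<in> carrier target"
    by (intro target.add_closed elementary_mem) auto
  then show ?case by simp
qed

lemma nrm_coeff_le:
  "set s \<subseteq> carrier S \<times> carrier F
    \<Longrightarrow> nrm target (coeff F s) \<le> (\<Sum>(x, y)\<leftarrow>s. nrm S x * nrm (bess_space F G) y)"
proof (induction s)
  case Nil
  then show ?case using target.nrm_zero by simp
next
  case (Cons p s)
  then have p: "fst p \<in> carrier S" "snd p \<in> carrier F" and s: "set s \<subseteq> carrier S \<times> carrier F" by auto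
  have "nrm target (coeff F (p # s))
      = nrm target (vadd target (\<lambda>i. smul F (fst p i) (snd p)) (coeff F s))" by simp
  also have "\<dots> \<le> nrm target (\<lambda>i. smul F (fst p i) (snd p)) + nrm target (coeff F s)"
    by (intro target.nrm_triangle elementary_mem coeff_mem p s)
  also have "\<dots> \<le> nrm S (fst p) * nrm (bess_space F G) (snd p)
      + (\<Sum>(x, y)\<leftarrow>s. nrm S x * nrm (bess_space F G) y)"
    using Cons.IH[OF s] unfolding elementary_mem(2)[OF p] by simp
  finally show ?case by (simp add: case_prod_unfold)
qed

lemma coeff_unit_list:
  assumes z: "\<And>i. z i \<in> carrier F"
  shows "coeff F (map (\<lambda>i. (unit i, z i)) [0..<n]) = (\<lambda>i. if i < n then z i else vzero F)"
proof (induction n)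
  case (Suc n)
  have "set (map (\<lambda>i. (unit i, z i)) [0..<n]) \<subseteq> carrier S \<times> carrier F"
    "set [(unit n, z n)] \<subseteq> carrier S \<times> carrier F"
    using z unit_closed by auto
  from coeff_append[OF this] show ?case
    using Suc z by (auto simp: fun_eq_iff F.closed F.smul_zero_left F.smul_one F.add_zero F.zero_add less_Suc_eq)
qed simp

lemma tail_closed: assumes "x \<in> carrier S" shows "tail n x \<in> carrier S"
proof -
  have "(\<lambda>i. norm (tail n x i)) \<in> C"
    by (rule mem_mono[of "\<lambda>i. norm (x i)"]) (use assms in auto)
  then show ?thesis by simp
qed

text \<open>
  Every tensor has representations whose first part is carried by finitely many unit vectors
  and whose remainder has the tails of the given first factors.
\<close>

lemma tensor_eq_expansion:
  assumes s: "set s \<subseteq> carrier S \<times> carrier F"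
  shows "tensor_eq S F s (map (\<lambda>i. (unit i, coeff F s i)) [0..<n] @ map (\<lambda>(x, y). (tail n x, y)) s)"
proof (induction n)
  case 0
  then show ?case using tensor_eq.refl[OF s] by simp
next
  case (Suc n)
  have tails: "set (map (\<lambda>(x, y). (tail m x, y)) t) \<subseteq> carrier S \<times> carrier F"
    if "set t \<subseteq> carrier S \<times> carrier F" for m t
    using that tail_closed by fastforce
  have split: "tensor_eq S F (map (\<lambda>(x, y). (tail n x, y)) t)
      ((unit n, coeff F t n) # map (\<lambda>(x, y). (tail (Suc n) x, y)) t)"
    if "set t \<subseteq> carrier S \<times> carrier F" for t
    using that
  proof (induction t)
    case Nil
    show ?case
      using tensor_eq.sym[OF tensor_eq_zero_right[OF S.normed_space_axioms F.normed_space_axioms unit_closed, of n]]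
      by simp
  next
    case (Cons p t)
    obtain x y where p: "p = (x, y)" by (cases p)
    have x: "x \<in> carrier S" and y: "y \<in> carrier F" and t: "set t \<subseteq> carrier S \<times> carrier F"
      using Cons.prems p by auto
    let ?r = "map (\<lambda>(x, y). (tail (Suc n) x, y)) t"
    note r = tails[OF t, of "Suc n"] and c = coeff_closed[OF t, of n] and u = unit_closed[of n]
    have xn: "smul S (x n) (unit n) \<in> carrier S" "smul F (x n) y \<in> carrier F"
      using S.smul_closed[OF u] F.smul_closed[OF y] by blast+
    note tx = tail_closed[OF x, of "Suc n"]
    have "tail n x = vadd S (smul S (x n) (unit n)) (tail (Suc n) x)"
      by (rule ext) (auto simp: less_Suc_eq)
    then have "tensor_eq S F [(tail n x, y)] [(smul S (x n) (unit n), y), (tail (Suc n) x, y)]"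
      using tensor_eq.add_left[OF xn(1) tx y] by simp
    from tensor_eq.trans[OF this tensor_eq.append[OF tensor_eq.scale[OF u y, of "x n"] tensor_eq.refl,
          of "[(tail (Suc n) x, y)]", simplified list.set append.simps]]
    have "tensor_eq S F [(tail n x, y)] [(unit n, smul F (x n) y), (tail (Suc n) x, y)]"
      using tx y by simp
    from tensor_eq.append[OF this Cons.IH[OF t]]
    have 1: "tensor_eq S F (map (\<lambda>(x, y). (tail n x, y)) (p # t))
        ([(unit n, smul F (x n) y)] @ ([(tail (Suc n) x, y)] @ [(unit n, coeff F t n)]) @ ?r)"
      by (simp add: p)
    have 2: "tensor_eq S F ([(tail (Suc n) x, y)] @ [(unit n, coeff F t n)])
        ([(unit n, coeff F t n)] @ [(tail (Suc n) x, y)])"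
      by (rule tensor_eq.commute) (use tx y c u in auto)
    have 3: "tensor_eq S F [(unit n, smul F (x n) y), (unit n, coeff F t n)]
        [(unit n, vadd F (smul F (x n) y) (coeff F t n))]"
      by (rule tensor_eq.sym[OF tensor_eq.add_right[OF u xn(2) c]])
    have refl1: "tensor_eq S F [(unit n, smul F (x n) y)] [(unit n, smul F (x n) y)]"
      by (rule tensor_eq.refl) (use xn(2) u in auto)
    have refl2: "tensor_eq S F [(tail (Suc n) x, y)] [(tail (Suc n) x, y)]"
      by (rule tensor_eq.refl) (use tx y in auto)
    have "tensor_eq S F ([(unit n, smul F (x n) y)] @ ([(tail (Suc n) x, y)] @ [(unit n, coeff F t n)]) @ ?r)
        ([(unit n, smul F (x n) y)] @ ([(unit n, coeff F t n)] @ [(tail (Suc n) x, y)]) @ ?r)"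
      by (intro tensor_eq.append refl1 2 tensor_eq.refl[OF r])
    note 4 = tensor_eq.trans[OF 1 this]
    have "tensor_eq S F ([(unit n, smul F (x n) y), (unit n, coeff F t n)] @ [(tail (Suc n) x, y)] @ ?r)
        ([(unit n, vadd F (smul F (x n) y) (coeff F t n))] @ [(tail (Suc n) x, y)] @ ?r)"
      by (intro tensor_eq.append 3 refl2 tensor_eq.refl[OF r])
    then show ?case using tensor_eq.trans[OF 4] by (simp add: p)
  qed
  let ?L = "map (\<lambda>i. (unit i, coeff F s i)) [0..<n]"
  have L: "set ?L \<subseteq> carrier S \<times> carrier F" using unit_closed coeff_closed[OF s] by auto
  have "tensor_eq S F (?L @ map (\<lambda>(x, y). (tail n x, y)) s)
      (?L @ ((unit n, coeff F s n) # map (\<lambda>(x, y). (tail (Suc n) x, y)) s))"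
    by (rule tensor_eq.append[OF tensor_eq.refl[OF L] split[OF s]])
  from tensor_eq.trans[OF Suc this] show ?case by simp
qed

lemma tail_tendsto:
  assumes "x \<in> carrier S" shows "(\<lambda>n. nrm S (tail n x)) \<longlonglongrightarrow> 0"
proof (rule LIMSEQ_I)
  fix e :: real assume e: "e > 0"
  have x: "(\<lambda>i. norm (x i)) \<in> C" using assms by simp
  obtain n where n: "N (\<lambda>i. if i < n then 0 else norm (x i)) \<le> e / 2"
    using tail_small[OF x, of "e / 2"] e by auto
  have "nrm S (tail m x) \<le> e / 2" if "n \<le> m" for m
  proof -
    have "nrm S (tail m x) \<le> N (\<lambda>i. if i < n then 0 else norm (x i))"
      unfolding sequence_space_simps
      by (rule N_mono) (use mem_mono[OF x, of "\<lambda>i. if i < n then 0 else norm (x i)"] that in auto)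
    then show ?thesis using n by linarith
  qed
  moreover have "0 \<le> nrm S (tail m x)" for m by (rule S.nrm_nonneg[OF tail_closed[OF assms]])
  ultimately have "\<forall>m\<ge>n. norm (nrm S (tail m x) - 0) < e"
    using e by (fastforce simp del: sequence_space_simps)
  then show "\<exists>n. \<forall>m\<ge>n. norm (nrm S (tail m x) - 0) < e" by blast
qed

lemma remainder_tendsto:
  assumes "set s \<subseteq> carrier S \<times> carrier F"
  shows "(\<lambda>n. \<Sum>(x, y)\<leftarrow>map (\<lambda>(x, y). (tail n x, y)) s. nrm S x * nrm (bess_space F G) y) \<longlonglongrightarrow> 0"
  using assms
proof (induction s)
  case (Cons p s)
  then have "(\<lambda>n. nrm S (tail n (fst p)) * nrm (bess_space F G) (snd p)) \<longlonglongrightarrow> 0"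
    by (intro tendsto_mult_left_zero tail_tendsto) auto
  from tendsto_add[OF this Cons.IH] Cons.prems show ?case
    by (simp add: case_prod_unfold del: sequence_space_simps)
qed simp

text \<open>
  Let \<open>\<Phi>\<close> be subadditive, dominated by the norm of the coefficients on finite combinations of unit
  vectors and by the projective sum on all representations. Then a lower bound of \<open>\<Phi>\<close> over the
  representations of a tensor is at most the norm of its coefficients.
\<close>

lemma le_nrm_coeff:
  fixes \<Phi> :: "((nat \<Rightarrow> 'k) \<times> 'b) list \<Rightarrow> ennreal"
  assumes s: "set s \<subseteq> carrier S \<times> carrier F"
    and M: "\<And>t. tensor_eq S F s t \<Longrightarrow> M \<le> \<Phi> t"
    and append: "\<And>s t. \<Phi> (s @ t) \<le> \<Phi> s + \<Phi> t"
    and unit_list: "\<And>z n. (\<And>i. z i \<in> carrier F) \<Longrightarrow>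
       \<Phi> (map (\<lambda>i. (unit i, z i)) [0..<n])
         \<le> ennreal (N (\<lambda>i. if i < n then nrm (bess_space F G) (z i) else 0))"
    and projective: "\<And>s. set s \<subseteq> carrier S \<times> carrier F \<Longrightarrow>
       \<Phi> s \<le> ennreal (\<Sum>(x, y)\<leftarrow>s. nrm S x * nrm (bess_space F G) y)"
  shows "M \<le> ennreal (nrm target (coeff F s))"
proof (rule ennreal_le_epsilon)
  fix e :: real assume e: "e > 0"
  let ?R = "\<lambda>n. map (\<lambda>(x, y). (tail n x, y)) s"
  obtain n where n: "(\<Sum>(x, y)\<leftarrow>?R n. nrm S x * nrm (bess_space F G) y) < e"
    using order_tendstoD(2)[OF remainder_tendsto[OF s] e] unfolding eventually_sequentially by blast
  have R: "set (?R n) \<subseteq> carrier S \<times> carrier F" using s tail_closed by fastforce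
  have nn: "0 \<le> nrm (bess_space F G) (coeff F s i)" for i
    using coeff_closed[OF s] by (intro FB.nrm_nonneg) simp
  have "M \<le> \<Phi> (map (\<lambda>i. (unit i, coeff F s i)) [0..<n] @ ?R n)"
    by (rule M[OF tensor_eq_expansion[OF s]])
  also have "\<dots> \<le> \<Phi> (map (\<lambda>i. (unit i, coeff F s i)) [0..<n]) + \<Phi> (?R n)" by (rule append)
  also have "\<dots> \<le> ennreal (N (\<lambda>i. if i < n then nrm (bess_space F G) (coeff F s i) else 0))
      + ennreal (\<Sum>(x, y)\<leftarrow>?R n. nrm S x * nrm (bess_space F G) y)"
    by (intro add_mono unit_list projective R coeff_closed s)
  also have "\<dots> \<le> ennreal (nrm target (coeff F s)) + ennreal e"
  proof (intro add_mono ennreal_leI less_imp_le[OF n])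
    show "N (\<lambda>i. if i < n then nrm (bess_space F G) (coeff F s i) else 0) \<le> nrm target (coeff F s)"
      unfolding sequence_space_simps by (rule N_mono) (use coeff_mem[OF s] nn in auto)
  qed
  finally show "M \<le> ennreal (nrm target (coeff F s)) + ennreal e" .
qed

lemma sum_list_bess_norms:
  "set s \<subseteq> carrier S \<times> carrier F \<Longrightarrow>
    (\<Sum>(x, y)\<leftarrow>s. bess_norm S unit_basis x * bess_norm F G y)
      = ennreal (\<Sum>(x, y)\<leftarrow>s. nrm S x * nrm (bess_space F G) y)"
proof (induction s)
  case (Cons p s)
  then have p: "fst p \<in> carrier S" "snd p \<in> carrier F" and s: "set s \<subseteq> carrier S \<times> carrier F" by auto
  have nn: "0 \<le> nrm S x" "0 \<le> nrm (bess_space F G) y" if "x \<in> carrier S" "y \<in> carrier F" for x y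
    using that S.nrm_nonneg FB.nrm_nonneg by auto
  have "0 \<le> (\<Sum>(x, y)\<leftarrow>s. nrm S x * nrm (bess_space F G) y)"
    by (rule sum_list_nonneg) (use s nn in \<open>auto simp del: sequence_space_simps bess_space_simps intro!: mult_nonneg_nonneg\<close>)
  moreover have "bess_norm S unit_basis (fst p) * bess_norm F G (snd p)
      = ennreal (nrm S (fst p) * nrm (bess_space F G) (snd p))"
    using bess_norm_unit_basis[OF p(1)] F.ennreal_bess_nrm[OF p(2)] nn[OF p]
    by (simp add: ennreal_mult del: sequence_space_simps)
  ultimately show ?case
    using Cons.IH[OF s] nn[OF p]
    by (simp add: case_prod_unfold ennreal_plus mult_nonneg_nonneg del: sequence_space_simps bess_space_simps)
qed simp

lemma bess_unit_list:
  assumes z: "\<And>i. z i \<in> carrier F"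
  shows "bess S unit_basis F G (map (\<lambda>i. (unit i, z i)) [0..<n])
    \<le> ennreal (N (\<lambda>i. if i < n then nrm (bess_space F G) (z i) else 0))"
  unfolding bess_def
proof (rule SUP_least, clarify)
  fix f g assume f: "f \<in> dual_ball S" and g: "g \<in> dual_ball F"
  let ?a = "\<lambda>i. if i < n then nrm (bess_space F G) (z i) else 0"
  have a: "?a \<in> C" "\<And>i. 0 \<le> ?a i"
    using FB.nrm_nonneg z by (auto intro!: finite_support_mem[of _ n] simp del: bess_space_simps(5))
  have "(\<Sum>m. ennreal (norm (snd (unit_basis m) (unit i) * f (fst (unit_basis m)))))
      = ennreal (norm (f (unit i)))" for i
  proof -
    have "(\<Sum>m. ennreal (norm (snd (unit_basis m) (unit i) * f (fst (unit_basis m)))))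
        = (\<Sum>m\<in>{i}. ennreal (norm (snd (unit_basis m) (unit i) * f (fst (unit_basis m)))))"
      by (rule suminf_finite) auto
    then show ?thesis by simp
  qed
  note head = this
  have inner: "(\<Sum>m. \<Sum>k. ennreal (norm (snd (unit_basis m) (unit i) * snd (G k) (z i)
        * f (fst (unit_basis m)) * g (fst (G k)))))
      \<le> ennreal (nrm (bess_space F G) (z i) * norm (f (unit i)))" for i
  proof -
    have "(\<Sum>k. ennreal (norm (snd (G k) (z i) * g (fst (G k))))) \<le> bess_norm F G (z i)"
      unfolding bess_norm_def by (rule SUP_upper[OF g])
    also have "\<dots> = ennreal (nrm (bess_space F G) (z i))" using F.ennreal_bess_nrm[OF z] by simp
    finally have "ennreal (norm (f (unit i))) * (\<Sum>k. ennreal (norm (snd (G k) (z i) * g (fst (G k)))))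
        \<le> ennreal (norm (f (unit i))) * ennreal (nrm (bess_space F G) (z i))"
      by (rule mult_left_mono) simp
    then show ?thesis
      unfolding bess_product head using FB.nrm_nonneg[of "z i"] z
      by (simp add: mult.commute[of "norm _"] mult.commute[of "ennreal (norm _)"] ennreal_mult del: bess_space_simps(5))
  qed
  have "(\<Sum>(x, y)\<leftarrow>map (\<lambda>i. (unit i, z i)) [0..<n]. \<Sum>m. \<Sum>k.
        ennreal (norm (snd (unit_basis m) x * snd (G k) y * f (fst (unit_basis m)) * g (fst (G k)))))
     = (\<Sum>i<n. \<Sum>m. \<Sum>k. ennreal (norm (snd (unit_basis m) (unit i) * snd (G k) (z i)
        * f (fst (unit_basis m)) * g (fst (G k)))))"
    by (simp add: o_def interv_sum_list_conv_sum_set_nat atLeast0LessThan del: unit_basis_simps)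
  also have "\<dots> \<le> (\<Sum>i<n. ennreal (?a i * norm (f (unit i))))"
    using inner by (intro sum_mono) (simp del: bess_space_simps unit_basis_simps)
  also have "\<dots> \<le> (\<Sum>m. ennreal (?a m * norm (f (unit m))))"
    by (rule sum_le_suminf) auto
  also have "\<dots> \<le> ennreal (N ?a)" by (rule dual_ball_pairing[OF f a])
  finally show "(\<Sum>(x, y)\<leftarrow>map (\<lambda>i. (unit i, z i)) [0..<n]. \<Sum>m. \<Sum>k.
        ennreal (norm (snd (unit_basis m) x * snd (G k) y * f (fst (unit_basis m)) * g (fst (G k)))))
     \<le> ennreal (N ?a)" .
qed

lemma crossnorm_le_nrm_coeff:
  assumes u: "u \<in> tensor S F" and s: "s \<in> u"
  shows "bess_crossnorm S unit_basis F G u \<le> ennreal (nrm target (coeff F s))"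
proof (rule le_nrm_coeff[where \<Phi> = "bess S unit_basis F G"])
  show "set s \<subseteq> carrier S \<times> carrier F"
    by (rule tensor_mem_carrier[OF S.normed_space_axioms F.normed_space_axioms u s])
  show "bess_crossnorm S unit_basis F G u \<le> bess S unit_basis F G t" if "tensor_eq S F s t" for t
    unfolding bess_crossnorm_def by (rule INF_lower[OF tensor_mem_trans[OF u s that]])
  show "bess S unit_basis F G t \<le> ennreal (\<Sum>(x, y)\<leftarrow>t. nrm S x * nrm (bess_space F G) y)"
    if "set t \<subseteq> carrier S \<times> carrier F" for t
    using bess_le_bess_norms[of S unit_basis F G t] unfolding sum_list_bess_norms[OF that] .
qed (rule bess_append, rule bess_unit_list)

text \<open>
  Every representation has a Besselian sum that dominates the pairings of the coefficients,
  because coefficientwise the triangle inequality only increases the summands.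
\<close>

lemma pairing_le_bess:
  assumes f: "f \<in> dual_ball S" and g: "g \<in> dual_ball F" and s: "set s \<subseteq> carrier S \<times> carrier F"
  shows "(\<Sum>m. ennreal (norm (f (unit m))) * (\<Sum>n. ennreal (norm (snd (G n) (coeff F s m) * g (fst (G n))))))
    \<le> bess S unit_basis F G s"
proof -
  let ?P = "\<lambda>y. \<Sum>n. ennreal (norm (snd (G n) y * g (fst (G n))))"
  have zero: "snd (G n) (vzero F) = 0" for n
    using linear_map_zero[OF F.normed_space_axioms normed_scalars F.coord_linear] by simp
  have P_add: "?P (vadd F y z) \<le> ?P y + ?P z" if "y \<in> carrier F" "z \<in> carrier F" for y z
  proof -
    have "?P (vadd F y z) \<le> (\<Sum>n. ennreal (norm (snd (G n) y * g (fst (G n))))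
        + ennreal (norm (snd (G n) z * g (fst (G n)))))"
      by (intro suminf_le summableI)
         (auto simp: linear_map_scalarsD(1)[OF F.coord_linear] that distrib_right norm_triangle_ineq
           simp flip: ennreal_plus intro!: ennreal_leI)
    also have "\<dots> = ?P y + ?P z" by (rule suminf_add[symmetric]) (rule summableI)+
    finally show ?thesis .
  qed
  have P_smul: "?P (smul F c y) = ennreal (norm c) * ?P y" if "y \<in> carrier F" for c y
    by (simp add: linear_map_scalarsD(2)[OF F.coord_linear that] norm_mult mult.assoc ennreal_mult)
  have "(\<Sum>m. ennreal (norm (f (unit m))) * ?P (coeff F s m))
     \<le> (\<Sum>(x, y)\<leftarrow>s. \<Sum>m. \<Sum>n. ennreal (norm (snd (unit_basis m) x * snd (G n) y
          * f (fst (unit_basis m)) * g (fst (G n)))))"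
    using s
  proof (induction s)
    case Nil
    have "?P (coeff F [] m) = 0" for m by (simp add: zero)
    then show ?case by (simp only: mult_zero_right suminf_zero list.map sum_list.Nil order_refl)
  next
    case (Cons p s)
    have y: "snd p \<in> carrier F" and s: "set s \<subseteq> carrier S \<times> carrier F"
      using Cons.prems by auto
    have "(\<Sum>m. ennreal (norm (f (unit m))) * ?P (coeff F (p # s) m))
      \<le> (\<Sum>m. ennreal (norm (fst p m * f (unit m))) * ?P (snd p)
          + ennreal (norm (f (unit m))) * ?P (coeff F s m))"
    proof (intro suminf_le summableI)
      fix m
      have "?P (coeff F (p # s) m) \<le> ennreal (norm (fst p m)) * ?P (snd p) + ?P (coeff F s m)"
        using P_add[OF F.smul_closed[OF y] coeff_closed[OF s], of "fst p m" m]
        by (simp add: P_smul[OF y])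
      from mult_left_mono[OF this, of "ennreal (norm (f (unit m)))"]
      show "ennreal (norm (f (unit m))) * ?P (coeff F (p # s) m)
        \<le> ennreal (norm (fst p m * f (unit m))) * ?P (snd p) + ennreal (norm (f (unit m))) * ?P (coeff F s m)"
        by (simp add: distrib_left norm_mult ennreal_mult mult_ac)
    qed
    also have "\<dots> = (\<Sum>m. ennreal (norm (fst p m * f (unit m))) * ?P (snd p))
        + (\<Sum>m. ennreal (norm (f (unit m))) * ?P (coeff F s m))"
      by (rule suminf_add[symmetric]) (rule summableI)+
    also have "\<dots> \<le> (\<Sum>(x, y)\<leftarrow>p # s. \<Sum>m. \<Sum>n. ennreal (norm (snd (unit_basis m) x * snd (G n) y
          * f (fst (unit_basis m)) * g (fst (G n)))))"
      using add_left_mono[OF Cons.IH[OF s]] by (simp add: case_prod_unfold bess_product)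
    finally show ?case .
  qed
  also have "\<dots> \<le> bess S unit_basis F G s"
    unfolding bess_def using f g by (intro SUP_upper2[of "(f, g)"]) auto
  finally show ?thesis .
qed

text \<open>
  Truncations approximate, and truncations are coefficients of finite combinations of unit vectors.
\<close>

lemma coeff_dense:
  assumes z: "z \<in> carrier target" and e: "e > 0"
  shows "\<exists>s. set s \<subseteq> carrier S \<times> carrier F \<and> vdist target (coeff F s) z < e"
proof -
  have zF: "z i \<in> carrier F" for i using z by simp
  have nn: "0 \<le> nrm (bess_space F G) (z i)" for i using zF by (intro FB.nrm_nonneg) simp
  have zC: "(\<lambda>i. nrm (bess_space F G) (z i)) \<in> C" using z by (simp del: bess_space_simps(5))
  obtain n where n: "N (\<lambda>i. if i < n then 0 else nrm (bess_space F G) (z i)) \<le> e / 2"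
    using tail_small[OF zC nn, of "e / 2"] e by auto
  let ?s = "map (\<lambda>i. (unit i, z i)) [0..<n]"
  have "vdist (bess_space F G) (coeff F ?s i) (z i) = (if i < n then 0 else nrm (bess_space F G) (z i))" for i
    unfolding coeff_unit_list[OF zF]
    using FB.vdist_refl[of "z i"] FB.vdist_sym[of "z i" "vzero F"] FB.vdist_zero_right[of "z i"] zF[of i] F.zero_closed
    by (simp del: bess_space_simps(5))
  then have "vdist target (coeff F ?s) z \<le> e / 2"
    unfolding vdist_sequence_space using n by simp
  moreover have "set ?s \<subseteq> carrier S \<times> carrier F" using zF unit_closed by auto
  ultimately show ?thesis using e by (intro exI[of _ ?s]) simp
qed

text \<open>
  The upper estimate of the crossnorm by the coefficients holds for all factors; whenever the
  lower one holds too, the completion is the space of coefficient sequences.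
\<close>

lemma completion_isometric_target:
  assumes F: "banach_space (bess_space F G)"
    and lower: "\<And>s. set s \<subseteq> carrier S \<times> carrier F
        \<Longrightarrow> ennreal (nrm target (coeff F s)) \<le> bess S unit_basis F G s"
  shows crossnorm_eq_nrm_coeff: "\<And>u s. \<lbrakk>u \<in> tensor S F; s \<in> u\<rbrakk>
        \<Longrightarrow> bess_crossnorm S unit_basis F G u = ennreal (nrm target (coeff F s))"
    and "isometrically_isomorphic (completion (tensor_space S F (bess_crossnorm S unit_basis F G))) target"
proof -
  show eq: "bess_crossnorm S unit_basis F G u = ennreal (nrm target (coeff F s))"
    if u: "u \<in> tensor S F" and s: "s \<in> u" for u s
  proof (rule antisym)
    show "ennreal (nrm target (coeff F s)) \<le> bess_crossnorm S unit_basis F G u"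
      unfolding bess_crossnorm_def
    proof (rule INF_greatest)
      fix t assume t: "t \<in> u"
      have "coeff F s = coeff F t" by (rule coeff_cong[OF tensor_memD[OF u s t]])
      then show "ennreal (nrm target (coeff F s)) \<le> bess S unit_basis F G t"
        using lower[OF tensor_mem_carrier[OF S.normed_space_axioms F.normed_space_axioms u t]] by simp
    qed
  qed (rule crossnorm_le_nrm_coeff[OF u s])
  show "isometrically_isomorphic (completion (tensor_space S F (bess_crossnorm S unit_basis F G))) target"
  proof (rule tensor_completion_isometric[where J = "coeff F"])
    show "banach_space target" by (rule banach_sequence_space[OF F])
    show "bess_crossnorm S unit_basis F G u = ennreal (nrm target (coeff F (rep u)))"
      if "u \<in> tensor S F" for u by (rule eq[OF that rep_in_tensor[OF that]])
    show "coeff F (s @ t) = vadd target (coeff F s) (coeff F t)"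
      if "set s \<subseteq> carrier S \<times> carrier F" "set t \<subseteq> carrier S \<times> carrier F" for s t
      using coeff_append[OF that] by (simp add: fun_eq_iff)
    show "coeff F (map (\<lambda>(x, y). (smul S c x, y)) s) = smul target c (coeff F s)"
      if "set s \<subseteq> carrier S \<times> carrier F" for c s
      using coeff_scale[OF that] by (simp add: fun_eq_iff del: sequence_space_simps(4)) simp
  qed (rule S.normed_space_axioms F.normed_space_axioms coeff_mem coeff_cong coeff_dense; assumption)+
qed

end


lemma (in sequence_norm) nrm_coeff_bess_space:
  fixes s :: "((nat \<Rightarrow> 'k::real_or_complex) \<times> (nat \<Rightarrow> 'k)) list"
  defines "S \<equiv> sequence_space C N (scalars :: ('k, 'k) nspace)"
  assumes s: "set s \<subseteq> carrier S \<times> carrier S"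
  shows "nrm (sequence_space C N (bess_space S unit_basis)) (coeff S s)
    = nrm (sequence_space C N S) (coeff S s)"
proof -
  interpret T: sequence_tensor C N S unit_basis
    unfolding S_def by (intro sequence_tensor.intro sequence_norm_axioms bessel_system_unit_basis)
  have "nrm (bess_space S unit_basis) (coeff S s i) = nrm S (coeff S s i)" for i
    unfolding S_def
    by (rule bess_nrm_unit_basis[OF T.coeff_closed[folded S_def, OF s, unfolded S_def]])
  then show ?thesis by (simp only: sequence_space_simps(5))
qed


section \<open>The tensor product of a null sequence space with a space having a basis\<close>

lemma isometrically_isomorphic_cong:
  assumes "isometrically_isomorphic X Y"
    and "carrier Z = carrier Y" "vadd Z = vadd Y" "smul Z = smul Y"
    and "\<And>y. y \<in> carrier Y \<Longrightarrow> nrm Z y = nrm Y y"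
  shows "isometrically_isomorphic X Z"
proof -
  obtain T where "linear_map X Y T" "bij_betw T (carrier X) (carrier Y)"
    "\<forall>x\<in>carrier X. nrm Y (T x) = nrm X x"
    using assms(1) unfolding isometrically_isomorphic_def by blast
  then show ?thesis
    using assms(2-) unfolding isometrically_isomorphic_def linear_map_def by (intro exI[of _ T]) auto
qed

lemma ennreal_SUP_le:
  fixes b :: "nat \<Rightarrow> real"
  assumes "\<And>i. 0 \<le> b i" "\<And>i. ennreal (b i) \<le> M" shows "ennreal (SUP i. b i) \<le> M"
proof (cases M)
  case (real r)
  then have "b i \<le> r" for i using assms(2)[of i] by simp
  then show ?thesis using real by (auto intro!: ennreal_leI cSUP_least)
qed simp

text \<open>A coordinate functional in the first factor isolates a single coefficient.\<close>

lemma c0_lower: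
  fixes F :: "('k::real_or_complex, 'b) nspace"
  assumes F: "bessel_system F G" and s: "set s \<subseteq> carrier c0 \<times> carrier F"
  shows "ennreal (nrm (c0_space (bess_space F G)) (coeff F s)) \<le> bess c0 unit_basis F G s"
proof -
  interpret sequence_tensor "{a. a \<longlonglongrightarrow> 0}" "\<lambda>a. SUP i. a i" F G
    by (intro sequence_tensor.intro sequence_norm_c0 F)
  note s' = s[unfolded c0_space_eq[of "scalars :: ('k, 'k) nspace"]]
  have "bess_norm F G (coeff F s i) \<le> bess S unit_basis F G s" for i
    unfolding bess_norm_def
  proof (rule SUP_least)
    fix g assume g: "g \<in> dual_ball F"
    let ?P = "\<lambda>m. \<Sum>n. ennreal (norm (snd (G n) (coeff F s m) * g (fst (G n))))"
    have "?P i = (\<Sum>m\<in>{i}. ennreal (norm (unit m i)) * ?P m)" by simp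
    also have "\<dots> \<le> (\<Sum>m. ennreal (norm (unit m i)) * ?P m)" by (rule sum_le_suminf) auto
    also have "\<dots> \<le> bess S unit_basis F G s" by (rule pairing_le_bess[OF coordinate_in_dual_ball g s'])
    finally show "?P i \<le> bess S unit_basis F G s" .
  qed
  then have "ennreal (nrm (bess_space F G) (coeff F s i)) \<le> bess S unit_basis F G s" for i
    using F.ennreal_bess_nrm[OF coeff_closed[OF s', of i]] by simp
  then have "ennreal (SUP i. nrm (bess_space F G) (coeff F s i)) \<le> bess S unit_basis F G s"
    using coeff_closed[OF s'] FB.nrm_nonneg by (intro ennreal_SUP_le) auto
  then show ?thesis by (simp add: c0_space_eq)
qed

lemma
  fixes F :: "('k::real_or_complex, 'b) nspace"
  assumes F: "bessel_system F G" and B: "banach_space (bess_space F G)"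
  shows crossnorm_c0: "\<And>u s. \<lbrakk>u \<in> tensor c0 F; s \<in> u\<rbrakk> \<Longrightarrow>
      bess_crossnorm c0 unit_basis F G u = ennreal (nrm (c0_space (bess_space F G)) (coeff F s))"
    and completion_c0: "isometrically_isomorphic
      (completion (tensor_space c0 F (bess_crossnorm c0 unit_basis F G))) (c0_space (bess_space F G))"
proof -
  interpret sequence_tensor "{a. a \<longlonglongrightarrow> 0}" "\<lambda>a. SUP i. a i" F G
    by (intro sequence_tensor.intro sequence_norm_c0 F)
  note lower = c0_lower[OF F, unfolded c0_space_eq]
  show "bess_crossnorm c0 unit_basis F G u = ennreal (nrm (c0_space (bess_space F G)) (coeff F s))"
    if "u \<in> tensor c0 F" "s \<in> u" for u s
    using completion_isometric_target(1)[OF B lower, of u s] that unfolding c0_space_eq by blast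
  show "isometrically_isomorphic
      (completion (tensor_space c0 F (bess_crossnorm c0 unit_basis F G))) (c0_space (bess_space F G))"
    using completion_isometric_target(2)[OF B lower] unfolding c0_space_eq by blast
qed

text \<open>Equivalence of the norms of \<open>F\<close> passes to sequences.\<close>

lemma linearly_homeomorphic_c0:
  fixes F :: "('k::real_or_complex, 'b) nspace"
  assumes F: "banach_space F" and G: "USB F G"
    and iso: "isometrically_isomorphic X (c0_space (bess_space F G))"
  shows "linearly_homeomorphic X (c0_space F)"
proof -
  interpret sequence_norm "{a. a \<longlonglongrightarrow> 0}" "\<lambda>a. SUP i. a i" by (rule sequence_norm_c0)
  interpret bessel_system F G by (rule USB_bessel_system[OF F G])
  interpret FB: normed_space "bess_space F G" by (rule normed_bess_space)
  obtain K where K: "K > 0" and le: "\<And>x. x \<in> carrier F \<Longrightarrow> bess_norm F G x \<le> ennreal (K * nrm F x)"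
    using USB_bess_norm_le[OF F G] by blast
  have le': "nrm (bess_space F G) x \<le> K * nrm F x" if "x \<in> carrier F" for x
    using enn2real_leI[OF _ le[OF that]] K nrm_nonneg[OF that] by simp
  have nn: "0 \<le> nrm (bess_space F G) x" if "x \<in> carrier F" for x using FB.nrm_nonneg that by simp
  let ?a = "\<lambda>x i. nrm F (x i)" and ?b = "\<lambda>x i. nrm (bess_space F G) (x i)"
  have mem: "?a x \<in> {a. a \<longlonglongrightarrow> 0} \<longleftrightarrow> ?b x \<in> {a. a \<longlonglongrightarrow> 0}" if x: "\<forall>i. x i \<in> carrier F" for x :: "nat \<Rightarrow> 'b"
  proof
    assume "?a x \<in> {a. a \<longlonglongrightarrow> 0}"
    then have "(\<lambda>i. K * ?a x i) \<in> {a. a \<longlonglongrightarrow> 0}"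
      by (rule scale_mem) (use x K nrm_nonneg in auto)
    then show "?b x \<in> {a. a \<longlonglongrightarrow> 0}"
      by (rule mem_mono) (use x nn le' in \<open>blast+\<close>)
  next
    assume "?b x \<in> {a. a \<longlonglongrightarrow> 0}"
    then show "?a x \<in> {a. a \<longlonglongrightarrow> 0}"
      by (rule mem_mono) (use x nrm_nonneg nrm_le_bess_nrm in \<open>blast+\<close>)
  qed
  have carr: "carrier (c0_space (bess_space F G)) = carrier (c0_space F)"
    unfolding c0_space_eq using mem by (auto simp del: bess_space_simps(5) mem_Collect_eq)
  have upper: "nrm (c0_space F) x \<le> nrm (c0_space (bess_space F G)) x"
    and lower: "nrm (c0_space (bess_space F G)) x \<le> K * nrm (c0_space F) x"
    if "x \<in> carrier (c0_space (bess_space F G))" for x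
  proof -
    have x: "\<And>i. x i \<in> carrier F" and b: "?b x \<in> {a. a \<longlonglongrightarrow> 0}"
      using that unfolding c0_space_eq by (auto simp del: bess_space_simps(5))
    have a: "?a x \<in> {a. a \<longlonglongrightarrow> 0}" using mem x b by blast
    show "nrm (c0_space F) x \<le> nrm (c0_space (bess_space F G)) x"
      unfolding c0_space_eq sequence_space_simps
      by (rule N_mono[OF b]) (use x nrm_nonneg nrm_le_bess_nrm in \<open>blast+\<close>)
    have Ka: "(\<lambda>i. K * ?a x i) \<in> {a. a \<longlonglongrightarrow> 0}"
      by (rule scale_mem[OF a]) (use x K nrm_nonneg in auto)
    have "nrm (c0_space (bess_space F G)) x \<le> (SUP i. K * ?a x i)"
      unfolding c0_space_eq sequence_space_simps
      by (rule N_mono[OF Ka]) (use x nn le' in \<open>blast+\<close>)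
    also have "\<dots> = K * nrm (c0_space F) x"
      unfolding c0_space_eq sequence_space_simps
      by (rule N_scale[OF a]) (use x nrm_nonneg K in auto)
    finally show "nrm (c0_space (bess_space F G)) x \<le> K * nrm (c0_space F) x" .
  qed
  obtain T where T: "linear_map X (c0_space (bess_space F G)) T"
    "bij_betw T (carrier X) (carrier (c0_space (bess_space F G)))"
    "\<And>x. x \<in> carrier X \<Longrightarrow> nrm (c0_space (bess_space F G)) (T x) = nrm X x"
    using iso unfolding isometrically_isomorphic_def by blast
  have TX: "T x \<in> carrier (c0_space (bess_space F G))" if "x \<in> carrier X" for x
    using T(1) that unfolding linear_map_def by blast
  have "vadd (c0_space (bess_space F G)) = vadd (c0_space F)" "smul (c0_space (bess_space F G)) = smul (c0_space F)"
    unfolding c0_space_def by simp_all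
  then have "linear_map X (c0_space F) T" using T(1) carr unfolding linear_map_def by simp
  moreover have "bij_betw T (carrier X) (carrier (c0_space F))" using T(2) carr by simp
  moreover have "1 / K * nrm X x \<le> nrm (c0_space F) (T x) \<and> nrm (c0_space F) (T x) \<le> 1 * nrm X x"
    if "x \<in> carrier X" for x
    using upper[OF TX[OF that]] lower[OF TX[OF that]] T(3)[OF that] K by (simp add: field_simps)
  moreover have "1 / K > 0" "(1 :: real) > 0" using K by auto
  ultimately show ?thesis unfolding linearly_homeomorphic_def by blast
qed


section \<open>The tensor product of a p-summable sequence space with absolutely summable sequences\<close>


lemma ell_1_summable:
  "x \<in> carrier (ell 1 :: ('k::real_or_complex, nat \<Rightarrow> 'k) nspace) \<longleftrightarrow> summable (\<lambda>i. norm (x i))"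
  unfolding lp_space_def by simp

lemma ell_1_nrm:
  assumes "x \<in> carrier (ell 1 :: ('k::real_or_complex, nat \<Rightarrow> 'k) nspace)"
  shows "nrm (ell 1) x = (\<Sum>i. norm (x i))"
  using assms suminf_nonneg[of "\<lambda>i. norm (x i)"] unfolding ell_1_summable by (simp add: lp_space_def)

text \<open>
  Summation is bounded by the norm of \<open>\<ell>\<^sub>1\<close>. Its value at every unit vector is \<open>1\<close>, so it norms all
  nonnegative sequences simultaneously.
\<close>

lemma suminf_in_dual_ball: "(\<lambda>x. \<Sum>i. x i) \<in> dual_ball (ell 1 :: ('k::real_or_complex, nat \<Rightarrow> 'k) nspace)"
proof -
  let ?S = "ell 1 :: ('k, nat \<Rightarrow> 'k) nspace"
  interpret N: sequence_norm "{a. summable (\<lambda>i. a i powr 1)}" "\<lambda>a. (\<Sum>i. a i powr 1) powr (1 / 1)"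
    by (rule sequence_norm_lp) simp
  interpret S: normed_space ?S
    unfolding lp_space_eq by (rule N.normed_sequence_space[OF normed_scalars])
  show ?thesis
  proof (rule S.dual_ballI)
    show "linear_map ?S scalars (\<lambda>x. \<Sum>i. x i)"
      unfolding linear_map_def
      by (auto simp: ell_1_summable lp_space_def suminf_add[symmetric] suminf_mult
          dest!: summable_norm_cancel)
    show "norm (\<Sum>i. x i) \<le> nrm ?S x" if "x \<in> carrier ?S" for x
      unfolding ell_1_nrm[OF that] using that unfolding ell_1_summable by (rule summable_norm)
  qed
qed

lemma bessel_system_ell:
  "1 \<le> p \<Longrightarrow> bessel_system (ell p :: ('k::real_or_complex, nat \<Rightarrow> 'k) nspace) unit_basis"
  unfolding lp_space_eq by (rule sequence_norm.bessel_system_unit_basis[OF sequence_norm_lp])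

lemma banach_bess_ell:
  "1 \<le> p \<Longrightarrow> banach_space (bess_space (ell p :: ('k::real_or_complex, nat \<Rightarrow> 'k) nspace) unit_basis)"
  unfolding lp_space_eq by (rule sequence_norm.banach_bess_unit_basis[OF sequence_norm_lp])

lemma bess_nrm_ell:
  assumes "1 \<le> p" "x \<in> carrier (ell p :: ('k::real_or_complex, nat \<Rightarrow> 'k) nspace)"
  shows "nrm (bess_space (ell p) unit_basis) x = nrm (ell p) x"
proof -
  interpret N: sequence_norm "{a. summable (\<lambda>i. a i powr p)}" "\<lambda>a. (\<Sum>i. a i powr p) powr (1 / p)"
    by (rule sequence_norm_lp[OF assms(1)])
  show ?thesis
    using N.bess_norm_unit_basis[of x] assms(2) unfolding lp_space_eq by simp
qed

text \<open>
  Pairing with summation in the second factor gives the norms of the coefficients, and the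
  functional in the first factor is chosen to norm the sequence of these norms.
\<close>

lemma ell_lower:
  assumes p: "1 \<le> p" and s: "set s \<subseteq> carrier (ell p) \<times> carrier (ell 1 :: ('k::real_or_complex, nat \<Rightarrow> 'k) nspace)"
  shows "ennreal (nrm (lp_space p (bess_space (ell 1) unit_basis)) (coeff (ell 1) s))
    \<le> bess (ell p) unit_basis (ell 1) unit_basis s"
proof -
  let ?F = "ell 1 :: ('k, nat \<Rightarrow> 'k) nspace"
  interpret sequence_tensor "{a. summable (\<lambda>i. a i powr p)}" "\<lambda>a. (\<Sum>i. a i powr p) powr (1 / p)" ?F unit_basis
    by (intro sequence_tensor.intro sequence_norm_lp p bessel_system_ell) simp
  have s': "set s \<subseteq> carrier S \<times> carrier ?F" using s unfolding lp_space_eq .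
  let ?a = "\<lambda>m. nrm (bess_space ?F unit_basis) (coeff ?F s m)"
  have a: "?a \<in> {a. summable (\<lambda>i. a i powr p)}" "0 \<le> ?a i" for i
    using coeff_mem[OF s'] FB.nrm_nonneg[of "coeff ?F s i"] coeff_closed[OF s']
    by (auto simp del: bess_space_simps(5))
  obtain f where f: "f \<in> dual_ball S"
    and le: "ennreal ((\<Sum>i. ?a i powr p) powr (1 / p)) \<le> (\<Sum>m. ennreal (?a m * norm (f (unit m))))"
    using norming_coefficients[OF a] by blast
  let ?g = "\<lambda>x :: nat \<Rightarrow> 'k. \<Sum>i. x i"
  have g1: "?g (unit n) = 1" for n
    using suminf_finite[of "{n}" "unit n"] by simp
  have "ennreal (?a m * norm (f (unit m)))
      = ennreal (norm (f (unit m))) * (\<Sum>n. ennreal (norm (snd (unit_basis n) (coeff ?F s m) * ?g (fst (unit_basis n)))))" for m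
  proof -
    have c: "coeff ?F s m \<in> carrier ?F" by (rule coeff_closed[OF s'])
    have "?a m = (\<Sum>n. norm (coeff ?F s m n))"
      unfolding bess_nrm_ell[OF order_refl c] ell_1_nrm[OF c] ..
    moreover have "(\<Sum>n. ennreal (norm (snd (unit_basis n) (coeff ?F s m) * ?g (fst (unit_basis n)))))
        = ennreal (\<Sum>n. norm (coeff ?F s m n))"
      using c unfolding ell_1_summable unit_basis_simps g1 by (simp add: suminf_ennreal2)
    ultimately show ?thesis using a(2)[of m] by (simp add: ennreal_mult mult.commute)
  qed
  then have "(\<Sum>m. ennreal (?a m * norm (f (unit m)))) \<le> bess S unit_basis ?F unit_basis s"
    using pairing_le_bess[OF f suminf_in_dual_ball s'] by simp
  then show ?thesis using le order_trans unfolding lp_space_eq sequence_space_simps by blast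
qed

lemma
  assumes p: "1 \<le> p"
  shows crossnorm_ell: "\<And>u s. \<lbrakk>u \<in> tensor (ell p) (ell 1 :: ('k::real_or_complex, nat \<Rightarrow> 'k) nspace); s \<in> u\<rbrakk> \<Longrightarrow>
      bess_crossnorm (ell p) unit_basis (ell 1) unit_basis u
        = ennreal (nrm (lp_space p (bess_space (ell 1) unit_basis)) (coeff (ell 1) s))"
    and completion_ell: "isometrically_isomorphic
      (completion (tensor_space (ell p) (ell 1 :: ('k, nat \<Rightarrow> 'k) nspace)
        (bess_crossnorm (ell p) unit_basis (ell 1) unit_basis)))
      (lp_space p (ell 1 :: ('k, nat \<Rightarrow> 'k) nspace))"
proof -
  let ?F = "ell 1 :: ('k, nat \<Rightarrow> 'k) nspace"
  interpret sequence_tensor "{a. summable (\<lambda>i. a i powr p)}" "\<lambda>a. (\<Sum>i. a i powr p) powr (1 / p)" ?F unit_basis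
    by (intro sequence_tensor.intro sequence_norm_lp p bessel_system_ell) simp
  have lower: "ennreal (nrm target (coeff ?F s)) \<le> bess S unit_basis ?F unit_basis s"
    if "set s \<subseteq> carrier S \<times> carrier ?F" for s
    using ell_lower[OF p, of s] that unfolding lp_space_eq[of p] by blast
  have B: "banach_space (bess_space ?F unit_basis)" by (rule banach_bess_ell) simp
  show "bess_crossnorm (ell p) unit_basis (ell 1) unit_basis u
      = ennreal (nrm (lp_space p (bess_space (ell 1) unit_basis)) (coeff (ell 1) s))"
    if "u \<in> tensor (ell p) ?F" "s \<in> u" for u s
    using completion_isometric_target(1)[OF B lower, of u s] that unfolding lp_space_eq[of p] by blast
  have "isometrically_isomorphic (completion (tensor_space S ?F (bess_crossnorm S unit_basis ?F unit_basis))) target"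
    using completion_isometric_target(2)[OF B lower] by blast
  then show "isometrically_isomorphic
      (completion (tensor_space (ell p) ?F (bess_crossnorm (ell p) unit_basis (ell 1) unit_basis)))
      (lp_space p ?F)"
    unfolding lp_space_eq[of p]
  proof (rule isometrically_isomorphic_cong)
    have eq: "nrm (bess_space ?F unit_basis) x = nrm ?F x" if "x \<in> carrier ?F" for x
      by (rule bess_nrm_ell[OF order_refl that])
    have eq': "(\<lambda>i. nrm ?F (x i)) = (\<lambda>i. nrm (bess_space ?F unit_basis) (x i))"
      if "\<forall>i. x i \<in> carrier ?F" for x
      using eq that by (auto simp del: bess_space_simps(5))
    show "carrier (sequence_space {a. summable (\<lambda>i. a i powr p)} (\<lambda>a. (\<Sum>i. a i powr p) powr (1 / p)) ?F)
        = carrier target"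
      unfolding sequence_space_simps bess_space_simps(1)
      by (rule Collect_cong, rule conj_cong) (simp, subst eq', assumption, rule HOL.refl)
    fix y assume "y \<in> carrier target"
    then have "\<forall>i. y i \<in> carrier ?F" by simp
    then have "nrm ?F (y i) = nrm (bess_space ?F unit_basis) (y i)" for i by (intro eq[symmetric]) simp
    then show "nrm (sequence_space {a. summable (\<lambda>i. a i powr p)} (\<lambda>a. (\<Sum>i. a i powr p) powr (1 / p)) ?F) y
        = nrm target y"
      by (simp only: sequence_space_simps(5))
  qed (simp_all add: fun_eq_iff)
qed


section \<open>Injective and projective norms\<close>

lemma dual_ball_cong:
  assumes "carrier Z = carrier X" "vadd Z = vadd X" "smul Z = smul X"
    and nrm: "\<And>x. x \<in> carrier X \<Longrightarrow> nrm Z x = nrm X x"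
  shows "dual_ball Z = dual_ball X"
proof -
  have "{x \<in> carrier X. nrm Z x \<le> 1} = {x \<in> carrier X. nrm X x \<le> 1}" using nrm by auto
  then have "dual_norm Z f = dual_norm X f" for f
    unfolding dual_norm_def by (simp add: assms(1))
  moreover have "dual Z = dual X"
    unfolding dual_def linear_map_def using assms by auto
  ultimately show ?thesis unfolding dual_ball_def by simp
qed

lemma injective_norm_bess_space:
  assumes "\<And>x. x \<in> carrier X \<Longrightarrow> nrm (bess_space X A) x = nrm X x"
    and "\<And>y. y \<in> carrier Y \<Longrightarrow> nrm (bess_space Y B) y = nrm Y y"
  shows "injective_norm (bess_space X A) (bess_space Y B) = injective_norm X Y"
proof -
  have "dual_ball (bess_space X A) = dual_ball X"
    by (rule dual_ball_cong) (use assms(1) in auto)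
  moreover have "dual_ball (bess_space Y B) = dual_ball Y"
    by (rule dual_ball_cong) (use assms(2) in auto)
  ultimately show ?thesis unfolding injective_norm_def by simp
qed

lemma projective_norm_bess_space:
  assumes X: "normed_space X" and Y: "normed_space Y"
    and nrm: "\<And>x. x \<in> carrier X \<Longrightarrow> nrm (bess_space X A) x = nrm X x"
      "\<And>y. y \<in> carrier Y \<Longrightarrow> nrm (bess_space Y B) y = nrm Y y"
    and u: "u \<in> tensor X Y"
  shows "projective_norm (bess_space X A) (bess_space Y B) u = projective_norm X Y u"
  unfolding projective_norm_def
proof (rule INF_cong[OF HOL.refl], rule arg_cong[where f = sum_list], rule map_cong[OF HOL.refl])
  fix s p assume "s \<in> u" "p \<in> set s"
  then have "p \<in> carrier X \<times> carrier Y" using tensor_mem_carrier[OF X Y u] by blast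
  then show "(case p of (x, y) \<Rightarrow> ennreal (nrm (bess_space X A) x * nrm (bess_space Y B) y))
      = (case p of (x, y) \<Rightarrow> ennreal (nrm X x * nrm Y y))"
    using nrm by (auto simp del: bess_space_simps(5))
qed

text \<open>The injective norm may be computed from any representation.\<close>

lemma injective_norm_eq:
  assumes X: "normed_space X" and u: "u \<in> tensor X Y" and s: "s \<in> u"
  shows "injective_norm X Y u =
    (SUP (f, g)\<in>dual_ball X \<times> dual_ball Y. ennreal (norm (\<Sum>(x, y)\<leftarrow>s. f x * g y)))"
  unfolding injective_norm_def
proof (rule SUP_cong[OF HOL.refl], clarify)
  fix f g assume "f \<in> dual_ball X" "g \<in> dual_ball Y"
  then show "ennreal (norm (\<Sum>(x, y)\<leftarrow>rep u. f x * g y)) = ennreal (norm (\<Sum>(x, y)\<leftarrow>s. f x * g y))"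
    using tensor_eq_functional[OF X dual_ball_linear dual_ball_linear tensor_memD[OF u rep_in_tensor[OF u] s]]
    by metis
qed

lemma (in sequence_tensor) sum_list_ennreal_nrm:
  "set s \<subseteq> carrier S \<times> carrier F \<Longrightarrow>
    (\<Sum>(x, y)\<leftarrow>s. ennreal (nrm S x * nrm (bess_space F G) y))
      = ennreal (\<Sum>(x, y)\<leftarrow>s. nrm S x * nrm (bess_space F G) y)
    \<and> 0 \<le> (\<Sum>(x, y)\<leftarrow>s. nrm S x * nrm (bess_space F G) y)"
proof (induction s)
  case (Cons p s)
  then have p: "fst p \<in> carrier S" "snd p \<in> carrier F" and s: "set s \<subseteq> carrier S \<times> carrier F" by auto
  have "0 \<le> nrm S (fst p) * nrm (bess_space F G) (snd p)"
    using S.nrm_nonneg[OF p(1)] FB.nrm_nonneg[of "snd p"] p(2) by (intro mult_nonneg_nonneg) auto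
  then show ?case
    using Cons.IH[OF s]
    by (simp add: case_prod_unfold ennreal_plus del: sequence_space_simps bess_space_simps)
qed simp

lemma (in sequence_tensor) injective_norm_le_nrm_coeff:
  assumes u: "u \<in> tensor S F" and s: "s \<in> u"
  shows "injective_norm S F u \<le> ennreal (nrm target (coeff F s))"
proof (rule le_nrm_coeff[where \<Phi> = "\<lambda>t. SUP (f, g)\<in>dual_ball S \<times> dual_ball F.
      ennreal (norm (\<Sum>(x, y)\<leftarrow>t. f x * g y))"])
  show "set s \<subseteq> carrier S \<times> carrier F"
    by (rule tensor_mem_carrier[OF S.normed_space_axioms F.normed_space_axioms u s])
  show "injective_norm S F u \<le> (SUP (f, g)\<in>dual_ball S \<times> dual_ball F.
      ennreal (norm (\<Sum>(x, y)\<leftarrow>t. f x * g y)))" if "tensor_eq S F s t" for t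
    using injective_norm_eq[OF S.normed_space_axioms u tensor_mem_trans[OF u s that]] by simp
next
  fix s t
  let ?I = "\<lambda>t. SUP (f, g)\<in>dual_ball S \<times> dual_ball F. ennreal (norm (\<Sum>(x, y)\<leftarrow>t. f x * g y))"
  show "?I (s @ t) \<le> ?I s + ?I t"
  proof (rule SUP_least, clarify)
    fix f g assume fg: "f \<in> dual_ball S" "g \<in> dual_ball F"
    have le: "ennreal (norm (\<Sum>(x, y)\<leftarrow>t. f x * g y)) \<le> ?I t" for t
      using fg by (intro SUP_upper2[of "(f, g)"]) auto
    have "ennreal (norm (\<Sum>(x, y)\<leftarrow>s @ t. f x * g y))
      \<le> ennreal (norm (\<Sum>(x, y)\<leftarrow>s. f x * g y)) + ennreal (norm (\<Sum>(x, y)\<leftarrow>t. f x * g y))"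
      by (simp add: ennreal_leI norm_triangle_ineq flip: ennreal_plus)
    also have "\<dots> \<le> ?I s + ?I t" by (intro add_mono le)
    finally show "ennreal (norm (\<Sum>(x, y)\<leftarrow>s @ t. f x * g y)) \<le> ?I s + ?I t" .
  qed
next
  fix z :: "nat \<Rightarrow> 'b" and n :: nat
  assume z: "\<And>i. z i \<in> carrier F"
  show "(SUP (f, g)\<in>dual_ball S \<times> dual_ball F.
      ennreal (norm (\<Sum>(x, y)\<leftarrow>map (\<lambda>i. (unit i, z i)) [0..<n]. f x * g y)))
    \<le> ennreal (N (\<lambda>i. if i < n then nrm (bess_space F G) (z i) else 0))"
  proof (rule SUP_least, clarify)
    fix f g assume f: "f \<in> dual_ball S" and g: "g \<in> dual_ball F"
    let ?a = "\<lambda>i. if i < n then nrm (bess_space F G) (z i) else 0"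
    have a: "?a \<in> C" "\<And>i. 0 \<le> ?a i"
      using FB.nrm_nonneg z by (auto intro!: finite_support_mem[of _ n] simp del: bess_space_simps(5))
    have gz: "norm (g (z i)) \<le> nrm (bess_space F G) (z i)" for i
      using F.dual_ball_le[OF g z] F.nrm_le_bess_nrm[OF z] order_trans by blast
    have "norm (\<Sum>(x, y)\<leftarrow>map (\<lambda>i. (unit i, z i)) [0..<n]. f x * g y) = norm (\<Sum>i<n. f (unit i) * g (z i))"
      by (simp add: o_def interv_sum_list_conv_sum_set_nat atLeast0LessThan)
    also have "\<dots> \<le> (\<Sum>i<n. ?a i * norm (f (unit i)))"
    proof (rule order_trans[OF norm_sum sum_mono])
      fix i assume "i \<in> {..<n}"
      then show "norm (f (unit i) * g (z i)) \<le> ?a i * norm (f (unit i))"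
        using mult_left_mono[OF gz[of i], of "norm (f (unit i))"] by (simp add: norm_mult mult.commute)
    qed
    finally have "ennreal (norm (\<Sum>(x, y)\<leftarrow>map (\<lambda>i. (unit i, z i)) [0..<n]. f x * g y))
      \<le> ennreal (\<Sum>i<n. ?a i * norm (f (unit i)))" by (rule ennreal_leI)
    also have "\<dots> \<le> (\<Sum>m. ennreal (?a m * norm (f (unit m))))"
      by (rule sum_le_suminf_ennreal) (use a in auto)
    also have "\<dots> \<le> ennreal (N ?a)" by (rule dual_ball_pairing[OF f a])
    finally show "ennreal (norm (\<Sum>(x, y)\<leftarrow>map (\<lambda>i. (unit i, z i)) [0..<n]. f x * g y)) \<le> ennreal (N ?a)" .
  qed
next
  fix s assume s: "set s \<subseteq> carrier S \<times> carrier F"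
  show "(SUP (f, g)\<in>dual_ball S \<times> dual_ball F. ennreal (norm (\<Sum>(x, y)\<leftarrow>s. f x * g y)))
    \<le> ennreal (\<Sum>(x, y)\<leftarrow>s. nrm S x * nrm (bess_space F G) y)"
  proof (rule SUP_least, clarify, rule ennreal_leI)
    fix f g assume f: "f \<in> dual_ball S" and g: "g \<in> dual_ball F"
    show "norm (\<Sum>(x, y)\<leftarrow>s. f x * g y) \<le> (\<Sum>(x, y)\<leftarrow>s. nrm S x * nrm (bess_space F G) y)"
      using s
    proof (induction s)
      case (Cons p s)
      have p: "fst p \<in> carrier S" "snd p \<in> carrier F" and s: "set s \<subseteq> carrier S \<times> carrier F"
        using Cons.prems by auto
      have "norm (f (fst p) * g (snd p)) \<le> nrm S (fst p) * nrm (bess_space F G) (snd p)"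
        unfolding norm_mult
        using S.dual_ball_le[OF f p(1)] F.dual_ball_le[OF g p(2)] F.nrm_le_bess_nrm[OF p(2)]
        by (intro mult_mono) (auto simp del: sequence_space_simps bess_space_simps intro: S.nrm_nonneg[OF p(1)])
      then show ?case
        using Cons.IH[OF s] norm_triangle_ineq[of "f (fst p) * g (snd p)" "\<Sum>(x, y)\<leftarrow>s. f x * g y"]
        by (simp add: case_prod_unfold del: sequence_space_simps bess_space_simps)
    qed simp
  qed
qed

lemma coeff_scalar_functional:
  "coeff (sequence_space C N scalars) s i j = (\<Sum>(x, y)\<leftarrow>s. x i * y j)"
  by (induction s) auto

lemma (in sequence_norm) norm_coeff_le_injective_norm:
  fixes u :: "((nat \<Rightarrow> 'k::real_or_complex) \<times> (nat \<Rightarrow> 'k)) list set"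
  assumes u: "u \<in> tensor (sequence_space C N scalars) (sequence_space C N scalars)" and s: "s \<in> u"
  shows "ennreal (norm (coeff (sequence_space C N scalars) s i j))
    \<le> injective_norm (sequence_space C N scalars) (sequence_space C N scalars) u"
  unfolding injective_norm_eq[OF normed_sequence_space[OF normed_scalars] u s] coeff_scalar_functional
  by (rule SUP_upper2[of "(\<lambda>x. x i, \<lambda>x. x j)"]) (simp_all only: coordinate_in_dual_ball mem_Times_iff fst_conv snd_conv split order_refl)


section \<open>Double sequences as sequences\<close>

text \<open>Enumeration of a double sequence along the pairing function.\<close>

definition flatten :: "(nat \<Rightarrow> nat \<Rightarrow> 'a) \<Rightarrow> nat \<Rightarrow> 'a" where
  "flatten x k = x (fst (prod_decode k)) (snd (prod_decode k))"

lemma null_flatten: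
  fixes a :: "nat \<Rightarrow> nat \<Rightarrow> real"
  assumes nn: "\<And>i j. 0 \<le> a i j" and rows: "\<And>i. a i \<longlonglongrightarrow> 0" and sup: "(\<lambda>i. SUP j. a i j) \<longlonglongrightarrow> 0"
  shows "flatten a \<longlonglongrightarrow> 0" and "(SUP k. flatten a k) = (SUP i. SUP j. a i j)"
proof -
  note bdd = bdd_above_null[OF rows] bdd_above_null[OF sup]
  have le: "a i j \<le> (SUP j. a i j)" for i j by (rule cSUP_upper[OF UNIV_I bdd(1)])
  show null: "flatten a \<longlonglongrightarrow> 0"
    unfolding tendsto_iff
  proof (intro allI impI)
    fix e :: real assume e: "e > 0"
    obtain n where n: "\<And>i. i \<ge> n \<Longrightarrow> (SUP j. a i j) < e"
      using order_tendstoD(2)[OF sup e] unfolding eventually_sequentially by blast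
    have "\<forall>i. \<exists>m. \<forall>j\<ge>m. a i j < e"
      using order_tendstoD(2)[OF rows e] unfolding eventually_sequentially by blast
    then obtain m where m: "\<And>i j. j \<ge> m i \<Longrightarrow> a i j < e" by metis
    \<comment> \<open>only finitely many rows, and in each of them finitely many entries, reach \<open>e\<close>\<close>
    have "{k. \<not> dist (flatten a k) 0 < e} \<subseteq> prod_encode ` (SIGMA i:{..<n}. {..<m i})"
    proof
      fix k assume "k \<in> {k. \<not> dist (flatten a k) 0 < e}"
      then have big: "e \<le> a (fst (prod_decode k)) (snd (prod_decode k))"
        using nn by (simp add: flatten_def)
      then have "fst (prod_decode k) < n" "snd (prod_decode k) < m (fst (prod_decode k))"
        using n le m by (meson leD leI order_trans)+
      then have "prod_decode k \<in> (SIGMA i:{..<n}. {..<m i})" by (cases "prod_decode k") simp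
      then show "k \<in> prod_encode ` (SIGMA i:{..<n}. {..<m i})" by (metis imageI prod_decode_inverse)
    qed
    then have "finite {k. \<not> dist (flatten a k) 0 < e}" by (rule finite_subset) auto
    then show "\<forall>\<^sub>F k in sequentially. dist (flatten a k) 0 < e"
      unfolding cofinite_eq_sequentially[symmetric] eventually_cofinite .
  qed
  show "(SUP k. flatten a k) = (SUP i. SUP j. a i j)"
  proof (rule antisym)
    show "(SUP k. flatten a k) \<le> (SUP i. SUP j. a i j)"
      unfolding flatten_def using le cSUP_upper[OF UNIV_I bdd(2)] by (intro cSUP_least) (auto intro: order_trans)
    have "a i j \<le> (SUP k. flatten a k)" for i j
      using cSUP_upper[OF UNIV_I bdd_above_null[OF null], of "prod_encode (i, j)"] by (simp add: flatten_def)
    then show "(SUP i. SUP j. a i j) \<le> (SUP k. flatten a k)" by (intro cSUP_least) auto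
  qed
qed

lemma suminf_flatten:
  fixes a :: "nat \<Rightarrow> nat \<Rightarrow> real"
  assumes nn: "\<And>i j. 0 \<le> a i j" and rows: "\<And>i. summable (a i)" and sum: "summable (\<lambda>i. \<Sum>j. a i j)"
  shows "summable (flatten a)" and "(\<Sum>k. flatten a k) = (\<Sum>i. \<Sum>j. a i j)"
proof -
  have nn': "0 \<le> flatten a k" for k using nn by (simp add: flatten_def)
  have "(\<Sum>k. ennreal (flatten a k)) = (\<Sum>i. \<Sum>j. ennreal (a i j))"
    using suminf_ennreal_2dimen[of "\<lambda>i. \<Sum>j. ennreal (a i j)" "\<lambda>p. ennreal (a (fst p) (snd p))"]
    by (simp add: flatten_def)
  also have "\<dots> = (\<Sum>i. ennreal (\<Sum>j. a i j))" using nn rows by (simp add: suminf_ennreal2)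
  also have "\<dots> = ennreal (\<Sum>i. \<Sum>j. a i j)"
    using nn rows sum by (intro suminf_ennreal2 suminf_nonneg) auto
  finally have eq: "(\<Sum>k. ennreal (flatten a k)) = ennreal (\<Sum>i. \<Sum>j. a i j)" .
  show s: "summable (flatten a)" by (rule summable_suminf_not_top[OF nn']) (simp add: eq)
  have "ennreal (\<Sum>k. flatten a k) = ennreal (\<Sum>i. \<Sum>j. a i j)"
    using eq suminf_ennreal2[OF nn' s] by simp
  then show "(\<Sum>k. flatten a k) = (\<Sum>i. \<Sum>j. a i j)"
    using s nn' rows nn sum by (simp add: suminf_nonneg)
qed

text \<open>
  If flattening maps double sequences isometrically, a tensor norm that is the norm of the
  coefficients has the scalar sequence space itself as completion.
\<close>

lemma (in sequence_norm) completion_flatten: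
  fixes \<alpha> :: "((nat \<Rightarrow> 'k::real_or_complex) \<times> (nat \<Rightarrow> 'k)) list set \<Rightarrow> ennreal"
  defines "S \<equiv> sequence_space C N (scalars :: ('k, 'k) nspace)"
  assumes flat: "\<And>x. x \<in> carrier (sequence_space C N S) \<Longrightarrow>
      flatten x \<in> carrier S \<and> nrm S (flatten x) = nrm (sequence_space C N S) x"
    and \<alpha>: "\<And>u s. \<lbrakk>u \<in> tensor S S; s \<in> u\<rbrakk> \<Longrightarrow> \<alpha> u = ennreal (nrm (sequence_space C N S) (coeff S s))"
  shows "isometrically_isomorphic (completion (tensor_space S S \<alpha>)) S"
proof -
  interpret sequence_tensor C N S unit_basis
    unfolding S_def by (intro sequence_tensor.intro sequence_norm_axioms bessel_system_unit_basis)
  have S: "sequence_space C N (scalars :: ('k, 'k) nspace) = S" by (simp add: S_def)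
  have nrmB: "nrm (bess_space S unit_basis) x = nrm S x" if "x \<in> carrier S" for x
    using bess_norm_unit_basis[where ?'k = 'k, unfolded S, OF that] F.nrm_nonneg[OF that] by simp
  have mem: "coeff S s \<in> carrier (sequence_space C N S)" if s: "set s \<subseteq> carrier S \<times> carrier S" for s
  proof -
    have c: "coeff S s i \<in> carrier S" for i by (rule coeff_closed[unfolded S, OF s])
    have "(\<lambda>i. nrm (bess_space S unit_basis) (coeff S s i)) \<in> C"
      using coeff_mem[unfolded S, OF s] unfolding sequence_space_simps(1) by blast
    then show ?thesis unfolding nrmB[OF c] using c by simp
  qed
  have vaddS: "vadd S x y = (\<lambda>j. x j + y j)" and smulS: "smul S c x = (\<lambda>j. c * x j)" for x y c
    by (simp_all add: S_def)
  show ?thesis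
  proof (rule tensor_completion_isometric[where J = "\<lambda>s. flatten (coeff S s)"])
    show "normed_space S" "normed_space S" by (rule F.normed_space_axioms)+
    show "banach_space S" unfolding S_def by (rule banach_sequence_space[OF banach_scalars])
    show "flatten (coeff S s) \<in> carrier S" if "set s \<subseteq> carrier S \<times> carrier S" for s
      using flat[OF mem[OF that]] by simp
    show "flatten (coeff S s) = flatten (coeff S t)" if "tensor_eq S S s t" for s t
      using coeff_cong[unfolded S, OF that] by simp
    show "flatten (coeff S (s @ t)) = vadd S (flatten (coeff S s)) (flatten (coeff S t))"
      if "set s \<subseteq> carrier S \<times> carrier S" "set t \<subseteq> carrier S \<times> carrier S" for s t
      unfolding flatten_def coeff_append[unfolded S, OF that] vaddS ..
    show "flatten (coeff S (map (\<lambda>(x, y). (smul S c x, y)) s)) = smul S c (flatten (coeff S s))"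
      if "set s \<subseteq> carrier S \<times> carrier S" for c s
      using coeff_scale[unfolded S, OF that, of c] by (simp add: flatten_def smulS fun_eq_iff)
    show "\<alpha> u = ennreal (nrm S (flatten (coeff S (rep u))))" if u: "u \<in> tensor S S" for u
      using \<alpha>[OF u rep_in_tensor[OF u]]
        flat[OF mem[OF tensor_mem_carrier[OF F.normed_space_axioms F.normed_space_axioms u rep_in_tensor[OF u]]]]
      by simp
    fix z and e :: real
    assume z: "z \<in> carrier S" and e: "e > 0"
    then have zC: "(\<lambda>i. norm (z i)) \<in> C" by (simp add: S_def)
    obtain n where n: "N (\<lambda>i. if i < n then 0 else norm (z i)) \<le> e / 2"
      using tail_small[OF zC, of "e / 2"] e by auto
    let ?s = "map (\<lambda>k. (unit (fst (prod_decode k)), \<lambda>i. z k * unit (snd (prod_decode k)) i)) [0..<n]"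
    have "coeff S ?s i j = (if prod_encode (i, j) < n then z (prod_encode (i, j)) else 0)" for i j
    proof -
      have "coeff S ?s i j = (\<Sum>k<n. unit (fst (prod_decode k)) i * (z k * unit (snd (prod_decode k)) j))"
        unfolding S_def coeff_scalar_functional
        by (simp add: o_def interv_sum_list_conv_sum_set_nat atLeast0LessThan)
      also have "\<dots> = (\<Sum>k<n. if k = prod_encode (i, j) then z k else 0)"
      proof (rule sum.cong[OF HOL.refl])
        fix k
        obtain a b where "k = prod_encode (a, b)" by (metis prod_decode_inverse surj_pair)
        then show "unit (fst (prod_decode k)) i * (z k * unit (snd (prod_decode k)) j)
            = (if k = prod_encode (i, j) then z k else 0)"
          by (auto simp: prod_encode_eq)
      qed
      finally show ?thesis by simp
    qed
    then have "flatten (coeff S ?s) = (\<lambda>k. if k < n then z k else 0)"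
      by (simp add: flatten_def fun_eq_iff)
    then have "vdist S (flatten (coeff S ?s)) z = N (\<lambda>i. if i < n then 0 else norm (z i))"
      unfolding S_def vdist_sequence_space vdist_scalars by (intro arg_cong[of _ _ N]) (auto simp: fun_eq_iff)
    moreover have "set ?s \<subseteq> carrier S \<times> carrier S"
    proof -
      have "(\<lambda>i. z k * unit m i) \<in> carrier S" for k m
        using F.smul_closed[OF unit_closed[where ?'k = 'k, unfolded S], of "z k" m] unfolding smulS .
      then show ?thesis using unit_closed[where ?'k = 'k, unfolded S] by auto
    qed
    ultimately show "\<exists>s. set s \<subseteq> carrier S \<times> carrier S \<and> vdist S (flatten (coeff S s)) z < e"
      using n e by (intro exI[of _ ?s]) simp
  qed
qed


section \<open>Two null sequence spaces\<close>

lemma bessel_system_c0: "bessel_system (c0 :: ('k::real_or_complex, nat \<Rightarrow> 'k) nspace) unit_basis"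
  unfolding c0_space_eq by (rule sequence_norm.bessel_system_unit_basis[OF sequence_norm_c0])

lemma banach_bess_c0:
  "banach_space (bess_space (c0 :: ('k::real_or_complex, nat \<Rightarrow> 'k) nspace) unit_basis)"
  unfolding c0_space_eq by (rule sequence_norm.banach_bess_unit_basis[OF sequence_norm_c0])

lemma normed_c0: "normed_space (c0 :: ('k::real_or_complex, nat \<Rightarrow> 'k) nspace)"
  unfolding c0_space_eq by (rule sequence_norm.normed_sequence_space[OF sequence_norm_c0 normed_scalars])

lemma normed_ell: "1 \<le> p \<Longrightarrow> normed_space (ell p :: ('k::real_or_complex, nat \<Rightarrow> 'k) nspace)"
  unfolding lp_space_eq by (rule sequence_norm.normed_sequence_space[OF sequence_norm_lp normed_scalars])

lemma bess_nrm_c0: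
  "x \<in> carrier (c0 :: ('k::real_or_complex, nat \<Rightarrow> 'k) nspace)
    \<Longrightarrow> nrm (bess_space c0 unit_basis) x = nrm c0 x"
  unfolding c0_space_eq by (rule sequence_norm.bess_nrm_unit_basis[OF sequence_norm_c0])

text \<open>
  Products of coordinate functionals show that the injective norm is at least the supremum of
  the entries; this supremum is also the Besselian crossnorm.
\<close>

lemma crossnorm_c0_c0:
  assumes u: "u \<in> tensor (c0 :: ('k::real_or_complex, nat \<Rightarrow> 'k) nspace) (c0 :: ('k, nat \<Rightarrow> 'k) nspace)"
    and s: "s \<in> u"
  shows "bess_crossnorm c0 unit_basis c0 unit_basis u = ennreal (nrm (c0_space c0) (coeff c0 s))"
    and "injective_norm c0 c0 u = ennreal (nrm (c0_space c0) (coeff c0 s))"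
proof -
  let ?S = "c0 :: ('k, nat \<Rightarrow> 'k) nspace"
  interpret sequence_tensor "{a. a \<longlonglongrightarrow> 0}" "\<lambda>a. SUP i. a i" ?S unit_basis
    by (intro sequence_tensor.intro sequence_norm_c0 bessel_system_c0)
  have S: "S = ?S" by (simp add: c0_space_eq)
  have sc: "set s \<subseteq> carrier ?S \<times> carrier ?S" by (rule tensor_mem_carrier[OF normed_c0 normed_c0 u s])
  have eq: "nrm (c0_space (bess_space ?S unit_basis)) (coeff ?S s) = nrm (c0_space ?S) (coeff ?S s)"
    using nrm_coeff_bess_space[of s] sc unfolding c0_space_eq by blast
  show "bess_crossnorm c0 unit_basis c0 unit_basis u = ennreal (nrm (c0_space c0) (coeff c0 s))"
    using crossnorm_c0[OF bessel_system_c0 banach_bess_c0 u s] unfolding eq .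
  have c: "coeff ?S s i \<in> carrier ?S" for i by (rule coeff_closed[unfolded S, OF sc])
  have nrm: "nrm ?S x = (SUP j. norm (x j))" for x by (simp add: c0_space_def)
  show "injective_norm c0 c0 u = ennreal (nrm (c0_space c0) (coeff c0 s))"
  proof (rule antisym)
    show "injective_norm c0 c0 u \<le> ennreal (nrm (c0_space c0) (coeff c0 s))"
      using injective_norm_le_nrm_coeff[of u s] u s unfolding S eq[symmetric] by (simp add: c0_space_eq)
    have "ennreal (norm (coeff ?S s i j)) \<le> injective_norm ?S ?S u" for i j
      using norm_coeff_le_injective_norm[of u s i j] u s unfolding S by blast
    then have "ennreal (nrm ?S (coeff ?S s i)) \<le> injective_norm ?S ?S u" for i
      unfolding nrm by (intro ennreal_SUP_le) auto
    then have "ennreal (SUP i. nrm ?S (coeff ?S s i)) \<le> injective_norm ?S ?S u"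
      using c by (intro ennreal_SUP_le F.nrm_nonneg) auto
    then show "ennreal (nrm (c0_space c0) (coeff c0 s)) \<le> injective_norm c0 c0 u"
      by (simp add: c0_space_def[of ?S])
  qed
qed

lemma completion_c0_c0:
  "isometrically_isomorphic
     (completion (tensor_space (c0 :: ('k::real_or_complex, nat \<Rightarrow> 'k) nspace)
       (c0 :: ('k, nat \<Rightarrow> 'k) nspace) (injective_norm c0 c0))) (c0 :: ('k, nat \<Rightarrow> 'k) nspace)"
proof -
  let ?S = "c0 :: ('k, nat \<Rightarrow> 'k) nspace"
  interpret sequence_norm "{a. a \<longlonglongrightarrow> 0}" "\<lambda>a. SUP i. a i" by (rule sequence_norm_c0)
  have flat: "flatten x \<in> carrier ?S \<and> nrm ?S (flatten x) = nrm (c0_space ?S) x"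
    if x: "x \<in> carrier (c0_space ?S)" for x
  proof -
    have flat_norm: "(\<lambda>k. norm (flatten x k)) = flatten (\<lambda>i j. norm (x i j))"
      by (simp add: flatten_def fun_eq_iff)
    have rows: "(\<lambda>j. norm (x i j)) \<longlonglongrightarrow> 0" and sup: "(\<lambda>i. SUP j. norm (x i j)) \<longlonglongrightarrow> 0" for i
      using x by (auto simp: c0_space_def)
    note nf = null_flatten[of "\<lambda>i j. norm (x i j)", OF _ rows sup, folded flat_norm]
    show ?thesis using nf by (simp add: c0_space_def)
  qed
  show ?thesis
    using completion_flatten[where ?'k = 'k and \<alpha> = "injective_norm ?S ?S"] flat crossnorm_c0_c0(2)
    unfolding c0_space_eq by blast
qed


section \<open>Two spaces of absolutely summable sequences\<close>

text \<open>
  On \<open>\<Sum>\<^sub>i\<^sub><\<^sub>n e\<^sub>i \<otimes> z\<^sub>i\<close> the projective sum is the sum of the norms of the \<open>z\<^sub>i\<close>, which is the norm of the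
  coefficients in \<open>\<ell>\<^sub>1(\<ell>\<^sub>1)\<close>.
\<close>

lemma crossnorm_ell_1:
  assumes u: "u \<in> tensor (ell 1 :: ('k::real_or_complex, nat \<Rightarrow> 'k) nspace) (ell 1 :: ('k, nat \<Rightarrow> 'k) nspace)"
    and s: "s \<in> u"
  shows "bess_crossnorm (ell 1) unit_basis (ell 1) unit_basis u
      = ennreal (nrm (lp_space 1 (ell 1)) (coeff (ell 1) s))"
    and "projective_norm (ell 1) (ell 1) u = ennreal (nrm (lp_space 1 (ell 1)) (coeff (ell 1) s))"
proof -
  let ?S = "ell 1 :: ('k, nat \<Rightarrow> 'k) nspace"
  let ?B = "bess_space ?S unit_basis"
  interpret sequence_tensor "{a. summable (\<lambda>i. a i powr 1)}" "\<lambda>a. (\<Sum>i. a i powr 1) powr (1 / 1)" ?S unit_basis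
    by (intro sequence_tensor.intro sequence_norm_lp bessel_system_ell) simp_all
  have S: "S = ?S" by (simp add: lp_space_eq)
  have T: "target = lp_space 1 ?B" by (rule lp_space_eq[symmetric])
  have carr: "set t \<subseteq> carrier ?S \<times> carrier ?S" if "t \<in> u" for t
    by (rule tensor_mem_carrier[OF normed_ell normed_ell u that]) simp_all
  note sc = carr[OF s]
  have eq: "nrm (lp_space 1 ?B) (coeff ?S s) = nrm (lp_space 1 ?S) (coeff ?S s)"
    using nrm_coeff_bess_space[of s] sc unfolding lp_space_eq by blast
  show "bess_crossnorm (ell 1) unit_basis (ell 1) unit_basis u
      = ennreal (nrm (lp_space 1 (ell 1)) (coeff (ell 1) s))"
    using crossnorm_ell[OF order_refl u s] unfolding eq .
  have B: "nrm ?B y = nrm ?S y" if "y \<in> carrier ?S" for y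
    by (rule bess_nrm_ell[OF order_refl that])
  have nn: "0 \<le> nrm ?S y" if "y \<in> carrier ?S" for y by (rule F.nrm_nonneg[OF that])
  have list: "(\<Sum>(x, y)\<leftarrow>t. ennreal (nrm ?S x * nrm ?S y))
      = ennreal (\<Sum>(x, y)\<leftarrow>t. nrm ?S x * nrm ?B y)" if t: "set t \<subseteq> carrier ?S \<times> carrier ?S" for t
  proof -
    have "(\<Sum>(x, y)\<leftarrow>t. ennreal (nrm ?S x * nrm ?S y)) = (\<Sum>(x, y)\<leftarrow>t. ennreal (nrm ?S x * nrm ?B y))"
      by (intro arg_cong[where f = sum_list] map_cong HOL.refl) (use t B in \<open>auto simp del: bess_space_simps(5)\<close>)
    then show ?thesis using sum_list_ennreal_nrm[unfolded S, OF t] by simp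
  qed
  show "projective_norm (ell 1) (ell 1) u = ennreal (nrm (lp_space 1 (ell 1)) (coeff (ell 1) s))"
  proof (rule antisym)
    have "projective_norm ?S ?S u \<le> ennreal (nrm target (coeff ?S s))"
    proof (rule le_nrm_coeff[unfolded S, where \<Phi> = "\<lambda>t. \<Sum>(x, y)\<leftarrow>t. ennreal (nrm ?S x * nrm ?S y)"])
      show "set s \<subseteq> carrier ?S \<times> carrier ?S" by (rule sc)
      show "projective_norm ?S ?S u \<le> (\<Sum>(x, y)\<leftarrow>t. ennreal (nrm ?S x * nrm ?S y))"
        if "tensor_eq ?S ?S s t" for t
        unfolding projective_norm_def by (rule INF_lower[OF tensor_mem_trans[OF u s that]])
      show "(\<Sum>(x, y)\<leftarrow>t. ennreal (nrm ?S x * nrm ?S y)) \<le> ennreal (\<Sum>(x, y)\<leftarrow>t. nrm ?S x * nrm ?B y)"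
        if "set t \<subseteq> carrier ?S \<times> carrier ?S" for t
        unfolding list[OF that] ..
      show "(\<Sum>(x, y)\<leftarrow>t @ t'. ennreal (nrm ?S x * nrm ?S y))
        \<le> (\<Sum>(x, y)\<leftarrow>t. ennreal (nrm ?S x * nrm ?S y)) + (\<Sum>(x, y)\<leftarrow>t'. ennreal (nrm ?S x * nrm ?S y))"
        for t t' by simp
      fix z :: "nat \<Rightarrow> nat \<Rightarrow> 'k" and n :: nat
      assume z: "\<And>i. z i \<in> carrier ?S"
      let ?a = "\<lambda>i. if i < n then nrm ?B (z i) else 0"
      have unit: "nrm ?S (unit i) = 1" for i
        using N_single[of 1 i] unfolding S[symmetric] sequence_space_simps by (simp add: if_distrib cong: if_cong)
      have "(\<Sum>(x, y)\<leftarrow>map (\<lambda>i. (unit i, z i)) [0..<n]. ennreal (nrm ?S x * nrm ?S y))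
          = (\<Sum>i<n. ennreal (nrm ?S (z i)))"
        by (simp add: o_def interv_sum_list_conv_sum_set_nat atLeast0LessThan unit)
      also have "\<dots> = ennreal (\<Sum>i<n. nrm ?S (z i))"
        using nn[OF z] by (simp add: sum_ennreal)
      also have "(\<Sum>i<n. nrm ?S (z i)) = (\<Sum>i<n. ?a i powr 1)"
        by (rule sum.cong) (use nn z B in \<open>auto simp del: bess_space_simps(5)\<close>)
      also have "\<dots> = (\<Sum>i. ?a i powr 1)"
        by (rule suminf_finite[symmetric]) auto
      also have "\<dots> = (\<Sum>i. ?a i powr 1) powr (1 / 1)"
      proof -
        have "0 \<le> (\<Sum>i. ?a i powr 1)" by (rule suminf_nonneg) (auto intro!: summable_finite[of "{..<n}"])
        then show ?thesis by simp
      qed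
      finally show "(\<Sum>(x, y)\<leftarrow>map (\<lambda>i. (unit i, z i)) [0..<n]. ennreal (nrm ?S x * nrm ?S y))
        \<le> ennreal ((\<Sum>i. ?a i powr 1) powr (1 / 1))" by simp
    qed
    then show "projective_norm (ell 1) (ell 1) u \<le> ennreal (nrm (lp_space 1 (ell 1)) (coeff (ell 1) s))"
      unfolding T eq .
    show "ennreal (nrm (lp_space 1 (ell 1)) (coeff (ell 1) s)) \<le> projective_norm (ell 1) (ell 1) u"
      unfolding projective_norm_def
    proof (rule INF_greatest)
      fix t assume t: "t \<in> u"
      have "coeff ?S s = coeff ?S t" by (rule coeff_cong[unfolded S, OF tensor_memD[OF u s t]])
      then show "ennreal (nrm (lp_space 1 ?S) (coeff ?S s)) \<le> (\<Sum>(x, y)\<leftarrow>t. ennreal (nrm ?S x * nrm ?S y))"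
        using nrm_coeff_le[unfolded S, OF carr[OF t]] unfolding list[OF carr[OF t]] eq[symmetric] T
        by (simp add: ennreal_leI)
    qed
  qed
qed

lemma completion_ell_1:
  "isometrically_isomorphic
     (completion (tensor_space (ell 1 :: ('k::real_or_complex, nat \<Rightarrow> 'k) nspace)
       (ell 1 :: ('k, nat \<Rightarrow> 'k) nspace) (projective_norm (ell 1) (ell 1)))) (ell 1 :: ('k, nat \<Rightarrow> 'k) nspace)"
proof -
  let ?S = "ell 1 :: ('k, nat \<Rightarrow> 'k) nspace"
  interpret sequence_norm "{a. summable (\<lambda>i. a i powr 1)}" "\<lambda>a. (\<Sum>i. a i powr 1) powr (1 / 1)"
    by (rule sequence_norm_lp) simp
  have flat: "flatten x \<in> carrier ?S \<and> nrm ?S (flatten x) = nrm (lp_space 1 ?S) x"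
    if x: "x \<in> carrier (lp_space 1 ?S)" for x
  proof -
    have flat_norm: "(\<lambda>k. norm (flatten x k)) = flatten (\<lambda>i j. norm (x i j))" by (simp add: flatten_def fun_eq_iff)
    have xi: "x i \<in> carrier ?S" for i using x by (simp add: lp_space_def)
    have nrm: "nrm ?S (x i) = (\<Sum>j. norm (x i j))" for i by (rule ell_1_nrm[OF xi])
    have rows: "summable (\<lambda>j. norm (x i j))" for i using xi unfolding ell_1_summable by blast
    have nn: "0 \<le> nrm ?S (x i)" for i unfolding nrm by (rule suminf_nonneg[OF rows]) simp
    have "summable (\<lambda>i. nrm ?S (x i) powr 1)" using x unfolding lp_space_def by simp
    then have sum: "summable (\<lambda>i. \<Sum>j. norm (x i j))" using nn unfolding nrm by simp
    have "0 \<le> (\<Sum>i. \<Sum>j. norm (x i j))" using sum nn unfolding nrm by (rule suminf_nonneg)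
    then have total: "nrm (lp_space 1 ?S) x = (\<Sum>i. \<Sum>j. norm (x i j))"
      unfolding lp_space_eq[of 1 ?S] sequence_space_simps nrm using nn[unfolded nrm] by simp
    note sf = suminf_flatten[of "\<lambda>i j. norm (x i j)", OF _ rows sum, folded flat_norm]
    have mem: "flatten x \<in> carrier ?S" using sf(1) unfolding ell_1_summable by simp
    show ?thesis using mem sf(2) unfolding ell_1_nrm[OF mem] total by simp
  qed
  show ?thesis
    using completion_flatten[where ?'k = 'k and \<alpha> = "projective_norm ?S ?S"] flat crossnorm_ell_1(2)
    unfolding lp_space_eq by blast
qed


section \<open>Two Hilbert sequence spaces\<close>

lemma parallelogram_scalar:
  fixes x y :: "'k::real_or_complex"
  shows "(norm (x + y))\<^sup>2 + (norm (x - y))\<^sup>2 = 2 * ((norm x)\<^sup>2 + (norm y)\<^sup>2)"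
proof -
  obtain \<phi> :: "'k \<Rightarrow> complex" where add: "\<And>x y. \<phi> (x + y) = \<phi> x + \<phi> y" and norm: "\<And>x. norm (\<phi> x) = norm x"
    using real_or_complex[where ?'a = 'k] by auto
  have diff: "\<phi> (x - y) = \<phi> x - \<phi> y" using add[of "x - y" y] by simp
  have "(norm (\<phi> x + \<phi> y))\<^sup>2 + (norm (\<phi> x - \<phi> y))\<^sup>2 = 2 * ((norm (\<phi> x))\<^sup>2 + (norm (\<phi> y))\<^sup>2)"
    unfolding cmod_power2 by (simp add: power2_eq_square algebra_simps)
  then show ?thesis by (simp add: norm flip: add diff)
qed

lemma cauchy_schwarz_two:
  fixes a b c d :: real
  shows "(a * b + c * d)\<^sup>2 \<le> (a\<^sup>2 + c\<^sup>2) * (b\<^sup>2 + d\<^sup>2)"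
proof -
  have "(a\<^sup>2 + c\<^sup>2) * (b\<^sup>2 + d\<^sup>2) - (a * b + c * d)\<^sup>2 = (a * d - c * b)\<^sup>2"
    by (simp add: power2_eq_square algebra_simps)
  then show ?thesis using zero_le_power2[of "a * d - c * b"] by linarith
qed

text \<open>
  Three tensors separate the norms. On \<open>e\<^sub>0 \<otimes> e\<^sub>0\<close> the Besselian crossnorm is \<open>1\<close>, the injective norm at least and the projective norm
  at most \<open>1\<close>, which bounds a factor
  of proportionality by \<open>1\<close>: from above for the injective norm, from below for the projective norm.
  The tensor with matrix rows \<open>(1, 1)\<close> and \<open>(1, -1)\<close> has Besselian crossnorm at least \<open>2\<close>, but injective
  norm at most \<open>\<surd>2\<close>; and \<open>e\<^sub>0 \<otimes> e\<^sub>0 + e\<^sub>1 \<otimes> e\<^sub>1\<close> has Besselian crossnorm at most \<open>1\<close>, but projective norm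
  at least \<open>2\<close>.
\<close>

lemma
  defines "S \<equiv> (ell 2 :: ('k::real_or_complex, nat \<Rightarrow> 'k) nspace)"
  shows ell_2_not_injective: "\<nexists>c. \<forall>u \<in> tensor S S.
      bess_crossnorm S unit_basis S unit_basis u
        = c * injective_norm (bess_space S unit_basis) (bess_space S unit_basis) u"
    and ell_2_not_projective: "\<nexists>c. \<forall>u \<in> tensor S S.
      bess_crossnorm S unit_basis S unit_basis u
        = c * projective_norm (bess_space S unit_basis) (bess_space S unit_basis) u"
proof -
  define C where "C = {a :: nat \<Rightarrow> real. summable (\<lambda>i. a i powr 2)}"
  define N where "N a = (\<Sum>i :: nat. a i powr 2) powr (1 / 2)" for a :: "nat \<Rightarrow> real"
  have S_eq: "S = sequence_space C N scalars"
    unfolding S_def lp_space_eq C_def N_def ..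
  interpret sequence_norm C N
    unfolding C_def N_def by (rule sequence_norm_lp) simp
  interpret T: sequence_tensor C N S unit_basis
    unfolding S_eq by (intro sequence_tensor.intro sequence_norm_axioms bessel_system_unit_basis)
  note SS = S_eq[symmetric]
  let ?e = "\<lambda>m i. if i = m then 1 else 0 :: 'k"
  have e: "?e m \<in> carrier S" for m using unit_closed[where ?'k = 'k, unfolded SS] .
  have nB: "nrm (bess_space S unit_basis) x = nrm S x" if "x \<in> carrier S" for x
    using bess_nrm_unit_basis[where ?'k = 'k, unfolded SS, OF that] .
  have ne: "nrm S (?e m) = 1" for m
    using N_unit[of m] unfolding S_eq sequence_space_simps by (simp add: if_distrib cong: if_cong)
  have be: "bess_norm S unit_basis (?e m) = 1" for m
    using bess_norm_unit_basis[where ?'k = 'k, unfolded SS, OF e] ne by simp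
  have N2: "N (\<lambda>i. if i < 2 then a i else 0) = sqrt ((a 0)\<^sup>2 + (a 1)\<^sup>2)" if "\<And>i. 0 \<le> a i" for a
  proof -
    have "(\<Sum>i. (if i < 2 then a i else 0) powr 2) = (\<Sum>i<2. (if i < 2 then a i else 0) powr 2)"
      by (rule suminf_finite) auto
    also have "\<dots> = (a 0)\<^sup>2 + (a 1)\<^sup>2" using that by (simp add: numeral_2_eq_2 powr_numeral)
    finally show ?thesis unfolding N_def by (simp add: powr_half_sqrt)
  qed
  have two_mem: "(\<lambda>i. if i < 2 then a i else 0) \<in> C" if "\<And>i. 0 \<le> a i" for a :: "nat \<Rightarrow> real"
    by (rule finite_support_mem[of _ 2]) (use that in auto)
  have pair: "(a 0 * norm (f (?e 0)) + a 1 * norm (f (?e 1))) \<le> sqrt ((a 0)\<^sup>2 + (a 1)\<^sup>2)"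
    if f: "f \<in> dual_ball S" and a: "\<And>i. 0 \<le> a i" for a :: "nat \<Rightarrow> real" and f
  proof -
    let ?a = "\<lambda>i. if i < 2 then a i else 0"
    have "ennreal (\<Sum>m<2. ?a m * norm (f (?e m))) \<le> (\<Sum>m. ennreal (?a m * norm (f (?e m))))"
      by (rule sum_le_suminf_ennreal) (use a in auto)
    also have "\<dots> \<le> ennreal (N ?a)"
      by (rule dual_ball_pairing[OF f[unfolded S_eq] two_mem[OF a]]) (use a in auto)
    finally have "(\<Sum>m<2. ?a m * norm (f (?e m))) \<le> sqrt ((a 0)\<^sup>2 + (a 1)\<^sup>2)"
      unfolding N2[OF a] by (simp add: ennreal_le_iff)
    then show ?thesis by (simp add: numeral_2_eq_2)
  qed
  have dual: "(norm (f (?e 0)))\<^sup>2 + (norm (f (?e 1)))\<^sup>2 \<le> 1" if f: "f \<in> dual_ball S" for f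
  proof -
    let ?q = "(norm (f (?e 0)))\<^sup>2 + (norm (f (?e 1)))\<^sup>2"
    have "?q \<le> sqrt ?q"
      using pair[OF f, of "\<lambda>i. norm (f (?e i))"] by (simp add: power2_eq_square)
    then have "?q * ?q \<le> sqrt ?q * sqrt ?q" by (intro mult_mono) auto
    then have "?q * ?q \<le> ?q * 1" by simp
    moreover have "0 \<le> ?q" by simp
    ultimately show ?thesis by (metis mult_le_cancel_left_pos order_le_less zero_le_one)
  qed
  have two_le: "a * b + c * d \<le> r"
    if "a\<^sup>2 + c\<^sup>2 \<le> 1" "b\<^sup>2 + d\<^sup>2 \<le> r\<^sup>2" "0 \<le> r" for a b c d r :: real
  proof (rule power2_le_imp_le)
    have "(a * b + c * d)\<^sup>2 \<le> (a\<^sup>2 + c\<^sup>2) * (b\<^sup>2 + d\<^sup>2)" by (rule cauchy_schwarz_two)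
    also have "\<dots> \<le> 1 * r\<^sup>2" by (rule mult_mono) (use that in auto)
    finally show "(a * b + c * d)\<^sup>2 \<le> r\<^sup>2" by simp
  qed (rule that)
  have coord: "(\<lambda>x. x i) \<in> dual_ball S" for i
    using coordinate_in_dual_ball[where ?'k = 'k] unfolding SS .
  have coeff: "coeff S s i j = (\<Sum>(x, y)\<leftarrow>s. x i * y j)" for s i j
    unfolding S_eq by (rule coeff_scalar_functional)
  have coeff_class: "coeff S t = coeff S s" if "t \<in> tensor_class S S s" for s t
    using that T.coeff_cong[unfolded SS, of s t] unfolding tensor_class_mem by simp
  have S: "normed_space S" by (rule T.F.normed_space_axioms)
  have carr: "set t \<subseteq> carrier S \<times> carrier S"
    if "t \<in> tensor_class S S s" "set s \<subseteq> carrier S \<times> carrier S" for s t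
    by (rule tensor_mem_carrier[OF S S tensor_class_in_tensor[OF that(2)] that(1)])
  have pairing: "ennreal (\<Sum>m<2. \<Sum>n<2. norm (f (?e m)) * norm (coeff S t m n) * norm (g (?e n)))
      \<le> bess S unit_basis S unit_basis t"
    if f: "f \<in> dual_ball S" and g: "g \<in> dual_ball S" and t: "set t \<subseteq> carrier S \<times> carrier S" for f g t
  proof -
    have "ennreal (\<Sum>m<2. \<Sum>n<2. norm (f (?e m)) * norm (coeff S t m n) * norm (g (?e n)))
        = (\<Sum>m<2. ennreal (norm (f (?e m))) * ennreal (\<Sum>n<2. norm (coeff S t m n * g (?e n))))"
      by (simp add: sum_distrib_left norm_mult mult.assoc sum_nonneg flip: ennreal_mult sum_ennreal)
    also have "\<dots> \<le> (\<Sum>m<2. ennreal (norm (f (?e m))) * (\<Sum>n. ennreal (norm (coeff S t m n * g (?e n)))))"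
      by (intro sum_mono mult_left_mono sum_le_suminf_ennreal) auto
    also have "\<dots> \<le> (\<Sum>m. ennreal (norm (f (?e m))) * (\<Sum>n. ennreal (norm (coeff S t m n * g (?e n)))))"
      by (rule sum_le_suminf) auto
    also have "\<dots> \<le> bess S unit_basis S unit_basis t"
      using T.pairing_le_bess[unfolded SS, OF f g t] by simp
    finally show ?thesis .
  qed

  let ?s0 = "[(?e 0, ?e 0)]"
  let ?u0 = "tensor_class S S ?s0"
  have s0: "set ?s0 \<subseteq> carrier S \<times> carrier S" using e by auto
  have \<alpha>0_le: "bess_crossnorm S unit_basis S unit_basis ?u0 \<le> 1"
    unfolding bess_crossnorm_def
    by (rule INF_lower2[OF tensor_class_self[OF s0]], rule order_trans[OF bess_le_bess_norms]) (simp add: be)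
  have \<alpha>0_ge: "1 \<le> bess_crossnorm S unit_basis S unit_basis ?u0"
    unfolding bess_crossnorm_def
  proof (rule INF_greatest)
    fix t assume t: "t \<in> ?u0"
    have "coeff S t 0 0 = 1" unfolding coeff_class[OF t] coeff by simp
    then show "1 \<le> bess S unit_basis S unit_basis t"
      using pairing[OF coord[of 0] coord[of 0] carr[OF t s0]] by (simp add: numeral_2_eq_2)
  qed

  show "\<nexists>c. \<forall>u \<in> tensor S S. bess_crossnorm S unit_basis S unit_basis u
        = c * injective_norm (bess_space S unit_basis) (bess_space S unit_basis) u"
  proof
    assume "\<exists>c. \<forall>u \<in> tensor S S. bess_crossnorm S unit_basis S unit_basis u
        = c * injective_norm (bess_space S unit_basis) (bess_space S unit_basis) u"
    then obtain c where c': "\<And>u. u \<in> tensor S S \<Longrightarrow> bess_crossnorm S unit_basis S unit_basis u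
        = c * injective_norm (bess_space S unit_basis) (bess_space S unit_basis) u" by blast
    have inj: "injective_norm (bess_space S unit_basis) (bess_space S unit_basis) = injective_norm S S"
      by (rule injective_norm_bess_space) (rule nB, assumption)+
    have c: "bess_crossnorm S unit_basis S unit_basis u = c * injective_norm S S u"
      if "u \<in> tensor S S" for u
      using c'[OF that] unfolding inj .
    have "coeff S ?s0 0 0 = 1" unfolding coeff by simp
    then have "1 \<le> injective_norm S S ?u0"
      using norm_coeff_le_injective_norm[where ?'k = 'k, unfolded SS,
          OF tensor_class_in_tensor[OF s0] tensor_class_self[OF s0], of 0 0] by simp
    then have "c * 1 \<le> c * injective_norm S S ?u0" by (rule mult_left_mono) simp
    also have "\<dots> \<le> 1" using \<alpha>0_le c[OF tensor_class_in_tensor[OF s0]] by simp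
    finally have c1: "c \<le> 1" by simp
    let ?p = "\<lambda>i. if i < 2 then 1 else 0 :: 'k"
    let ?m = "\<lambda>i. if i < 2 then (if i = 0 then 1 else - 1) else 0 :: 'k"
    let ?s = "[(?e 0, ?p), (?e 1, ?m)]"
    let ?u = "tensor_class S S ?s"
    have pm: "?p \<in> carrier S" "?m \<in> carrier S"
      by (rule truncation_closed[where ?'k = 'k, unfolded SS])+
    have s: "set ?s \<subseteq> carrier S \<times> carrier S" using e pm by auto
    have "2 \<le> bess_crossnorm S unit_basis S unit_basis ?u"
      unfolding bess_crossnorm_def
    proof (rule INF_greatest)
      fix t assume t: "t \<in> ?u"
      let ?a = "\<lambda>i. if i < 2 then 1 else 0 :: real"
      have a: "?a \<in> C" "\<And>i. 0 \<le> ?a i" using two_mem[of "\<lambda>_. 1"] by simp_all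
      \<comment> \<open>a functional norming \<open>e\<^sub>0 + e\<^sub>1\<close> in both factors\<close>
      obtain f where f: "f \<in> dual_ball S" and le: "ennreal (N ?a) \<le> (\<Sum>m. ennreal (?a m * norm (f (?e m))))"
        by (rule norming_coefficients[where ?'k = 'k, unfolded SS, OF a])
      have "(\<Sum>m. ennreal (?a m * norm (f (?e m)))) = (\<Sum>m<2. ennreal (?a m * norm (f (?e m))))"
        by (rule suminf_finite) auto
      also have "\<dots> = ennreal (norm (f (?e 0)) + norm (f (?e 1)))"
        by (simp add: numeral_2_eq_2 ennreal_plus)
      finally have f_ge: "sqrt 2 \<le> norm (f (?e 0)) + norm (f (?e 1))"
        using le N2[of "\<lambda>_. 1"] by (simp flip: ennreal_plus)
      have "2 = sqrt 2 * sqrt 2" by simp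
      also have "\<dots> \<le> (norm (f (?e 0)) + norm (f (?e 1))) * (norm (f (?e 0)) + norm (f (?e 1)))"
        by (intro mult_mono f_ge) auto
      also have "\<dots> = (\<Sum>m<2. \<Sum>n<2. norm (f (?e m)) * norm (coeff S t m n) * norm (f (?e n)))"
        unfolding coeff_class[OF t] coeff by (simp add: numeral_2_eq_2 algebra_simps)
      finally have "ennreal 2 \<le> ennreal (\<Sum>m<2. \<Sum>n<2. norm (f (?e m)) * norm (coeff S t m n) * norm (f (?e n)))"
        by (rule ennreal_leI)
      also note pairing[OF f f carr[OF t s]]
      finally show "2 \<le> bess S unit_basis S unit_basis t" by simp
    qed
    also have "\<dots> = c * injective_norm S S ?u" by (rule c[OF tensor_class_in_tensor[OF s]])
    also have "\<dots> \<le> 1 * injective_norm S S ?u" by (rule mult_right_mono[OF c1]) simp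
    also have "1 * injective_norm S S ?u \<le> ennreal (sqrt 2)"
      unfolding mult_1 injective_norm_eq[OF S tensor_class_in_tensor[OF s] tensor_class_self[OF s]]
    proof (rule SUP_least, clarify, rule ennreal_leI)
      fix f g assume f: "f \<in> dual_ball S" and g: "g \<in> dual_ball S"
      note tr = functional_truncation[where ?'k = 'k, unfolded SS, OF dual_ball_linear[OF g], of 2]
      have gp: "g ?p = g (?e 0) + g (?e 1)"
        using tr[of "\<lambda>_. 1"] by (simp add: numeral_2_eq_2)
      have gm: "g ?m = g (?e 0) - g (?e 1)"
        using tr[of "\<lambda>i. if i = 0 then 1 else - 1"] by (simp add: numeral_2_eq_2)
      have "norm (\<Sum>(x, y)\<leftarrow>?s. f x * g y)
          = norm (f (?e 0) * (g (?e 0) + g (?e 1)) + f (?e 1) * (g (?e 0) - g (?e 1)))"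
        using gp gm by simp
      also have "\<dots> \<le> norm (f (?e 0)) * norm (g (?e 0) + g (?e 1)) + norm (f (?e 1)) * norm (g (?e 0) - g (?e 1))"
        by (rule order_trans[OF norm_triangle_ineq]) (simp add: norm_mult)
      also have "\<dots> \<le> sqrt 2"
        by (rule two_le[OF dual[OF f]]) (use dual[OF g] in \<open>simp_all add: parallelogram_scalar\<close>)
      finally show "norm (\<Sum>(x, y)\<leftarrow>?s. f x * g y) \<le> sqrt 2" .
    qed
    finally have "ennreal 2 \<le> ennreal (sqrt 2)" by simp
    then have "2 \<le> sqrt 2" by (subst (asm) ennreal_le_iff) auto
    then show False using sqrt2_less_2 by linarith
  qed

  show "\<nexists>c. \<forall>u \<in> tensor S S. bess_crossnorm S unit_basis S unit_basis u
        = c * projective_norm (bess_space S unit_basis) (bess_space S unit_basis) u"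
  proof
    assume "\<exists>c. \<forall>u \<in> tensor S S. bess_crossnorm S unit_basis S unit_basis u
        = c * projective_norm (bess_space S unit_basis) (bess_space S unit_basis) u"
    then obtain c where c': "\<And>u. u \<in> tensor S S \<Longrightarrow> bess_crossnorm S unit_basis S unit_basis u
        = c * projective_norm (bess_space S unit_basis) (bess_space S unit_basis) u" by blast
    have c: "bess_crossnorm S unit_basis S unit_basis u = c * projective_norm S S u"
      if "u \<in> tensor S S" for u
      using c'[OF that] projective_norm_bess_space[OF S S nB nB that] by simp
    have "projective_norm S S ?u0 \<le> 1"
      unfolding projective_norm_def
      by (rule INF_lower2[OF tensor_class_self[OF s0]]) (simp add: ne)
    then have "c * projective_norm S S ?u0 \<le> c * 1" by (rule mult_left_mono) simp
    then have c1: "1 \<le> c" using \<alpha>0_ge c[OF tensor_class_in_tensor[OF s0]] by simp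
    let ?s = "[(?e 0, ?e 0), (?e 1, ?e 1)]"
    let ?u = "tensor_class S S ?s"
    have s: "set ?s \<subseteq> carrier S \<times> carrier S" using e by auto
    have two: "norm (x 0 * y 0 + x 1 * y 1) \<le> nrm S x * nrm S y"
      if x: "x \<in> carrier S" and y: "y \<in> carrier S" for x y
    proof -
      have part: "sqrt ((norm (x 0))\<^sup>2 + (norm (x 1))\<^sup>2) \<le> nrm S x" if x: "x \<in> carrier S" for x
      proof -
        have "(\<lambda>i. norm (x i)) \<in> C" using x unfolding S_eq by simp
        then have "N (\<lambda>i. if i < 2 then norm (x i) else 0) \<le> N (\<lambda>i. norm (x i))" by (rule N_mono) auto
        then show ?thesis using N2[of "\<lambda>i. norm (x i)"] unfolding S_eq by simp
      qed
      have "norm (x 0 * y 0 + x 1 * y 1) \<le> norm (x 0) * norm (y 0) + norm (x 1) * norm (y 1)"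
        by (rule order_trans[OF norm_triangle_ineq]) (simp add: norm_mult)
      also have "\<dots> \<le> sqrt (((norm (x 0))\<^sup>2 + (norm (x 1))\<^sup>2) * ((norm (y 0))\<^sup>2 + (norm (y 1))\<^sup>2))"
        by (rule real_le_rsqrt[OF cauchy_schwarz_two])
      also have "\<dots> = sqrt ((norm (x 0))\<^sup>2 + (norm (x 1))\<^sup>2) * sqrt ((norm (y 0))\<^sup>2 + (norm (y 1))\<^sup>2)"
        by (rule real_sqrt_mult)
      also have "\<dots> \<le> nrm S x * nrm S y"
        by (intro mult_mono part x y T.F.nrm_nonneg) auto
      finally show ?thesis .
    qed
    have "2 \<le> projective_norm S S ?u"
      unfolding projective_norm_def
    proof (rule INF_greatest)
      fix t assume t: "t \<in> ?u"
      \<comment> \<open>the trace is a functional bounded by the projective norm\<close>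
      have "ennreal (norm (coeff S t 0 0 + coeff S t 1 1)) \<le> (\<Sum>(x, y)\<leftarrow>t. ennreal (nrm S x * nrm S y))"
        using carr[OF t s]
      proof (induction t)
        case Nil
        show ?case by (simp add: coeff del: coeff.simps)
      next
        case (Cons p t)
        have p: "fst p \<in> carrier S" "snd p \<in> carrier S" and t: "set t \<subseteq> carrier S \<times> carrier S"
          using Cons.prems by auto
        let ?d = "fst p 0 * snd p 0 + fst p 1 * snd p 1"
        have "coeff S (p # t) 0 0 + coeff S (p # t) 1 1 = ?d + (coeff S t 0 0 + coeff S t 1 1)"
          unfolding coeff by (simp add: case_prod_unfold)
        then have "ennreal (norm (coeff S (p # t) 0 0 + coeff S (p # t) 1 1))
            \<le> ennreal (norm ?d) + ennreal (norm (coeff S t 0 0 + coeff S t 1 1))"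
          by (simp only: ennreal_plus[symmetric] norm_ge_zero ennreal_leI norm_triangle_ineq)
        also have "\<dots> \<le> ennreal (nrm S (fst p) * nrm S (snd p)) + (\<Sum>(x, y)\<leftarrow>t. ennreal (nrm S x * nrm S y))"
          by (intro add_mono ennreal_leI two p Cons.IH[OF t])
        finally show ?case by (simp only: list.map sum_list.Cons case_prod_unfold)
      qed
      moreover have "coeff S t 0 0 + coeff S t 1 1 = 2"
        unfolding coeff_class[OF t] coeff by simp
      ultimately show "2 \<le> (\<Sum>(x, y)\<leftarrow>t. ennreal (nrm S x * nrm S y))" by simp
    qed
    then have "1 * 2 \<le> c * projective_norm S S ?u" by (rule mult_mono[OF c1]) auto
    also have "\<dots> = bess_crossnorm S unit_basis S unit_basis ?u"
      by (rule c[OF tensor_class_in_tensor[OF s], symmetric])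
    also have "\<dots> \<le> bess S unit_basis S unit_basis ?s"
      unfolding bess_crossnorm_def by (rule INF_lower[OF tensor_class_self[OF s]])
    also have "\<dots> \<le> 1"
      unfolding bess_def bess_product
    proof (rule SUP_least, clarify)
      fix f g assume f: "f \<in> dual_ball S" and g: "g \<in> dual_ball S"
      have head: "(\<Sum>m. ennreal (norm (snd (unit_basis m) (?e i) * f (fst (unit_basis m))))) = ennreal (norm (f (?e i)))"
        for f :: "(nat \<Rightarrow> 'k) \<Rightarrow> 'k" and i
      proof -
        have "(\<Sum>m. ennreal (norm (snd (unit_basis m) (?e i) * f (fst (unit_basis m)))))
            = (\<Sum>m\<in>{i}. ennreal (norm (snd (unit_basis m) (?e i) * f (fst (unit_basis m)))))"
          by (rule suminf_finite) auto
        then show ?thesis by simp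
      qed
      have "norm (f (?e 0)) * norm (g (?e 0)) + norm (f (?e 1)) * norm (g (?e 1)) \<le> 1"
        by (rule two_le[OF dual[OF f]]) (use dual[OF g] in auto)
      then show "(\<Sum>(x, y)\<leftarrow>?s. (\<Sum>m. ennreal (norm (snd (unit_basis m) x * f (fst (unit_basis m)))))
          * (\<Sum>n. ennreal (norm (snd (unit_basis n) y * g (fst (unit_basis n)))))) \<le> 1"
        by (simp only: list.map sum_list.Cons sum_list.Nil split head)
           (simp flip: ennreal_mult ennreal_plus)
    qed
    finally show False by simp
  qed
qed


section \<open>Besselian tensor products of the classical sequence spaces\<close>

theorem proposition3:
  "(\<forall>u \<in> tensor (c0 :: ('k::real_or_complex, nat \<Rightarrow> 'k) nspace) (c0 :: ('k, nat \<Rightarrow> 'k) nspace).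
      bess_crossnorm c0 unit_basis c0 unit_basis u
        = injective_norm (bess_space c0 unit_basis) (bess_space c0 unit_basis) u \<and>
      injective_norm (bess_space c0 unit_basis) (bess_space c0 unit_basis) u
        = injective_norm c0 c0 u) \<and>
   completion (tensor_space c0 c0 (bess_crossnorm c0 unit_basis c0 unit_basis))
     = completion (tensor_space (c0 :: ('k, nat \<Rightarrow> 'k) nspace) (c0 :: ('k, nat \<Rightarrow> 'k) nspace)
         (injective_norm c0 c0)) \<and>
   isometrically_isomorphic
     (completion (tensor_space (c0 :: ('k, nat \<Rightarrow> 'k) nspace) (c0 :: ('k, nat \<Rightarrow> 'k) nspace)
        (injective_norm c0 c0)))
     (c0 :: ('k, nat \<Rightarrow> 'k) nspace) \<and>

   (\<forall>u \<in> tensor (ell 1 :: ('k, nat \<Rightarrow> 'k) nspace) (ell 1 :: ('k, nat \<Rightarrow> 'k) nspace).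
      bess_crossnorm (ell 1) unit_basis (ell 1) unit_basis u
        = projective_norm (bess_space (ell 1) unit_basis) (bess_space (ell 1) unit_basis) u \<and>
      projective_norm (bess_space (ell 1) unit_basis) (bess_space (ell 1) unit_basis) u
        = projective_norm (ell 1) (ell 1) u) \<and>
   completion (tensor_space (ell 1) (ell 1)
       (bess_crossnorm (ell 1) unit_basis (ell 1) unit_basis))
     = completion (tensor_space (ell 1 :: ('k, nat \<Rightarrow> 'k) nspace) (ell 1 :: ('k, nat \<Rightarrow> 'k) nspace)
         (projective_norm (ell 1) (ell 1))) \<and>
   isometrically_isomorphic
     (completion (tensor_space (ell 1 :: ('k, nat \<Rightarrow> 'k) nspace) (ell 1 :: ('k, nat \<Rightarrow> 'k) nspace)
        (projective_norm (ell 1) (ell 1))))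
     (ell 1 :: ('k, nat \<Rightarrow> 'k) nspace) \<and>

   (\<nexists>c. \<forall>u \<in> tensor (ell 2 :: ('k, nat \<Rightarrow> 'k) nspace) (ell 2 :: ('k, nat \<Rightarrow> 'k) nspace).
      bess_crossnorm (ell 2) unit_basis (ell 2) unit_basis u
        = c * injective_norm (bess_space (ell 2) unit_basis) (bess_space (ell 2) unit_basis) u) \<and>
   (\<nexists>c. \<forall>u \<in> tensor (ell 2 :: ('k, nat \<Rightarrow> 'k) nspace) (ell 2 :: ('k, nat \<Rightarrow> 'k) nspace).
      bess_crossnorm (ell 2) unit_basis (ell 2) unit_basis u
        = c * projective_norm (bess_space (ell 2) unit_basis) (bess_space (ell 2) unit_basis) u) \<and>

   (\<forall>p\<ge>1. isometrically_isomorphic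
      (completion (tensor_space (ell p :: ('k, nat \<Rightarrow> 'k) nspace) (ell 1 :: ('k, nat \<Rightarrow> 'k) nspace)
         (bess_crossnorm (ell p) unit_basis (ell 1) unit_basis)))
      (lp_space p (ell 1 :: ('k, nat \<Rightarrow> 'k) nspace))) \<and>

   \<comment> \<open>the isometry is for the Besselian norm on the terms of the sequences in \<open>c\<^sub>0(F)\<close>; for the
      original norm of \<open>F\<close>, which is only equivalent to it, the isomorphism is topological\<close>
   (\<forall>(F :: ('k, 'b) nspace) G. banach_space F \<longrightarrow> USB F G \<longrightarrow>
      isometrically_isomorphic
        (completion (tensor_space c0 F (bess_crossnorm c0 unit_basis F G)))
        (c0_space (bess_space F G)) \<and>
      linearly_homeomorphic
        (completion (tensor_space c0 F (bess_crossnorm c0 unit_basis F G)))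
        (c0_space F))"

proof (intro conjI ballI allI impI)
  let ?c = "c0 :: ('k, nat \<Rightarrow> 'k) nspace" and ?l = "ell 1 :: ('k, nat \<Rightarrow> 'k) nspace"
  have inj: "injective_norm (bess_space ?c unit_basis) (bess_space ?c unit_basis) = injective_norm ?c ?c"
    by (rule injective_norm_bess_space) (rule bess_nrm_c0, assumption)+
  have \<epsilon>: "bess_crossnorm ?c unit_basis ?c unit_basis u = injective_norm ?c ?c u" if "u \<in> tensor ?c ?c" for u
    using crossnorm_c0_c0[OF that rep_in_tensor[OF that]] by simp
  have proj: "projective_norm (bess_space ?l unit_basis) (bess_space ?l unit_basis) u = projective_norm ?l ?l u"
    if "u \<in> tensor ?l ?l" for u
    by (rule projective_norm_bess_space[OF normed_ell normed_ell bess_nrm_ell bess_nrm_ell that]) simp_all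
  have \<pi>: "bess_crossnorm ?l unit_basis ?l unit_basis u = projective_norm ?l ?l u" if "u \<in> tensor ?l ?l" for u
    using crossnorm_ell_1[OF that rep_in_tensor[OF that]] by simp
  {
    fix u assume u: "u \<in> tensor ?c ?c"
    show "bess_crossnorm ?c unit_basis ?c unit_basis u
        = injective_norm (bess_space ?c unit_basis) (bess_space ?c unit_basis) u"
      unfolding inj by (rule \<epsilon>[OF u])
    show "injective_norm (bess_space ?c unit_basis) (bess_space ?c unit_basis) u = injective_norm ?c ?c u"
      unfolding inj ..
  next
    fix u assume u: "u \<in> tensor ?l ?l"
    show "bess_crossnorm ?l unit_basis ?l unit_basis u
        = projective_norm (bess_space ?l unit_basis) (bess_space ?l unit_basis) u"
      unfolding proj[OF u] by (rule \<pi>[OF u])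
    show "projective_norm (bess_space ?l unit_basis) (bess_space ?l unit_basis) u = projective_norm ?l ?l u"
      by (rule proj[OF u])
  }
  show "completion (tensor_space ?c ?c (bess_crossnorm ?c unit_basis ?c unit_basis))
      = completion (tensor_space ?c ?c (injective_norm ?c ?c))"
    by (rule arg_cong[where f = completion], rule tensor_space_cong) (rule \<epsilon>)
  show "isometrically_isomorphic (completion (tensor_space ?c ?c (injective_norm ?c ?c))) ?c"
    by (rule completion_c0_c0)
  show "completion (tensor_space ?l ?l (bess_crossnorm ?l unit_basis ?l unit_basis))
      = completion (tensor_space ?l ?l (projective_norm ?l ?l))"
    by (rule arg_cong[where f = completion], rule tensor_space_cong) (rule \<pi>)
  show "isometrically_isomorphic (completion (tensor_space ?l ?l (projective_norm ?l ?l))) ?l"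
    by (rule completion_ell_1)
next
  show "\<nexists>c. \<forall>u \<in> tensor (ell 2 :: ('k, nat \<Rightarrow> 'k) nspace) (ell 2 :: ('k, nat \<Rightarrow> 'k) nspace).
      bess_crossnorm (ell 2) unit_basis (ell 2) unit_basis u
        = c * injective_norm (bess_space (ell 2) unit_basis) (bess_space (ell 2) unit_basis) u"
    by (rule ell_2_not_injective)
  show "\<nexists>c. \<forall>u \<in> tensor (ell 2 :: ('k, nat \<Rightarrow> 'k) nspace) (ell 2 :: ('k, nat \<Rightarrow> 'k) nspace).
      bess_crossnorm (ell 2) unit_basis (ell 2) unit_basis u
        = c * projective_norm (bess_space (ell 2) unit_basis) (bess_space (ell 2) unit_basis) u"
    by (rule ell_2_not_projective)
next
  fix p :: real assume "1 \<le> p"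
  then show "isometrically_isomorphic
      (completion (tensor_space (ell p :: ('k, nat \<Rightarrow> 'k) nspace) (ell 1 :: ('k, nat \<Rightarrow> 'k) nspace)
         (bess_crossnorm (ell p) unit_basis (ell 1) unit_basis)))
      (lp_space p (ell 1 :: ('k, nat \<Rightarrow> 'k) nspace))"
    by (rule completion_ell)
next
  fix F :: "('k, 'b) nspace" and G
  assume F: "banach_space F" and G: "USB F G"
  obtain K where "\<And>x. x \<in> carrier F \<Longrightarrow> bess_norm F G x \<le> ennreal (K * nrm F x)"
    using USB_bess_norm_le[OF F G] by blast
  then have B: "banach_space (bess_space F G)"
    by (rule banach_bess_space[OF F USB_bessel_system[OF F G]])
  show iso: "isometrically_isomorphic (completion (tensor_space c0 F (bess_crossnorm c0 unit_basis F G)))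
      (c0_space (bess_space F G))"
    by (rule completion_c0[OF USB_bessel_system[OF F G] B])
  show "linearly_homeomorphic (completion (tensor_space c0 F (bess_crossnorm c0 unit_basis F G)))
      (c0_space F)"
    by (rule linearly_homeomorphic_c0[OF F G iso])
qed

end
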